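(* Assume there is a constant $0<c_1<\infty$ such that $\max_{1\le i\le n}|f_0(x_i)|\le c_1$. Let $C_0>0$ and for $m\in\mathcal{M}$ let $$\hat f_m=\arg\min_{t\in \mathcal{S}_m\cap \mathbb{L}_\infty(C_0)}\gamma_n(t),\qquad f_m=\arg\min_{t\in \mathcal{S}_m\cap \mathbb{L}_\infty(C_0)}\gamma(t).$$ Let $\{L_m\}_{m\in\mathcal{M}}$ be positive numbers with $\Sigma=\sum_{m\in\mathcal{M}}\exp(-L_mD_m)<\infty$. Let $\mathrm{pen}:\mathcal{M}\to\mathbb{R}_+$ satisfy, for all $m\in\mathcal{M}$, $$\mathrm{pen}(m)\ge \lambda\frac{D_m}{n}\Big(\frac12+\sqrt{5L_m}\Big)^2,$$ where $\lambda$ is a (suitable) positive constant depending on $c_1$, and let $\hat m=\arg\min_{m\in\mathcal{M}}\{\gamma_n(\hat f_m)+\mathrm{pen}(m)\}$. Then $$\mathbb{E}_{f_0}\big[\mathcal{K}(\mathbb{P}_{f_0}^{(n)},\mathbb{P}_{\hat f_{\hat m}}^{(n)})\big]\le C\inf_{m\in\mathcal{M}}\big\{\mathcal{K}(\mathbb{P}_{f_0}^{(n)},\mathbb{P}_{f_m}^{(n)})+\mathrm{pen}(m)\big\}+C_1\frac{\Sigma}{n}$$ and $$\mathbb{E}_{f_0}\|\hat f_{\hat m}-f_0\|_n^2\le C'\inf_{m\in\mathcal{M}}\big\{\|f_0-f_m\|_n^2+\mathrm{pen}(m)\big\}+C_1'\frac{\Sigma}{n},$$ where $C,C',C_1,C_1'$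 are constants depending on $c_1$ and $C_0$.
   Context: Observations $(Y_1,x_1),\dots,(Y_n,x_n)\in\{0,1\}\times\mathcal{X}$ with deterministic design points $x_i$ and independent $Y_i$ satisfying $\mathbb{E}_{f_0}(Y_i)=\pi_{f_0}(x_i)$, where for $f:\mathcal{X}\to\mathbb{R}$, $\pi_f(x)=e^{f(x)}/(1+e^{f(x)})$, and $f_0$ is unknown. $\mathbb{P}^{(n)}_f$ is the law of $(Y_1,\dots,Y_n)$ when the $Y_i$ are independent Bernoulli$(\pi_f(x_i))$. $\gamma_n(f)=\frac1n\sum_{i=1}^n\{\log(1+e^{f(x_i)})-Y_if(x_i)\}$, $\gamma(f)=\mathbb{E}_{f_0}[\gamma_n(f)]$, and $\mathcal{K}(\mathbb{P}_{f_0}^{(n)},\mathbb{P}_{f}^{(n)})=\frac1n\sum_{i=1}^n\big[\pi_{f_0}(x_i)\log\frac{\pi_{f_0}(x_i)}{\pi_f(x_i)}+(1-\pi_{f_0}(x_i))\log\frac{1-\pi_{f_0}(x_i)}{1-\pi_f(x_i)}\big]$. $\|f\|_n^2=\frac1n\sum_{i=1}^nf(x_i)^2$ and $\langle f,g\rangle_n=\frac1n\sum_i f(x_i)g(x_i)$. A dictionary $\{\phi_1,\dots,\phi_M\}$ orthonormal for $\langle\cdot,\cdot\rangle_n$ is fixed; $\mathcal{M}$ is the set of subsets $m\subset\{1,\dots,M\}$, $\mathcal{S}_m=\{\sum_{j\in m}\beta_j\phi_j\}$, and $D_m$ is the dimension of $\mathrm{span}\{\phi_j,j\in m\}$. $\mathbb{L}_\infty(C_0)=\{f:\max_{1\le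 i\le n}|f(x_i)|\le C_0\}$. *)

theory Defs
  imports "HOL-Analysis.Analysis" "HOL-Library.Function_Algebras"
begin

(* Design points are x 0, ..., x (n-1); responses Y :: nat => real with Y i in {0,1}. *)

definition logistic :: "real \<Rightarrow> real" where
  "logistic t = exp t / (1 + exp t)"

definition pif :: "('x \<Rightarrow> real) \<Rightarrow> 'x \<Rightarrow> real" where
  "pif f z = logistic (f z)"

definition resp_space :: "nat \<Rightarrow> (nat \<Rightarrow> real) set" where
  "resp_space n = PiE {..<n} (\<lambda>_. {0, 1})"

(* E_{f0}[g(Y)] where Y_i independent Bernoulli(pi_{f0}(x_i)) *)
definition expect :: "nat \<Rightarrow> (nat \<Rightarrow> 'x) \<Rightarrow> ('x \<Rightarrow> real) \<Rightarrow> ((nat \<Rightarrow> real) \<Rightarrow> real) \<Rightarrow> real" where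
  "expect n x f0 g =
     (\<Sum>y\<in>resp_space n. (\<Prod>i<n. if y i = 1 then pif f0 (x i) else 1 - pif f0 (x i)) * g y)"

definition gamma_n :: "nat \<Rightarrow> (nat \<Rightarrow> 'x) \<Rightarrow> (nat \<Rightarrow> real) \<Rightarrow> ('x \<Rightarrow> real) \<Rightarrow> real" where
  "gamma_n n x Y f = (1 / real n) * (\<Sum>i<n. ln (1 + exp (f (x i))) - Y i * f (x i))"

definition gamma :: "nat \<Rightarrow> (nat \<Rightarrow> 'x) \<Rightarrow> ('x \<Rightarrow> real) \<Rightarrow> ('x \<Rightarrow> real) \<Rightarrow> real" where
  "gamma n x f0 f = expect n x f0 (\<lambda>Y. gamma_n n x Y f)"

definition KL :: "nat \<Rightarrow> (nat \<Rightarrow> 'x) \<Rightarrow> ('x \<Rightarrow> real) \<Rightarrow> ('x \<Rightarrow> real) \<Rightarrow> real" where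
  "KL n x f0 f = (1 / real n) * (\<Sum>i<n.
      pif f0 (x i) * ln (pif f0 (x i) / pif f (x i))
    + (1 - pif f0 (x i)) * ln ((1 - pif f0 (x i)) / (1 - pif f (x i))))"

definition inner_n :: "nat \<Rightarrow> (nat \<Rightarrow> 'x) \<Rightarrow> ('x \<Rightarrow> real) \<Rightarrow> ('x \<Rightarrow> real) \<Rightarrow> real" where
  "inner_n n x f g = (1 / real n) * (\<Sum>i<n. f (x i) * g (x i))"

definition norm_n_sq :: "nat \<Rightarrow> (nat \<Rightarrow> 'x) \<Rightarrow> ('x \<Rightarrow> real) \<Rightarrow> real" where
  "norm_n_sq n x f = (1 / real n) * (\<Sum>i<n. (f (x i))\<^sup>2)"

definition S_m :: "(nat \<Rightarrow> 'x \<Rightarrow> real) \<Rightarrow> nat set \<Rightarrow> ('x \<Rightarrow> real) set" where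
  "S_m phi m = {f. \<exists>beta :: nat \<Rightarrow> real. f = (\<lambda>z. \<Sum>j\<in>m. beta j * phi j z)}"

definition Linf :: "nat \<Rightarrow> (nat \<Rightarrow> 'x) \<Rightarrow> real \<Rightarrow> ('x \<Rightarrow> real) set" where
  "Linf n x C0 = {f. \<forall>i<n. \<bar>f (x i)\<bar> \<le> C0}"

definition D_m :: "(nat \<Rightarrow> 'x \<Rightarrow> real) \<Rightarrow> nat set \<Rightarrow> nat" where
  "D_m phi m = vector_space.dim (\<lambda>(c::real) (f::'x \<Rightarrow> real) z. c * f z) (phi ` m)"

end

theory Submission
  imports Defs
begin

text \<open>
  The penalty constant may depend on \<open>c1\<close> only, so the likelihood gain
  \<open>L(t) = \<Sum>i. ln (p_t(Y i) / p_f0(Y i))\<close> over a linear model of dimension \<open>d\<close> has to be bounded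
  without any help from the sup-norm bound \<open>C0\<close>: the point is that
  \<open>E exp (c * sup L) \<le> A ^ d\<close> with \<open>c\<close> and \<open>A\<close> depending on \<open>c1\<close> only.

  Put Lebesgue measure on a large box of coefficients. For a set \<open>R\<close> of observations, the Bayes
  predictive probability \<open>Q\<close> of \<open>Y i\<close> given the observations in \<open>R - {i}\<close> is a ratio of marginal
  likelihoods, so \<open>(1 + Q / p_f0(Y i)) / 2\<close> has conditional mean 1. Multiplying these factors along
  a random order of the observations (second half only) gives a variable of mean 1. It remains to
  bound it from below, for every outcome, by \<open>exp (c * L(t) - K * d)\<close>. This rests on two facts about
  the posterior given \<open>R\<close>. Dilating the box about a point shows that the total posterior dispersion
  of the linear predictors, measured by \<open>\<Sum>i. E ((z i - a i) * (logistic (z i) - logistic (a i)))\<close>,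
  is at most \<open>d\<close>. And since one-dimensional marginals of log-concave measures are log-concave
  (Prekopa-Leindler), leaving out observation \<open>i\<close> lowers its predictive probability by at most a
  constant times its share of that dispersion.

  The gain is applied at the midpoint of the estimator and \<open>f0\<close>. Strict convexity of the log-partition
  function on the bounded range of the estimator, the only place where \<open>C0\<close> enters, then turns the
  bound into the oracle inequalities, and the misspecification of the model costs just one extra
  dimension, the direction \<open>f0\<close>.
\<close>

text \<open>Only the total dispersion is controlled, so one observation may carry a large share of
  it. In a random order, the step that removes one of \<open>r\<close> observations pays the average
  share, of order \<open>d / r\<close>. Summed over all \<open>r\<close> this would put a multiple
  of \<open>ln n\<close> into the exponent; over \<open>n/2 < r \<le> n\<close> it stays bounded, at
  the price of collecting only about half of the log-likelihood ratio. Averaging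
  \<open>Q / p\<close> with 1 keeps the relevant denominator \<open>p + Q\<close> above the lower
  bound of the label probabilities; with \<open>Q / p\<close> alone the loss would have
  \<open>Q\<close> in the denominator, which has no lower bound. The arithmetic-geometric mean
  inequality for this average costs another factor 1/2, hence an exponent between 1/4 and 1/2. The
  coefficients range over an unbounded set, but there are only finitely many outcomes, so some box
  contains every coefficient vector that occurs, and no constant depends on its size.\<close>

section \<open>The Prekopa-Leindler inequality\<close>

lemma emeasure_lborel_affine_preimage:
  fixes H :: "real set"
  assumes "H \<in> sets borel" "c > 0"
  shows "emeasure lborel H = ennreal c * emeasure lborel {x. t + c * x \<in> H}"
proof -
  have m: "{x. t + c * x \<in> H} \<in> sets lborel"
  proof -
    have "(\<lambda>x. t + c * x) -` H \<inter> space borel \<in> sets borel"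
      by (rule measurable_sets[of _ borel borel]) (use assms in auto)
    thus ?thesis by (simp add: vimage_def)
  qed
  have "emeasure lborel H = (\<integral>\<^sup>+x. indicator H x \<partial>lborel)"
    using assms by simp
  also have "\<dots> = ennreal \<bar>c\<bar> * (\<integral>\<^sup>+x. indicator H (t + c * x) \<partial>lborel)"
    by (rule nn_integral_real_affine) (use assms in auto)
  also have "(\<lambda>x. indicator H (t + c * x) :: ennreal) = indicator {x. t + c * x \<in> H}"
    by (auto simp: indicator_def)
  also have "(\<integral>\<^sup>+x. indicator {x. t + c * x \<in> H} x \<partial>lborel) = emeasure lborel {x. t + c * x \<in> H}"
    using m by simp
  finally show ?thesis using assms by simp
qed

text \<open>The Minkowski sum need not be Borel, hence an arbitrary Borel set \<open>H\<close>
  containing it. Near-extremal points \<open>x1\<close> of \<open>A\<close> and \<open>y0\<close> of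
  \<open>B\<close> give two scaled copies, of \<open>A\<close> moved by \<open>l * y0\<close> and of
  \<open>B\<close> moved by \<open>(1 - l) * x1\<close>, that lie in \<open>H\<close> on opposite
  sides of the common point \<open>c\<close>, so their measures add. Cutting the sets at
  \<open>x1\<close> and \<open>y0\<close> costs at most \<open>e\<close> each.\<close>

lemma brunn_minkowski_real:
  fixes A B H :: "real set" and l :: real
  assumes mA: "A \<in> sets borel" and mB: "B \<in> sets borel" and mH: "H \<in> sets borel"
    and bA: "bounded A" and bB: "bounded B" and nA: "A \<noteq> {}" and nB: "B \<noteq> {}"
    and l: "0 < l" "l < 1"
    and sub: "\<And>x y. x \<in> A \<Longrightarrow> y \<in> B \<Longrightarrow> (1 - l) * x + l * y \<in> H"
  shows "ennreal (1 - l) * emeasure lborel A + ennreal l * emeasure lborel B \<le> emeasure lborel H"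
proof (rule ennreal_le_epsilon)
  fix e :: real assume e: "e > 0"
  have bdA: "bdd_above A" "bdd_below B" using bA bB bounded_imp_bdd_above bounded_imp_bdd_below by auto
  obtain x1 where x1: "x1 \<in> A" "Sup A - e < x1"
    using less_cSup_iff[OF nA bdA(1), of "Sup A - e"] e by auto
  obtain y0 where y0: "y0 \<in> B" "y0 < Inf B + e"
    using cInf_less_iff[OF nB bdA(2), of "Inf B + e"] e by auto
  define c where "c = (1 - l) * x1 + l * y0"
  have A1: "emeasure lborel A \<le> emeasure lborel (A \<inter> {..x1}) + ennreal e"
  proof -
    have "emeasure lborel A \<le> emeasure lborel ((A \<inter> {..x1}) \<union> {x1..x1+e})"
    proof (rule emeasure_mono)
      show "A \<subseteq> (A \<inter> {..x1}) \<union> {x1..x1+e}"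
      proof
        fix x assume "x \<in> A"
        moreover have "x \<le> Sup A" using \<open>x \<in> A\<close> bdA(1) by (rule cSup_upper)
        ultimately show "x \<in> (A \<inter> {..x1}) \<union> {x1..x1+e}" using x1 by auto
      qed
    qed (use mA in auto)
    also have "\<dots> \<le> emeasure lborel (A \<inter> {..x1}) + emeasure lborel {x1..x1+e}"
      by (rule emeasure_subadditive) (use mA in auto)
    finally show ?thesis using e by simp
  qed
  have B1: "emeasure lborel B \<le> emeasure lborel (B \<inter> {y0<..}) + ennreal e"
  proof -
    have "emeasure lborel B \<le> emeasure lborel ((B \<inter> {y0<..}) \<union> {y0-e..y0})"
    proof (rule emeasure_mono)
      show "B \<subseteq> (B \<inter> {y0<..}) \<union> {y0-e..y0}"
      proof
        fix x assume "x \<in> B"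
        moreover have "Inf B \<le> x" using \<open>x \<in> B\<close> bdA(2) by (rule cInf_lower)
        ultimately show "x \<in> (B \<inter> {y0<..}) \<union> {y0-e..y0}" using y0 by auto
      qed
    qed (use mB in auto)
    also have "\<dots> \<le> emeasure lborel (B \<inter> {y0<..}) + emeasure lborel {y0-e..y0}"
      by (rule emeasure_subadditive) (use mB in auto)
    finally show ?thesis using e by simp
  qed
  have mp: "{x. t + k * x \<in> H \<inter> S} \<in> sets lborel" if "S \<in> sets borel" for t k :: real and S
  proof -
    have "(\<lambda>x. t + k * x) -` (H \<inter> S) \<inter> space borel \<in> sets borel"
      by (rule measurable_sets[of _ borel borel]) (use mH that in auto)
    thus ?thesis by (simp add: vimage_def)
  qed
  have HA: "ennreal (1 - l) * emeasure lborel (A \<inter> {..x1}) \<le> emeasure lborel (H \<inter> {..c})"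
  proof -
    have "emeasure lborel (H \<inter> {..c}) = ennreal (1-l) * emeasure lborel {x. l * y0 + (1-l) * x \<in> H \<inter> {..c}}"
      by (rule emeasure_lborel_affine_preimage) (use mH l in auto)
    moreover have "A \<inter> {..x1} \<subseteq> {x. l * y0 + (1-l) * x \<in> H \<inter> {..c}}"
      using sub[OF _ y0(1)] l by (auto simp: c_def add.commute intro!: mult_left_mono)
    ultimately show ?thesis
      using emeasure_mono[OF _ mp[of "{..c}" "l * y0" "1-l"]] by (auto intro!: mult_left_mono)
  qed
  have HB: "ennreal l * emeasure lborel (B \<inter> {y0<..}) \<le> emeasure lborel (H \<inter> {c<..})"
  proof -
    have "emeasure lborel (H \<inter> {c<..}) = ennreal l * emeasure lborel {x. (1-l) * x1 + l * x \<in> H \<inter> {c<..}}"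
      by (rule emeasure_lborel_affine_preimage) (use mH l in auto)
    moreover have "B \<inter> {y0<..} \<subseteq> {x. (1-l) * x1 + l * x \<in> H \<inter> {c<..}}"
      using sub[OF x1(1)] l by (auto simp: c_def)
    ultimately show ?thesis
      using emeasure_mono[OF _ mp[of "{c<..}" "(1-l) * x1" "l"]] by (auto intro!: mult_left_mono)
  qed
  have "ennreal (1 - l) * emeasure lborel A + ennreal l * emeasure lborel B
      \<le> ennreal (1 - l) * (emeasure lborel (A \<inter> {..x1}) + ennreal e) + ennreal l * (emeasure lborel (B \<inter> {y0<..}) + ennreal e)"
    using A1 B1 by (intro add_mono mult_left_mono) auto
  also have "\<dots> = (ennreal (1 - l) * emeasure lborel (A \<inter> {..x1}) + ennreal l * emeasure lborel (B \<inter> {y0<..}))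
       + (ennreal (1-l) * ennreal e + ennreal l * ennreal e)"
    by (simp add: distrib_left ac_simps)
  also have "ennreal (1-l) * ennreal e + ennreal l * ennreal e = ennreal e"
    using l e by (simp flip: ennreal_mult ennreal_plus add: algebra_simps)
  also have "ennreal (1 - l) * emeasure lborel (A \<inter> {..x1}) + ennreal l * emeasure lborel (B \<inter> {y0<..})
      \<le> emeasure lborel (H \<inter> {..c}) + emeasure lborel (H \<inter> {c<..})"
    using HA HB by (rule add_mono)
  also have "\<dots> = emeasure lborel ((H \<inter> {..c}) \<union> (H \<inter> {c<..}))"
    by (rule plus_emeasure) (use mH in auto)
  also have "(H \<inter> {..c}) \<union> (H \<inter> {c<..}) = H" by auto
  finally show "ennreal (1 - l) * emeasure lborel A + ennreal l * emeasure lborel B \<le> emeasure lborel H + ennreal e"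
    by (simp add: add_right_mono)
qed

lemma nn_integral_layer_cake_unit:
  fixes f :: "real \<Rightarrow> real"
  assumes [measurable]: "f \<in> borel_measurable borel" and f: "\<And>x. 0 \<le> f x" "\<And>x. f x \<le> 1"
  shows "(\<integral>\<^sup>+x. ennreal (f x) \<partial>lborel)
       = (\<integral>\<^sup>+s. indicator {0..<1} s * emeasure lborel {x. s < f x} \<partial>lborel)"
proof -
  have "(\<integral>\<^sup>+x. ennreal (f x) \<partial>lborel) = (\<integral>\<^sup>+x. (\<integral>\<^sup>+s. indicator {0..<1} s * indicator {x. s < f x} x \<partial>lborel) \<partial>lborel)"
  proof (rule nn_integral_cong)
    fix x
    have "(\<lambda>s. indicator {0..<1} s * indicator {x. s < f x} x :: ennreal) = indicator {0..<f x}"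
      using f[of x] by (auto simp: indicator_def fun_eq_iff)
    thus "ennreal (f x) = (\<integral>\<^sup>+s. indicator {0..<1} s * indicator {x. s < f x} x \<partial>lborel)"
      using f(1)[of x] by simp
  qed
  also have "\<dots> = (\<integral>\<^sup>+s. (\<integral>\<^sup>+x. indicator {0..<1} s * indicator {x. s < f x} x \<partial>lborel) \<partial>lborel)"
    by (rule lborel_pair.Fubini') measurable
  also have "\<dots> = (\<integral>\<^sup>+s. indicator {0..<1} s * emeasure lborel {x. s < f x} \<partial>lborel)"
    by (intro nn_integral_cong) (simp add: nn_integral_cmult)
  finally show ?thesis .
qed

lemma weighted_am_gm_nat:
  fixes a b :: real
  assumes "0 \<le> a" "0 \<le> b" "p > 0" "q > (0::nat)"
  shows "a ^ p * b ^ q \<le> ((real p * a + real q * b) / real (p + q)) ^ (p + q)"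
proof (cases "a = 0 \<or> b = 0")
  case True
  thus ?thesis using assms by (auto intro!: zero_le_power divide_nonneg_nonneg simp: power_0_left)
next
  case False
  with assms have ab: "a > 0" "b > 0" by auto
  define m where "m = (real p * a + real q * b) / real (p + q)"
  have m: "m > 0" unfolding m_def using ab assms by (intro divide_pos_pos add_pos_pos mult_pos_pos) auto
  have "real p * ln (a / m) + real q * ln (b / m) \<le> real p * (a / m - 1) + real q * (b / m - 1)"
    using ab m by (intro add_mono mult_left_mono ln_le_minus_one) auto
  also have "\<dots> = (real p * a + real q * b) / m - real (p + q)"
    by (simp add: algebra_simps add_divide_distrib)
  also have "real p * a + real q * b = m * real (p + q)" using assms by (simp add: m_def)
  also have "m * real (p + q) / m - real (p + q) = 0" using m by simp
  finally have "real p * ln a + real q * ln b \<le> real (p + q) * ln m"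
    using ab m by (simp add: ln_div algebra_simps)
  hence "ln (a ^ p * b ^ q) \<le> ln (m ^ (p + q))"
    using ab m by (simp add: ln_mult ln_realpow)
  thus ?thesis using ab m unfolding m_def[symmetric] by simp
qed

text \<open>Integer weights replace the usual exponents in (0,1), so that the inequality can be stated with
  natural powers of extended nonnegative reals.\<close>

lemma prekopa_leindler_real:
  fixes f g h :: "real \<Rightarrow> ennreal"
  assumes [measurable]: "f \<in> borel_measurable borel" "g \<in> borel_measurable borel" "h \<in> borel_measurable borel"
    and pq: "p > 0" "q > (0::nat)"
    and bf: "\<And>x. f x \<le> ennreal C" and bg: "\<And>x. g x \<le> ennreal C"
    and sf: "\<And>x. \<bar>x\<bar> > b \<Longrightarrow> f x = 0" and sg: "\<And>x. \<bar>x\<bar> > b \<Longrightarrow> g x = 0"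
    and hfg: "\<And>x y. f x ^ p * g y ^ q \<le> h ((real p * x + real q * y) / real (p + q)) ^ (p + q)"
  shows "(\<integral>\<^sup>+x. f x \<partial>lborel) ^ p * (\<integral>\<^sup>+x. g x \<partial>lborel) ^ q \<le> (\<integral>\<^sup>+x. h x \<partial>lborel) ^ (p + q)"
proof (cases "(\<forall>x. f x = 0) \<or> (\<forall>x. g x = 0)")
  case True
  hence "(\<integral>\<^sup>+x. f x \<partial>lborel) = 0 \<or> (\<integral>\<^sup>+x. g x \<partial>lborel) = 0" by auto
  thus ?thesis using pq by (auto simp: power_0_left)
next
  case False
  define f' where "f' x = enn2real (f x)" for x
  define g' where "g' x = enn2real (g x)" for x
  have f_eq: "f x = ennreal (f' x)" and g_eq: "g x = ennreal (g' x)" for x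
    using bf[of x] bg[of x] by (auto simp: f'_def g'_def le_less_trans[OF _ ennreal_less_top] top.not_eq_extremum)
  have f'0: "f' x \<ge> 0" and g'0: "g' x \<ge> 0" for x by (auto simp: f'_def g'_def)
  have f'C: "f' x \<le> max C 0" and g'C: "g' x \<le> max C 0" for x
    using bf[of x] bg[of x] f'0[of x] g'0[of x] unfolding f_eq g_eq
    by (cases "C \<ge> 0"; auto simp: ennreal_neg)+
  have [measurable]: "f' \<in> borel_measurable borel" "g' \<in> borel_measurable borel"
    unfolding f'_def g'_def by measurable
  \<comment> \<open>Dividing by the suprema makes both level sets nonempty at every level
    \<open>s < 1\<close>, as \<open>brunn_minkowski_real\<close> requires.\<close>
  define a where "a = (SUP x. f' x)"
  define c where "c = (SUP x. g' x)"
  have bdf: "bdd_above (range f')" and bdg: "bdd_above (range g')"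
    using f'C g'C by (auto intro!: bdd_aboveI)
  have fa: "f' x \<le> a" and gc: "g' x \<le> c" for x
    unfolding a_def c_def by (auto intro: cSUP_upper bdf bdg)
  have a0: "a > 0" and c0: "c > 0"
  proof -
    obtain x where "f x \<noteq> 0" using False by auto
    hence "f' x > 0" using f_eq[of x] f'0[of x] by (cases "f' x = 0") auto
    thus "a > 0" using fa[of x] by linarith
    obtain x where "g x \<noteq> 0" using False by auto
    hence "g' x > 0" using g_eq[of x] g'0[of x] by (cases "g' x = 0") auto
    thus "c > 0" using gc[of x] by linarith
  qed
  \<comment> \<open>Weighted geometric mean of the two suprema: the height up to which the
    hypothesis makes \<open>h\<close> reach. Truncating \<open>h\<close> there, as in
    \<open>h'\<close>, allows the layer-cake formula over levels in [0, 1).\<close>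
  define r where "r = root (p + q) (a ^ p * c ^ q)"
  have r0: "r > 0" unfolding r_def using a0 c0 pq by simp
  have rpow: "r ^ (p + q) = a ^ p * c ^ q" unfolding r_def using a0 c0 pq
    by (intro real_root_pow_pos2) auto
  define h' where "h' x = enn2real (min (h x) (ennreal r)) / r" for x
  have hmin: "min (h x) (ennreal r) = ennreal (r * h' x)" for x
  proof -
    have "min (h x) (ennreal r) < top" by (simp add: min_less_iff_disj)
    thus ?thesis using r0 by (simp add: h'_def)
  qed
  have h'0: "h' x \<ge> 0" for x using r0 by (simp add: h'_def)
  have h'1: "h' x \<le> 1" for x
  proof -
    have "ennreal (r * h' x) \<le> ennreal r" unfolding hmin[symmetric] by simp
    thus ?thesis using r0 by (simp add: ennreal_le_iff)
  qed
  have [measurable]: "h' \<in> borel_measurable borel" unfolding h'_def by measurable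
  define l where "l = real q / real (p + q)"
  have l: "0 < l" "l < 1" "1 - l = real p / real (p + q)" using pq by (auto simp: l_def field_simps)
  have level: "ennreal (1 - l) * emeasure lborel {x. s < f' x / a} + ennreal l * emeasure lborel {x. s < g' x / c}
       \<le> emeasure lborel {x. s < h' x}" if s: "0 \<le> s" "s < 1" for s
  proof (rule brunn_minkowski_real)
    show "{x. s < f' x / a} \<in> sets borel" "{x. s < g' x / c} \<in> sets borel" "{x. s < h' x} \<in> sets borel"
      by measurable
    have "{x. s < f' x / a} \<subseteq> cball 0 b"
    proof
      fix x assume "x \<in> {x. s < f' x / a}"
      hence "f' x \<noteq> 0" using s by auto
      hence "f x \<noteq> 0" using f_eq[of x] f'0[of x] by auto
      thus "x \<in> cball 0 b" using sf[of x] by (cases "\<bar>x\<bar> > b") (auto simp: dist_real_def)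
    qed
    thus "bounded {x. s < f' x / a}" by (rule bounded_subset[OF bounded_cball])
    have "{x. s < g' x / c} \<subseteq> cball 0 b"
    proof
      fix x assume "x \<in> {x. s < g' x / c}"
      hence "g' x \<noteq> 0" using s by auto
      hence "g x \<noteq> 0" using g_eq[of x] g'0[of x] by auto
      thus "x \<in> cball 0 b" using sg[of x] by (cases "\<bar>x\<bar> > b") (auto simp: dist_real_def)
    qed
    thus "bounded {x. s < g' x / c}" by (rule bounded_subset[OF bounded_cball])
    have "s * a < a" using s a0 by simp
    then obtain x where "s * a < f' x" unfolding a_def using less_cSUP_iff[OF _ bdf] by auto
    thus "{x. s < f' x / a} \<noteq> {}" using a0 by (auto simp: field_simps)
    have "s * c < c" using s c0 by simp
    then obtain x where "s * c < g' x" unfolding c_def using less_cSUP_iff[OF _ bdg] by auto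
    thus "{x. s < g' x / c} \<noteq> {}" using c0 by (auto simp: field_simps)
    show "0 < l" "l < 1" by fact+
    fix x y assume "x \<in> {x. s < f' x / a}" "y \<in> {x. s < g' x / c}"
    hence xy: "s * a < f' x" "s * c < g' y" using a0 c0 by (auto simp: field_simps)
    define z where "z = (real p * x + real q * y) / real (p + q)"
    have z: "(1 - l) * x + l * y = z" unfolding z_def l(3) by (simp add: l_def add_divide_distrib)
    have "ennreal (s * r) < h z"
    proof (rule ccontr)
      assume "\<not> ennreal (s * r) < h z"
      hence "h z \<le> ennreal (s * r)" by simp
      hence "h z ^ (p + q) \<le> ennreal (s * r) ^ (p + q)" by (rule power_mono) simp
      hence "f x ^ p * g y ^ q \<le> ennreal ((s * r) ^ (p + q))"
        using hfg[of x y] s r0 unfolding z_def[symmetric] by (simp add: ennreal_power del: ennreal_mult_less_top)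
      hence "ennreal (f' x ^ p * g' y ^ q) \<le> ennreal ((s * r) ^ (p + q))"
        using f'0 g'0 unfolding f_eq g_eq by (simp add: ennreal_power ennreal_mult)
      hence "f' x ^ p * g' y ^ q \<le> (s * r) ^ (p + q)"
        using s r0 by (simp add: ennreal_le_iff)
      also have "\<dots> = (s * a) ^ p * (s * c) ^ q" unfolding power_mult_distrib rpow by (simp add: power_add)
      also have "\<dots> < f' x ^ p * g' y ^ q"
      proof -
          have "0 \<le> s * a" "0 \<le> s * c" using s a0 c0 by auto
          hence "(s * a) ^ p < f' x ^ p" "(s * c) ^ q < g' y ^ q" "0 \<le> (s * a) ^ p" "0 \<le> (s * c) ^ q"
            using xy pq by (auto intro!: power_strict_mono)
          thus ?thesis by (intro mult_strict_mono) auto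
        qed
      finally show False by simp
    qed
    hence "ennreal (s * r) < min (h z) (ennreal r)" using s r0 by (simp add: ennreal_less_iff)
    hence "s * r < r * h' z" unfolding hmin using s r0 by (simp add: ennreal_less_iff)
    thus "(1 - l) * x + l * y \<in> {x. s < h' x}" unfolding z using r0 by simp
  qed
  define If where "If = (\<integral>\<^sup>+x. ennreal (f' x / a) \<partial>lborel)"
  define Ig where "Ig = (\<integral>\<^sup>+x. ennreal (g' x / c) \<partial>lborel)"
  define Ih where "Ih = (\<integral>\<^sup>+x. ennreal (h' x) \<partial>lborel)"
  \<comment> \<open>After normalisation the claim becomes additive;
    \<open>weighted_am_gm_nat\<close> returns to products at the end.\<close>
  have main: "ennreal (1 - l) * If + ennreal l * Ig \<le> Ih"
  proof -
    have "ennreal (1 - l) * If + ennreal l * Ig =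
       ennreal (1 - l) * (\<integral>\<^sup>+s. indicator {0..<1} s * emeasure lborel {x. s < f' x / a} \<partial>lborel)
       + ennreal l * (\<integral>\<^sup>+s. indicator {0..<1} s * emeasure lborel {x. s < g' x / c} \<partial>lborel)"
      unfolding If_def Ig_def using f'0 g'0 fa gc a0 c0
      by (subst (1 2) nn_integral_layer_cake_unit) auto
    also have "\<dots> = (\<integral>\<^sup>+s. ennreal (1 - l) * (indicator {0..<1} s * emeasure lborel {x. s < f' x / a})
         + ennreal l * (indicator {0..<1} s * emeasure lborel {x. s < g' x / c}) \<partial>lborel)"
      by (subst nn_integral_add) (auto simp: nn_integral_cmult)
    also have "\<dots> \<le> (\<integral>\<^sup>+s. indicator {0..<1} s * emeasure lborel {x. s < h' x} \<partial>lborel)"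
      by (rule nn_integral_mono) (use level in \<open>auto simp: indicator_def\<close>)
    also have "\<dots> = Ih" unfolding Ih_def by (rule nn_integral_layer_cake_unit[symmetric]) (use h'0 h'1 in auto)
    finally show ?thesis .
  qed
  have fin: "(\<integral>\<^sup>+x. ennreal (k x) \<partial>lborel) < \<infinity>"
    if "k \<in> borel_measurable borel" "\<And>x. k x \<le> 1" "\<And>x. \<bar>x\<bar> > b \<Longrightarrow> k x = 0" for k :: "real \<Rightarrow> real"
  proof -
    have "(\<integral>\<^sup>+x. ennreal (k x) \<partial>lborel) \<le> (\<integral>\<^sup>+x. indicator {-b..b} x \<partial>lborel)"
    proof (rule nn_integral_mono)
      fix x show "ennreal (k x) \<le> indicator {-b..b} x"
        using that(2)[of x] that(3)[of x] by (cases "\<bar>x\<bar> > b") (auto simp: indicator_def)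
    qed
    also have "\<dots> < \<infinity>" by (cases "b \<ge> 0") auto
    finally show ?thesis .
  qed
  have zf: "f' x = 0" "g' x = 0" if "\<bar>x\<bar> > b" for x using sf[OF that] sg[OF that] by (auto simp: f'_def g'_def)
  have finf: "If < \<infinity>" unfolding If_def by (rule fin) (use fa a0 zf in auto)
  have fing: "Ig < \<infinity>" unfolding Ig_def by (rule fin) (use gc c0 zf in auto)
  have intf: "(\<integral>\<^sup>+x. f x \<partial>lborel) = ennreal a * If"
    unfolding If_def f_eq using a0 f'0
    by (subst nn_integral_cmult[symmetric]) (auto simp flip: ennreal_mult intro!: nn_integral_cong)
  have intg: "(\<integral>\<^sup>+x. g x \<partial>lborel) = ennreal c * Ig"
    unfolding Ig_def g_eq using c0 g'0
    by (subst nn_integral_cmult[symmetric]) (auto simp flip: ennreal_mult intro!: nn_integral_cong)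
  have inth: "ennreal r * Ih \<le> (\<integral>\<^sup>+x. h x \<partial>lborel)"
    unfolding Ih_def
    by (subst nn_integral_cmult[symmetric])
       (auto simp: ennreal_mult[symmetric] h'0 less_imp_le[OF r0] hmin[symmetric] intro!: nn_integral_mono)
  obtain F where F: "If = ennreal F" "F \<ge> 0" using finf by (cases If) auto
  obtain G where G: "Ig = ennreal G" "G \<ge> 0" using fing by (cases Ig) auto
  have "(\<integral>\<^sup>+x. f x \<partial>lborel) ^ p * (\<integral>\<^sup>+x. g x \<partial>lborel) ^ q = ennreal ((a * F) ^ p * (c * G) ^ q)"
    unfolding intf intg F G using F G a0 c0 by (simp add: ennreal_power flip: ennreal_mult)
  also have "(a * F) ^ p * (c * G) ^ q = r ^ (p + q) * (F ^ p * G ^ q)"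
    by (simp add: rpow power_mult_distrib)
  also have "ennreal \<dots> \<le> ennreal (r ^ (p + q) * ((1 - l) * F + l * G) ^ (p + q))"
  proof (intro ennreal_leI mult_left_mono)
    have "(1 - l) * F + l * G = (real p * F + real q * G) / real (p + q)"
      unfolding l(3) by (simp add: l_def add_divide_distrib)
    thus "F ^ p * G ^ q \<le> ((1 - l) * F + l * G) ^ (p + q)"
      using weighted_am_gm_nat[OF F(2) G(2) pq] by simp
  qed (use r0 in auto)
  also have "\<dots> = (ennreal r * (ennreal (1 - l) * If + ennreal l * Ig)) ^ (p + q)"
    unfolding F G using F G l r0
    by (simp add: ennreal_power power_mult_distrib flip: ennreal_plus ennreal_mult)
  also have "\<dots> \<le> (ennreal r * Ih) ^ (p + q)" using main by (intro power_mono mult_left_mono) auto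
  also have "\<dots> \<le> (\<integral>\<^sup>+x. h x \<partial>lborel) ^ (p + q)" using inth by (intro power_mono) auto
  finally show ?thesis .
qed

section \<open>Lebesgue measure on a box\<close>

definition lborel_interval :: "real \<Rightarrow> real measure" where
  "lborel_interval b = restrict_space lborel {-b..b}"

text \<open>Each factor is restricted to the interval before the product is taken, so this is a
  product of finite measures and can be integrated one coordinate at a time.\<close>

definition box_measure :: "real \<Rightarrow> nat set \<Rightarrow> (nat \<Rightarrow> real) measure" where
  "box_measure b I = PiM I (\<lambda>_. lborel_interval b)"

lemma space_lborel_interval [simp]: "space (lborel_interval b) = {-b..b}"
  by (simp add: lborel_interval_def space_restrict_space)

lemma space_box_measure: "space (box_measure b I) = PiE I (\<lambda>_. {-b..b})"
  by (simp add: box_measure_def space_PiM)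

lemma finite_lborel_interval: "finite_measure (lborel_interval b)"
proof
  have "emeasure (lborel_interval b) {-b..b} = emeasure lborel {-b..b}"
    by (simp add: lborel_interval_def emeasure_restrict_space)
  thus "emeasure (lborel_interval b) (space (lborel_interval b)) \<noteq> \<infinity>"
    by (cases "b \<ge> 0") auto
qed

lemma product_sigma_finite_lborel_interval: "product_sigma_finite (\<lambda>_. lborel_interval b)"
  unfolding product_sigma_finite_def
  using finite_lborel_interval finite_measure.axioms(1) by blast

lemma finite_box_measure:
  assumes "finite I"
  shows "finite_measure (box_measure b I)"
proof
  interpret product_sigma_finite "\<lambda>_::nat. lborel_interval b" by (rule product_sigma_finite_lborel_interval)
  have "emeasure (box_measure b I) (space (box_measure b I)) = (\<Prod>i\<in>I. emeasure (lborel_interval b) {-b..b})"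
    unfolding space_box_measure unfolding box_measure_def
    using sets.top[of "lborel_interval b"] by (intro emeasure_PiM assms) auto
  also have "\<dots> \<noteq> \<infinity>"
    using finite_measure.emeasure_finite[OF finite_lborel_interval, of b "{-b..b}"]
    by (simp add: power_eq_top_ennreal)
  finally show "emeasure (box_measure b I) (space (box_measure b I)) \<noteq> \<infinity>" .
qed

lemma emeasure_box_measure_pos:
  assumes "finite I" "b > 0"
  shows "emeasure (box_measure b I) (space (box_measure b I)) > 0"
proof -
  interpret product_sigma_finite "\<lambda>_::nat. lborel_interval b" by (rule product_sigma_finite_lborel_interval)
  have "emeasure (box_measure b I) (space (box_measure b I)) = (\<Prod>i\<in>I. emeasure (lborel_interval b) {-b..b})"
    unfolding space_box_measure unfolding box_measure_def
    using sets.top[of "lborel_interval b"] by (intro emeasure_PiM assms) auto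
  also have "emeasure (lborel_interval b) {-b..b} = ennreal (2 * b)"
    using assms by (simp add: lborel_interval_def emeasure_restrict_space)
  finally show ?thesis using assms by (simp add: ennreal_power)
qed

lemma measurable_lborel_interval [measurable]: "(\<lambda>x. x) \<in> borel_measurable (lborel_interval b)"
  unfolding lborel_interval_def by (rule measurable_restrict_space1) simp

lemma measurable_box_component [measurable]:
  assumes "k \<in> I"
  shows "(\<lambda>x. x k) \<in> borel_measurable (box_measure b I)"
  unfolding box_measure_def
  by (rule measurable_compose[OF measurable_component_singleton[OF assms] measurable_lborel_interval])

lemma nn_integral_lborel_interval:
  "f \<in> borel_measurable (lborel_interval b) \<Longrightarrow>
   (\<integral>\<^sup>+x. f x \<partial>lborel_interval b) = (\<integral>\<^sup>+x. f x * indicator {-b..b} x \<partial>lborel)"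
  unfolding lborel_interval_def by (subst nn_integral_restrict_space) auto

lemma borel_measurable_interval_extend:
  fixes f :: "real \<Rightarrow> ennreal"
  assumes "f \<in> borel_measurable (lborel_interval b)"
  shows "(\<lambda>x. f x * indicator {-b..b} x) \<in> borel_measurable borel"
  using assms unfolding lborel_interval_def
  by (subst (asm) borel_measurable_restrict_space_iff_ennreal) auto

text \<open>Induction on the dimension: with the new coordinate frozen, the integral over the old
  ones is a function of one real variable, and the induction hypothesis is exactly the pointwise
  condition of the one-dimensional inequality. Points of the box are extensional functions, hence
  the restricted lambda.\<close>

proposition prekopa_leindler_box:
  fixes f g h :: "(nat \<Rightarrow> real) \<Rightarrow> ennreal"
  assumes "finite I" and pq: "p > 0" "q > (0::nat)"
    and "f \<in> borel_measurable (box_measure b I)" "g \<in> borel_measurable (box_measure b I)"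
      "h \<in> borel_measurable (box_measure b I)"
    and "\<And>x. x \<in> space (box_measure b I) \<Longrightarrow> f x \<le> ennreal C"
    and "\<And>x. x \<in> space (box_measure b I) \<Longrightarrow> g x \<le> ennreal C"
    and "\<And>x y. x \<in> space (box_measure b I) \<Longrightarrow> y \<in> space (box_measure b I) \<Longrightarrow>
        f x ^ p * g y ^ q \<le> h (\<lambda>k\<in>I. (real p * x k + real q * y k) / real (p + q)) ^ (p + q)"
  shows "(\<integral>\<^sup>+x. f x \<partial>box_measure b I) ^ p * (\<integral>\<^sup>+x. g x \<partial>box_measure b I) ^ q
      \<le> (\<integral>\<^sup>+x. h x \<partial>box_measure b I) ^ (p + q)"
  using assms(1,4-)
proof (induction I arbitrary: f g h rule: finite_induct)
  case empty
  interpret product_sigma_finite "\<lambda>_::nat. lborel_interval b" by (rule product_sigma_finite_lborel_interval)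
  show ?case using empty.prems(6)[of "\<lambda>_. undefined" "\<lambda>_. undefined"]
    unfolding box_measure_def by (simp add: nn_integral_empty space_PiM)
next
  case (insert i I)
  interpret product_sigma_finite "\<lambda>_::nat. lborel_interval b" by (rule product_sigma_finite_lborel_interval)
  note ms = insert.prems(1-3)[unfolded box_measure_def]
  note [measurable] = ms
  have upd: "x(i := y) \<in> space (box_measure b (insert i I))" if "x \<in> space (box_measure b I)" "y \<in> {-b..b}" for x y
    using that unfolding space_box_measure by (auto simp: PiE_def extensional_def Pi_def)
  have sec: "(\<lambda>x. k (x(i := y))) \<in> borel_measurable (box_measure b I)"
    if "k \<in> borel_measurable (box_measure b (insert i I))" "y \<in> {-b..b}" for k :: "(nat \<Rightarrow> real) \<Rightarrow> ennreal" and y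
  proof -
    have "(\<lambda>x. x(i := y)) \<in> box_measure b I \<rightarrow>\<^sub>M box_measure b (insert i I)"
      unfolding box_measure_def using that(2) insert.hyps
      by (intro measurable_fun_upd[of _ I]) auto
    thus ?thesis using that(1) by (rule measurable_compose)
  qed
  define m where "m k y = (\<integral>\<^sup>+x. k (x(i := y)) \<partial>box_measure b I)" for k :: "(nat \<Rightarrow> real) \<Rightarrow> ennreal" and y
  have mm: "m k \<in> borel_measurable (lborel_interval b)"
    if [measurable]: "k \<in> borel_measurable (Pi\<^sub>M (insert i I) (\<lambda>_. lborel_interval b))" for k
  proof -
    interpret s: sigma_finite_measure "Pi\<^sub>M I (\<lambda>_. lborel_interval b)"
      using insert.hyps by (intro sigma_finite)
    show ?thesis unfolding m_def box_measure_def by measurable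
  qed
  have int_eq: "(\<integral>\<^sup>+x. k x \<partial>box_measure b (insert i I)) = (\<integral>\<^sup>+y. m k y * indicator {-b..b} y \<partial>lborel)"
    if "k \<in> borel_measurable (Pi\<^sub>M (insert i I) (\<lambda>_. lborel_interval b))" for k
    using mm[OF that] insert.hyps that
    by (subst nn_integral_lborel_interval[symmetric])
       (auto simp: m_def[abs_def] box_measure_def product_nn_integral_insert_rev)
  interpret fb: finite_measure "box_measure b I" by (rule finite_box_measure) (use insert in auto)
  define C' where "C' = enn2real (ennreal C * emeasure (box_measure b I) (space (box_measure b I)))"
  have C': "ennreal C' = ennreal C * emeasure (box_measure b I) (space (box_measure b I))"
    unfolding C'_def using fb.emeasure_finite by (simp add: ennreal_enn2real_if ennreal_mult_eq_top_iff)
  have bd: "m k y \<le> ennreal C'" if "y \<in> {-b..b}"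
    and "\<And>x. x \<in> space (box_measure b (insert i I)) \<Longrightarrow> k x \<le> ennreal C" for k y
  proof -
    have "m k y \<le> (\<integral>\<^sup>+x. ennreal C \<partial>box_measure b I)"
      unfolding m_def by (rule nn_integral_mono) (use that upd in auto)
    thus ?thesis by (simp add: C')
  qed
  show ?case unfolding int_eq[OF ms(1)] int_eq[OF ms(2)] int_eq[OF ms(3)]
  proof (rule prekopa_leindler_real[where C = C' and b = b])
    show "(\<lambda>y. m f y * indicator {-b..b} y) \<in> borel_measurable borel"
      "(\<lambda>y. m g y * indicator {-b..b} y) \<in> borel_measurable borel"
      "(\<lambda>y. m h y * indicator {-b..b} y) \<in> borel_measurable borel"
      using borel_measurable_interval_extend mm ms by auto
    show "p > 0" "q > 0" by fact+
    show "m f y * indicator {-b..b} y \<le> ennreal C'" for y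
      using bd[of y f] insert.prems(4) by (auto simp: indicator_def)
    show "m g y * indicator {-b..b} y \<le> ennreal C'" for y
      using bd[of y g] insert.prems(5) by (auto simp: indicator_def)
    show "b < \<bar>y\<bar> \<Longrightarrow> m f y * indicator {-b..b} y = 0" for y by (auto simp: indicator_def)
    show "b < \<bar>y\<bar> \<Longrightarrow> m g y * indicator {-b..b} y = 0" for y by (auto simp: indicator_def)
    fix y y'
    define z where "z = (real p * y + real q * y') / real (p + q)"
    show "(m f y * indicator {-b..b} y) ^ p * (m g y' * indicator {-b..b} y') ^ q
       \<le> (m h ((real p * y + real q * y') / real (p + q)) * indicator {-b..b} ((real p * y + real q * y') / real (p + q))) ^ (p + q)"
    proof (cases "y \<in> {-b..b} \<and> y' \<in> {-b..b}")
      case False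
      thus ?thesis using pq by (auto simp: indicator_def power_0_left)
    next
      case True
      have zb: "z \<in> {-b..b}"
      proof -
        have "real p * y + real q * y' \<le> real p * b + real q * b" "real p * (-b) + real q * (-b) \<le> real p * y + real q * y'"
          using True by (intro add_mono mult_left_mono; simp)+
        thus ?thesis using pq by (auto simp: z_def field_simps)
      qed
      have "m f y ^ p * m g y' ^ q \<le> m h z ^ (p + q)"
        unfolding m_def
      proof (rule insert.IH)
        show "(\<lambda>x. f (x(i := y))) \<in> borel_measurable (box_measure b I)"
          "(\<lambda>x. g (x(i := y'))) \<in> borel_measurable (box_measure b I)"
          "(\<lambda>x. h (x(i := z))) \<in> borel_measurable (box_measure b I)"
          using sec True zb insert.prems by auto
        show "x \<in> space (box_measure b I) \<Longrightarrow> f (x(i := y)) \<le> ennreal C" for x using upd True insert.prems(4) by auto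
        show "x \<in> space (box_measure b I) \<Longrightarrow> g (x(i := y')) \<le> ennreal C" for x using upd True insert.prems(5) by auto
        fix x x' assume x: "x \<in> space (box_measure b I)" "x' \<in> space (box_measure b I)"
        have "(\<lambda>k\<in>insert i I. (real p * (x(i := y)) k + real q * (x'(i := y')) k) / real (p + q))
          = (\<lambda>k\<in>I. (real p * x k + real q * x' k) / real (p + q))(i := z)"
          using insert.hyps by (auto simp: fun_eq_iff z_def)
        moreover have "f (x(i := y)) ^ p * g (x'(i := y')) ^ q
           \<le> h (\<lambda>k\<in>insert i I. (real p * (x(i := y)) k + real q * (x'(i := y')) k) / real (p + q)) ^ (p + q)"
          using True by (intro insert.prems(6) upd x) auto
        ultimately show "f (x(i := y)) ^ p * g (x'(i := y')) ^ q
           \<le> h ((\<lambda>k\<in>I. (real p * x k + real q * x' k) / real (p + q))(i := z)) ^ (p + q)"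
          by (simp only:)
      qed
      thus ?thesis using True zb unfolding z_def[symmetric] by simp
    qed
  qed
qed

text \<open>The contraction sends the box into itself, so the change of variables yields an integral
  over a smaller box: an inequality instead of an equality. The factor \<open>card I\<close> in all
  later bounds originates here.\<close>

lemma nn_integral_box_contract:
  fixes f :: "(nat \<Rightarrow> real) \<Rightarrow> ennreal"
  assumes "finite I" and th: "0 < th" "th < 1"
    and "f \<in> borel_measurable (box_measure b I)" and "\<And>k. k \<in> I \<Longrightarrow> z k \<in> {-b..b}"
  shows "(\<integral>\<^sup>+x. f (\<lambda>k\<in>I. z k + th * (x k - z k)) \<partial>box_measure b I)
      \<le> ennreal (1 / th) ^ card I * (\<integral>\<^sup>+x. f x \<partial>box_measure b I)"
  using assms(1,4-)
proof (induction I arbitrary: f rule: finite_induct)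
  case empty
  interpret product_sigma_finite "\<lambda>_::nat. lborel_interval b" by (rule product_sigma_finite_lborel_interval)
  show ?case
    using nn_integral_empty[of "\<lambda>_. f (\<lambda>k\<in>{}. undefined)"] nn_integral_empty[of f]
    unfolding box_measure_def by (simp add: restrict_def)
next
  case (insert i I)
  interpret product_sigma_finite "\<lambda>_::nat. lborel_interval b" by (rule product_sigma_finite_lborel_interval)
  note ms = insert.prems(1)[unfolded box_measure_def]
  note [measurable] = ms
  have zi: "z i \<in> {-b..b}" using insert.prems by auto
  have inb: "c + th * (t - c) \<in> {-b..b}" if "t \<in> {-b..b}" "c \<in> {-b..b}" for t c
  proof -
    have "c + th * (t - c) = (1 - th) * c + th * t" by (simp add: algebra_simps)
    moreover have "(1 - th) * c + th * t \<le> (1 - th) * b + th * b"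
      "(1 - th) * (-b) + th * (-b) \<le> (1 - th) * c + th * t"
      using that th by (intro add_mono mult_left_mono; simp)+
    ultimately show ?thesis by (auto simp: algebra_simps)
  qed
  have contr: "(\<lambda>x. \<lambda>k\<in>J. z k + th * (x k - z k)) \<in> box_measure b J \<rightarrow>\<^sub>M box_measure b J"
    if "\<And>k. k \<in> J \<Longrightarrow> z k \<in> {-b..b}" for J
    unfolding box_measure_def
  proof (rule measurable_restrict)
    fix k assume k: "k \<in> J"
    show "(\<lambda>x. z k + th * (x k - z k)) \<in> Pi\<^sub>M J (\<lambda>_. lborel_interval b) \<rightarrow>\<^sub>M lborel_interval b"
      unfolding lborel_interval_def[of b]
    proof (rule measurable_restrict_space2)
      show "(\<lambda>x. z k + th * (x k - z k)) \<in> Pi\<^sub>M J (\<lambda>_. restrict_space lborel {-b..b}) \<rightarrow>\<^sub>M lborel"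
        using measurable_box_component[OF k, of b, unfolded box_measure_def lborel_interval_def]
        by simp
      show "(\<lambda>x. z k + th * (x k - z k)) \<in> space (Pi\<^sub>M J (\<lambda>_. restrict_space lborel {-b..b})) \<rightarrow> {-b..b}"
      proof
        fix x assume "x \<in> space (Pi\<^sub>M J (\<lambda>_. restrict_space lborel {-b..b}))"
        hence "x k \<in> {-b..b}" using k by (auto simp: space_PiM space_restrict_space PiE_def Pi_def)
        thus "z k + th * (x k - z k) \<in> {-b..b}" using inb[OF _ that[OF k]] by blast
      qed
    qed
  qed
  have [measurable]: "(\<lambda>x. f (\<lambda>k\<in>insert i I. z k + th * (x k - z k))) \<in> borel_measurable (Pi\<^sub>M (insert i I) (\<lambda>_. lborel_interval b))"
    using measurable_compose[OF contr insert.prems(1)] insert.prems(2) unfolding box_measure_def by blast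
  have sec: "(\<lambda>y. f (x(i := y))) \<in> borel_measurable (lborel_interval b)" if "x \<in> space (box_measure b I)" for x
  proof -
    have "(\<lambda>y. x(i := y)) \<in> lborel_interval b \<rightarrow>\<^sub>M Pi\<^sub>M (insert i I) (\<lambda>_. lborel_interval b)"
      using that insert.hyps unfolding box_measure_def by (intro measurable_fun_upd[of _ I]) auto
    thus ?thesis using ms by (rule measurable_compose)
  qed
  define F where "F x = (\<integral>\<^sup>+y. f (x(i := y)) \<partial>lborel_interval b)" for x
  have F[measurable]: "F \<in> borel_measurable (box_measure b I)"
  proof -
    interpret s: sigma_finite_measure "lborel_interval b"
      using finite_lborel_interval finite_measure.axioms(1) by blast
    show ?thesis unfolding F_def box_measure_def by measurable
  qed
  have one: "(\<integral>\<^sup>+y. k (z i + th * (y - z i)) \<partial>lborel_interval b) \<le> ennreal (1 / th) * (\<integral>\<^sup>+y. k y \<partial>lborel_interval b)"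
    if k: "k \<in> borel_measurable (lborel_interval b)" for k :: "real \<Rightarrow> ennreal"
  proof -
    define k' where "k' = (\<lambda>y. k y * indicator {-b..b} y)"
    have [measurable]: "k' \<in> borel_measurable borel"
      unfolding k'_def using k by (rule borel_measurable_interval_extend)
    have eq: "k (z i + th * (y - z i)) * indicator {-b..b} y \<le> k' ((1 - th) * z i + th * y)" for y
      using inb[of y "z i"] zi by (auto simp: k'_def indicator_def algebra_simps)
    have "(\<integral>\<^sup>+y. k (z i + th * (y - z i)) \<partial>lborel_interval b) = (\<integral>\<^sup>+y. k (z i + th * (y - z i)) * indicator {-b..b} y \<partial>lborel)"
      unfolding lborel_interval_def by (subst nn_integral_restrict_space) auto
    also have "\<dots> \<le> (\<integral>\<^sup>+y. k' ((1 - th) * z i + th * y) \<partial>lborel)"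
      by (rule nn_integral_mono) (rule eq)
    also have "\<dots> = ennreal (1 / th) * (ennreal \<bar>th\<bar> * (\<integral>\<^sup>+y. k' ((1 - th) * z i + th * y) \<partial>lborel))"
      using th by (simp add: mult.assoc[symmetric] flip: ennreal_mult)
    also have "ennreal \<bar>th\<bar> * (\<integral>\<^sup>+y. k' ((1 - th) * z i + th * y) \<partial>lborel) = (\<integral>\<^sup>+y. k' y \<partial>lborel)"
      by (rule nn_integral_real_affine[symmetric]) (use th in auto)
    also have "\<dots> = (\<integral>\<^sup>+y. k y \<partial>lborel_interval b)"
      unfolding k'_def using k by (simp add: nn_integral_lborel_interval)
    finally show ?thesis .
  qed
  have "(\<integral>\<^sup>+x. f (\<lambda>k\<in>insert i I. z k + th * (x k - z k)) \<partial>box_measure b (insert i I))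
     = (\<integral>\<^sup>+x. (\<integral>\<^sup>+y. f (\<lambda>k\<in>insert i I. z k + th * ((x(i := y)) k - z k)) \<partial>lborel_interval b) \<partial>box_measure b I)"
    unfolding box_measure_def by (rule product_nn_integral_insert) (use insert.hyps in auto)
  also have "\<dots> \<le> (\<integral>\<^sup>+x. ennreal (1 / th) * F (\<lambda>k\<in>I. z k + th * (x k - z k)) \<partial>box_measure b I)"
  proof (rule nn_integral_mono)
    fix x assume x: "x \<in> space (box_measure b I)"
    define x' where "x' = (\<lambda>k\<in>I. z k + th * (x k - z k))"
    have x': "x' \<in> space (box_measure b I)"
      unfolding x'_def by (rule measurable_space[OF contr x]) (use insert.prems in auto)
    have "(\<lambda>k\<in>insert i I. z k + th * ((x(i := y)) k - z k)) = x'(i := z i + th * (y - z i))" for y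
      using insert.hyps by (auto simp: fun_eq_iff x'_def)
    thus "(\<integral>\<^sup>+y. f (\<lambda>k\<in>insert i I. z k + th * ((x(i := y)) k - z k)) \<partial>lborel_interval b) \<le> ennreal (1 / th) * F x'"
      using one[OF sec[OF x']] by (simp add: F_def)
  qed
  also have "\<dots> = ennreal (1 / th) * (\<integral>\<^sup>+x. F (\<lambda>k\<in>I. z k + th * (x k - z k)) \<partial>box_measure b I)"
    by (rule nn_integral_cmult) (rule measurable_compose[OF contr F], use insert.prems in auto)
  also have "\<dots> \<le> ennreal (1 / th) * (ennreal (1 / th) ^ card I * (\<integral>\<^sup>+x. F x \<partial>box_measure b I))"
    by (intro mult_left_mono insert.IH F) (use insert.prems in auto)
  also have "(\<integral>\<^sup>+x. F x \<partial>box_measure b I) = (\<integral>\<^sup>+x. f x \<partial>box_measure b (insert i I))"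
    unfolding F_def box_measure_def by (rule product_nn_integral_insert[symmetric]) (use insert.hyps in auto)
  finally show ?case using insert.hyps by (simp add: mult.assoc)
qed

section \<open>One-dimensional log-concave laws under a logistic weight\<close>

lemma logistic_pos: "logistic t > 0"
  and logistic_less_1: "logistic t < 1"
  by (auto simp: logistic_def field_simps add_pos_pos)

lemma logistic_neq_0 [simp]: "logistic t \<noteq> 0"
  using logistic_pos[of t] by simp

lemma one_plus_exp_neq_0: "1 + exp (t::real) \<noteq> 0"
  using exp_gt_zero[of t] by linarith

lemma logistic_minus: "logistic (- t) = 1 - logistic t"
  using one_plus_exp_neq_0[of t] by (simp add: logistic_def exp_minus divide_simps)

lemma logistic_mono: "s \<le> t \<Longrightarrow> logistic s \<le> logistic t"
  by (simp add: logistic_def field_simps add_pos_pos)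

lemma logistic_shift_diff:
  "logistic z - logistic a = (1 - logistic a) * logistic z * (1 - exp (a - z))"
  using one_plus_exp_neq_0[of a] one_plus_exp_neq_0[of z]
  by (simp add: logistic_def exp_diff divide_simps) (simp add: algebra_simps)

lemma logistic_shift_le: "q \<ge> 0 \<Longrightarrow> logistic (a + q) \<le> exp q * logistic a"
  by (simp add: logistic_def exp_add field_simps add_pos_pos)

text \<open>Locates where the logistic function has fallen to half of its value at \<open>a\<close>.
  The distance \<open>ln (2 + exp a)\<close> stays above \<open>ln 2\<close> and grows like
  \<open>a\<close>, which makes it the natural length scale of the estimates below.\<close>

lemma logistic_half: "logistic (a - ln (2 + exp a)) = logistic a / 2"
proof -
  have "1 + exp a \<noteq> 0" "2 + exp a \<noteq> 0" "2 + exp a > 0" using exp_gt_zero[of a] by linarith+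
  thus ?thesis by (simp add: logistic_def exp_diff divide_simps)
qed

lemma borel_measurable_logistic [measurable]: "logistic \<in> borel_measurable borel"
  unfolding logistic_def[abs_def] by measurable

text \<open>With \<open>t = z - a\<close> the left side is
  \<open>(1 - logistic a) * logistic z * (t - (1 - exp (- t)))\<close>, a second-order remainder
  that \<open>(1 + t) * exp (- t) \<le> 1\<close> bounds by the dispersion term. The assumption
  keeps \<open>logistic z\<close> above \<open>logistic a / (2 * exp 1)\<close>, which supplies the
  missing factor \<open>logistic z / logistic a\<close>.\<close>

lemma logistic_taylor_left:
  assumes "z \<ge> a - ln (2 + exp a) - 1"
  shows "logistic a - logistic z + (1 - logistic a) * logistic z * (z - a)
    \<le> 2 * exp 1 * (logistic z * (z - a) * (logistic z - logistic a)) / logistic a"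
proof -
  define s0 where "s0 = logistic a"
  define s where "s = logistic z"
  define t where "t = z - a"
  note pos = logistic_pos[of a, folded s0_def] logistic_less_1[of a, folded s0_def] logistic_pos[of z, folded s_def]
  have d: "s - s0 = (1 - s0) * s * (1 - exp (- t))"
    using logistic_shift_diff[of z a] by (simp add: s_def s0_def t_def)
  have key: "t - (1 - exp (-t)) \<le> t * (1 - exp (-t))"
  proof -
    have "(1 + t) * exp (-t) \<le> exp t * exp (-t)" by (intro mult_right_mono) auto
    also have "\<dots> = 1" by (simp flip: exp_add)
    finally show ?thesis by (simp add: algebra_simps)
  qed
  have nn: "0 \<le> t * (1 - exp (-t))"
    by (cases "t \<ge> 0") (auto intro: mult_nonneg_nonneg mult_nonpos_nonpos)
  have ratio: "1 \<le> 2 * exp 1 * (s / s0)"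
  proof -
    have "logistic (a - ln (2 + exp a)) \<le> exp 1 * logistic (a - ln (2 + exp a) - 1)"
      using logistic_shift_le[of 1 "a - ln (2 + exp a) - 1"] by simp
    also have "\<dots> \<le> exp 1 * s" unfolding s_def using assms by (intro mult_left_mono logistic_mono) auto
    finally have "s0 / 2 \<le> exp 1 * s" unfolding logistic_half s0_def .
    thus ?thesis using pos by (simp add: field_simps)
  qed
  have "s0 - s + (1 - s0) * s * t = (1 - s0) * s * (t - (1 - exp (-t)))"
    using d by (simp add: algebra_simps)
  also have "\<dots> \<le> (1 - s0) * s * (1 * (t * (1 - exp (-t))))"
    using pos key by (intro mult_left_mono) auto
  also have "\<dots> \<le> (1 - s0) * s * (2 * exp 1 * (s / s0) * (t * (1 - exp (-t))))"
    using pos nn ratio by (intro mult_left_mono mult_right_mono) auto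
  also have "\<dots> = 2 * exp 1 * (s * t * (s - s0)) / s0" unfolding d by simp
  finally show ?thesis unfolding s_def s0_def t_def .
qed

lemma logistic_excess_nonneg: "0 \<le> logistic z * (z - a) * (logistic z - logistic a)"
proof -
  have "0 \<le> (z - a) * (logistic z - logistic a)"
    using logistic_mono[of a z] logistic_mono[of z a] by (cases "z \<ge> a") (auto intro: mult_nonneg_nonneg mult_nonpos_nonpos)
  thus ?thesis using logistic_pos[of z] by (simp add: mult.assoc)
qed

text \<open>The first summand comes from \<open>logistic_taylor_left\<close>. The second collects
  the constants of the far-left estimate in \<open>logistic_predictive_gap\<close>:
  \<open>3 * exp 8\<close> from \<open>step4\<close>, \<open>8\<close> from the bound on
  \<open>K\<close>, and \<open>4 * exp 1\<close> from \<open>step2\<close>.\<close>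

definition gap_const :: real where "gap_const = 2 * exp 1 + 96 * exp 9"

section \<open>Slab masses of log-concave laws and the predictive gap\<close>

context finite_measure
begin

lemma integrable_bounded:
  fixes f :: "'a \<Rightarrow> real"
  assumes "f \<in> borel_measurable M" "\<And>x. x \<in> space M \<Longrightarrow> \<bar>f x\<bar> \<le> C"
  shows "integrable M f"
  by (rule integrable_const_bound[of _ C]) (use assms in auto)

text \<open>Summing the four-point inequality \<open>lc\<close> over \<open>i\<close> and over
  \<open>j \<le> K\<close> gives the product on the left. On the right the slabs belonging to a
  fixed \<open>j\<close> are disjoint, so each \<open>j\<close> contributes at most
  \<open>P c\<close>. Masses of unit slabs take the place of a density.\<close>

lemma slab_measure_bound:
  fixes z :: "'a \<Rightarrow> real"
  assumes [measurable]: "z \<in> borel_measurable M" and bz: "\<And>x. x \<in> space M \<Longrightarrow> \<bar>z x\<bar> \<le> B"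
    and m1: "measure M (space M) = 1"
    and P: "\<And>c. P c = measure M {x \<in> space M. c \<le> z x \<and> z x < c + 1}"
    and lc: "\<And>c i j. 0 < i \<Longrightarrow> 0 < (j::nat) \<Longrightarrow> P (c - real i) * P (c + real j) \<le> P c * P (c + real j - real i)"
  shows "measure M {x \<in> space M. z x < c} * measure M {x \<in> space M. c + 1 \<le> z x \<and> z x < c + 1 + real K} \<le> real K * P c"
proof -
  define S where "S c = {x \<in> space M. c \<le> z x \<and> z x < c + 1}" for c
  have PS: "P c = measure M (S c)" for c by (simp add: P S_def)
  have mS[measurable]: "S c \<in> sets M" for c unfolding S_def by measurable
  have P0: "P c \<ge> 0" for c by (simp add: PS)
  obtain N :: nat where N: "real N > c + B" using reals_Archimedean2 by blast
  have F: "measure M {x \<in> space M. z x < c} \<le> (\<Sum>i\<in>{1..N}. P (c - real i))"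
  proof -
    have "{x \<in> space M. z x < c} \<subseteq> (\<Union>i\<in>{1..N}. S (c - real i))"
    proof
      fix x assume x: "x \<in> {x \<in> space M. z x < c}"
      define i where "i = nat \<lceil>c - z x\<rceil>"
      have "c - z x > 0" using x by auto
      hence i: "real i \<ge> c - z x" "real i < c - z x + 1" "i \<ge> 1" unfolding i_def by linarith+
      have "real i < real N + 1" using i N bz[of x] x by auto
      hence "i \<le> N" by linarith
      thus "x \<in> (\<Union>i\<in>{1..N}. S (c - real i))" using i x unfolding S_def by (auto intro!: bexI[of _ i])
    qed
    hence "measure M {x \<in> space M. z x < c} \<le> measure M (\<Union>i\<in>{1..N}. S (c - real i))"
      by (intro finite_measure_mono) auto
    also have "\<dots> \<le> (\<Sum>i\<in>{1..N}. measure M (S (c - real i)))"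
      by (intro finite_measure_subadditive_finite) auto
    finally show ?thesis by (simp add: PS)
  qed
  have I: "measure M {x \<in> space M. c + 1 \<le> z x \<and> z x < c + 1 + real K} \<le> (\<Sum>j\<in>{1..K}. P (c + real j))"
  proof -
    have "{x \<in> space M. c + 1 \<le> z x \<and> z x < c + 1 + real K} \<subseteq> (\<Union>j\<in>{1..K}. S (c + real j))"
    proof
      fix x assume x: "x \<in> {x \<in> space M. c + 1 \<le> z x \<and> z x < c + 1 + real K}"
      define j where "j = nat \<lfloor>z x - c\<rfloor>"
      have j: "real j \<le> z x - c" "real j > z x - c - 1" "j \<ge> 1" using x unfolding j_def by (auto simp: le_nat_iff le_floor_iff)
      have "real j < real K + 1" using j x by auto
      hence "j \<le> K" by linarith
      thus "x \<in> (\<Union>j\<in>{1..K}. S (c + real j))" using j x unfolding S_def by (auto intro!: bexI[of _ j])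
    qed
    hence "measure M {x \<in> space M. c + 1 \<le> z x \<and> z x < c + 1 + real K} \<le> measure M (\<Union>j\<in>{1..K}. S (c + real j))"
      by (intro finite_measure_mono) auto
    also have "\<dots> \<le> (\<Sum>j\<in>{1..K}. measure M (S (c + real j)))"
      by (intro finite_measure_subadditive_finite) auto
    finally show ?thesis by (simp add: PS)
  qed
  have tot: "(\<Sum>i\<in>{1..N}. P (c + real j - real i)) \<le> 1" for j :: nat
  proof -
    have "(\<Sum>i\<in>{1..N}. measure M (S (c + real j - real i))) = measure M (\<Union>i\<in>{1..N}. S (c + real j - real i))"
    proof (rule finite_measure_finite_Union[symmetric])
      show "disjoint_family_on (\<lambda>i. S (c + real j - real i)) {1..N}"
        unfolding disjoint_family_on_def
      proof (intro ballI impI)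
        fix i k assume "i \<in> {1..N}" "k \<in> {1..N}" "i \<noteq> k"
        hence "real i + 1 \<le> real k \<or> real k + 1 \<le> real i" by linarith
        thus "S (c + real j - real i) \<inter> S (c + real j - real k) = {}" unfolding S_def by auto
      qed
    qed auto
    also have "\<dots> \<le> measure M (space M)" by (rule bounded_measure)
    finally show ?thesis by (simp add: PS m1)
  qed
  have "measure M {x \<in> space M. z x < c} * measure M {x \<in> space M. c + 1 \<le> z x \<and> z x < c + 1 + real K}
     \<le> (\<Sum>i\<in>{1..N}. P (c - real i)) * (\<Sum>j\<in>{1..K}. P (c + real j))"
    using F I by (intro mult_mono) (auto intro!: sum_nonneg P0)
  also have "\<dots> = (\<Sum>j\<in>{1..K}. \<Sum>i\<in>{1..N}. P (c - real i) * P (c + real j))"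
    by (subst sum.swap) (simp add: sum_product)
  also have "\<dots> \<le> (\<Sum>j\<in>{1..K}. \<Sum>i\<in>{1..N}. P c * P (c + real j - real i))"
    by (intro sum_mono lc) auto
  also have "\<dots> = (\<Sum>j\<in>{1..K}. P c * (\<Sum>i\<in>{1..N}. P (c + real j - real i)))"
    by (simp add: sum_distrib_left)
  also have "\<dots> \<le> (\<Sum>j\<in>{1..K}. P c * 1)" using tot P0 by (intro sum_mono mult_left_mono) auto
  finally show ?thesis by simp
qed

text \<open>Here \<open>z\<close> under \<open>M\<close> is the predictor of the left-out observation given the others, and \<open>a\<close> is the mean of \<open>z\<close> after
  reweighting by \<open>logistic z\<close>. Adding the vanishing term \<open>(1 - logistic a) * logistic z * (z - a)\<close> removes
  the first-order part of \<open>logistic a - logistic z\<close>; what is left is dominated by the dispersion,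
  except far to the left of \<open>a\<close>, where log-concavity compares \<open>M\<close> with its mass on the unit slab at
  which \<open>logistic z\<close> has dropped to half of \<open>logistic a\<close>.\<close>

lemma logistic_predictive_gap:
  fixes z :: "'a \<Rightarrow> real"
  assumes mz[measurable]: "z \<in> borel_measurable M" and bz: "\<And>x. x \<in> space M \<Longrightarrow> \<bar>z x\<bar> \<le> B"
    and m1: "measure M (space M) = 1"
    and lc: "\<And>c i j. 0 < i \<Longrightarrow> 0 < (j::nat) \<Longrightarrow>
      measure M {x \<in> space M. c - real i \<le> z x \<and> z x < c - real i + 1} * measure M {x \<in> space M. c + real j \<le> z x \<and> z x < c + real j + 1}
      \<le> measure M {x \<in> space M. c \<le> z x \<and> z x < c + 1} * measure M {x \<in> space M. c + real j - real i \<le> z x \<and> z x < c + real j - real i + 1}"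
    and mean: "(\<integral>x. logistic (z x) * (z x - a) \<partial>M) = 0"
    and Q: "Q = (\<integral>x. logistic (z x) \<partial>M)" and Q0: "Q > 0"
  shows "logistic a - Q \<le> gap_const * ((\<integral>x. logistic (z x) * (z x - a) * (logistic (z x) - logistic a) \<partial>M) / Q)"
proof -
  define s0 where "s0 = logistic a"
  define s where "s x = logistic (z x)" for x
  define b where "b x = s x * (z x - a) * (s x - s0)" for x
  \<comment> \<open>\<open>a - y\<close> is the half-value point of \<open>logistic_half\<close>;
    the unit slab that starts at \<open>c\<close> ends there.\<close>
  define y where "y = ln (2 + exp a)"
  define c where "c = a - y - 1"
  define beta where "beta = (\<integral>x. b x \<partial>M) / Q"
  have s0: "s0 > 0" "s0 < 1" unfolding s0_def by (auto simp: logistic_pos logistic_less_1)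
  have s: "s x > 0" "s x < 1" for x unfolding s_def by (auto simp: logistic_pos logistic_less_1)
  have b0: "b x \<ge> 0" for x unfolding b_def s_def s0_def by (rule logistic_excess_nonneg)
  have ms[measurable]: "s \<in> borel_measurable M" unfolding s_def by measurable
  have mb[measurable]: "b \<in> borel_measurable M" unfolding b_def by measurable
  have iS: "integrable M s" by (rule integrable_bounded[of _ 1]) (use s in \<open>auto simp: less_imp_le abs_of_pos\<close>)
  have tb: "\<bar>z x - a\<bar> \<le> B + \<bar>a\<bar>" if "x \<in> space M" for x using bz[OF that] by linarith
  have st: "\<bar>s x * (z x - a)\<bar> \<le> B + \<bar>a\<bar>" if "x \<in> space M" for x
  proof -
    have "\<bar>s x\<bar> * \<bar>z x - a\<bar> \<le> 1 * (B + \<bar>a\<bar>)" using s[of x] tb[OF that] by (intro mult_mono) auto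
    thus ?thesis by (simp add: abs_mult)
  qed
  have it: "integrable M (\<lambda>x. s x * (z x - a))" by (rule integrable_bounded[OF _ st]) auto
  have ib: "integrable M b"
  proof (rule integrable_bounded[of _ "(B + \<bar>a\<bar>) * 1"])
    fix x assume x: "x \<in> space M"
    have "\<bar>s x - s0\<bar> \<le> 1" using s[of x] s0 by linarith
    thus "\<bar>b x\<bar> \<le> (B + \<bar>a\<bar>) * 1" unfolding b_def abs_mult[of "s x * (z x - a)"] using st[OF x]
      by (intro mult_mono) auto
  qed auto
  have ind: "integrable M (\<lambda>x. k * indicator A x)" if "A \<in> sets M" for A and k :: real
    by (rule integrable_bounded[of _ "\<bar>k\<bar>"]) (use that in \<open>auto simp: indicator_def\<close>)
  have ib': "integrable M (\<lambda>x. k * b x)" for k using ib by simp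
  have beta0: "beta \<ge> 0" unfolding beta_def using Q0 b0 by (intro divide_nonneg_pos integral_nonneg) auto
  have intb: "(\<integral>x. b x \<partial>M) = beta * Q" unfolding beta_def using Q0 by simp
  have Qs: "(\<integral>x. s x \<partial>M) = Q" unfolding Q s_def ..
  have means: "(\<integral>x. s x * (z x - a) \<partial>M) = 0" using mean unfolding s_def .
  have e1: "exp 1 > (2::real)" "exp 9 > (0::real)" using exp_gt_one[of "1/2::real"] exp_ge_add_one_self[of "1::real"] e_approx_32 by (auto simp: abs_if split: if_splits)
  have gc: "gap_const \<ge> 8"
    unfolding gap_const_def using e1 exp_ge_add_one_self[of "9::real"] by linarith
  have y: "y \<ge> 2/3"
  proof -
    have "ln 2 \<le> y" unfolding y_def by (subst ln_le_cancel_iff) (auto simp: add_pos_pos)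
    thus ?thesis using ln2_ge_two_thirds by linarith
  qed
  have goal: "s0 - Q \<le> gap_const * beta"
  \<comment> \<open>If \<open>beta\<close> is at least \<open>s0 / 8\<close>, the trivial bound
    \<open>s0 - Q \<le> s0\<close> suffices; a small \<open>beta\<close> is what confines the mass
    in \<open>step4\<close>.\<close>
  proof (cases "Q < s0 \<and> beta < s0 / 8")
    case False
    show ?thesis
    proof (cases "Q < s0")
      case True
      hence "s0 - Q \<le> 8 * beta" using False Q0 by linarith
      also have "\<dots> \<le> gap_const * beta" using gc beta0 by (intro mult_right_mono) auto
      finally show ?thesis .
    next
      case False
      have "0 \<le> gap_const * beta" using gc beta0 by simp
      thus ?thesis using False by linarith
    qed
  next
    case True
    define F where "F = {x \<in> space M. z x < c}"
    define G where "G = {x \<in> space M. c \<le> z x \<and> z x < c + 1}"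
    \<comment> \<open>The length \<open>5 * y + 1\<close> gives
      \<open>real K - y \<ge> 4 * y + 1\<close>, which turns the Markov bound for the right tail in
      \<open>step4\<close> into \<open>Q / 4\<close>. The upper bound \<open>5 * y + 2\<close> is at
      most \<open>8 * y\<close> because \<open>y \<ge> 2/3\<close>.\<close>
    define K where "K = nat \<lceil>5 * y + 1\<rceil>"
    define J where "J = {x \<in> space M. c + 1 \<le> z x \<and> z x < c + 1 + real K}"
    have [measurable]: "F \<in> sets M" "G \<in> sets M" "J \<in> sets M" unfolding F_def G_def J_def by measurable
    have K: "real K \<ge> 5 * y + 1" "real K \<le> 5 * y + 2" unfolding K_def using y by linarith+
    have mF: "measure M F \<ge> 0" "measure M G \<ge> 0" "measure M J \<ge> 0" by auto
    have slab: "measure M F * measure M J \<le> real K * measure M G"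
      unfolding F_def J_def G_def
      by (rule slab_measure_bound[where P = "\<lambda>c. measure M {x \<in> space M. c \<le> z x \<and> z x < c + 1}", OF mz bz m1 refl lc])
    have half: "logistic (c + 1) = s0 / 2" unfolding c_def y_def s0_def using logistic_half[of a] by simp
    have low: "s0 - s x \<ge> s0 / 2" if "z x < c + 1" for x
      using logistic_mono[of "z x" "c + 1"] that unfolding half s_def by simp
    have lowb: "s x * (a - z x) \<le> (2 / s0) * b x" "s x \<le> 2 / (s0 * y) * b x" if "z x < c + 1" for x
    proof -
      have az: "a - z x \<ge> y" using that unfolding c_def by linarith
      have "s x * (a - z x) * (s0 / 2) \<le> s x * (a - z x) * (s0 - s x)"
        using low[OF that] az y s[of x] by (intro mult_left_mono mult_nonneg_nonneg) auto
      also have "\<dots> = b x" unfolding b_def by (simp add: algebra_simps)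
      finally have *: "s x * (a - z x) * (s0 / 2) \<le> b x" .
      thus "s x * (a - z x) \<le> (2 / s0) * b x" using s0 by (simp add: field_simps)
      have "s x * y * (s0 / 2) \<le> s x * (a - z x) * (s0 / 2)"
        using az s[of x] s0 by (intro mult_right_mono mult_left_mono) auto
      with * have "s x * y * (s0 / 2) \<le> b x" by linarith
      thus "s x \<le> 2 / (s0 * y) * b x" using s0 y by (simp add: field_simps)
    qed
    \<comment> \<open>Outside \<open>F\<close> the comparison corrected to first order applies. On
      \<open>F\<close> only the crude bound \<open>s0\<close> is available, so the mass of
      \<open>F\<close> is what remains to be bounded.\<close>
    have step1: "s0 - Q \<le> 2 * exp 1 * beta + s0 * measure M F"
    proof -
      have "s0 - Q = (\<integral>x. s0 - s x + (1 - s0) * (s x * (z x - a)) \<partial>M)"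
        using iS it by (simp add: Qs means m1)
      also have "\<dots> \<le> (\<integral>x. 2 * exp 1 / s0 * b x + s0 * indicator F x \<partial>M)"
      proof (rule integral_mono)
        show "integrable M (\<lambda>x. s0 - s x + (1 - s0) * (s x * (z x - a)))" using iS it by simp
        show "integrable M (\<lambda>x. 2 * exp 1 / s0 * b x + s0 * indicator F x)"
          by (intro Bochner_Integration.integrable_add ib' ind) simp
        fix x assume x: "x \<in> space M"
        show "s0 - s x + (1 - s0) * (s x * (z x - a)) \<le> 2 * exp 1 / s0 * b x + s0 * indicator F x"
        proof (cases "z x < c")
          case True
          have "z x \<le> a" using True y unfolding c_def by linarith
          hence "(1 - s0) * (s x * (z x - a)) \<le> 0" using s[of x] s0 by (intro mult_nonneg_nonpos) auto
          moreover have "0 \<le> 2 * exp 1 / s0 * b x" using b0[of x] s0 by simp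
          ultimately show ?thesis using True x s[of x] by (simp add: F_def)
        next
          case False
          thus ?thesis using logistic_taylor_left[of a "z x"] unfolding F_def c_def y_def b_def s_def s0_def
            by (simp add: mult.assoc)
        qed
      qed
      also have "\<dots> = 2 * exp 1 / s0 * (beta * Q) + s0 * measure M F"
        by (subst Bochner_Integration.integral_add[OF ib' ind]) (simp_all add: intb)
      also have "2 * exp 1 / s0 * (beta * Q) \<le> 2 * exp 1 * beta"
      proof -
        have "2 * exp 1 / s0 * (beta * Q) \<le> 2 * exp 1 / s0 * (beta * s0)"
          using True beta0 s0 by (intro mult_left_mono) auto
        thus ?thesis using s0 by simp
      qed
      finally show ?thesis by simp
    qed
    \<comment> \<open>On \<open>G\<close> the weight is at least \<open>s0 / (2 * exp 1)\<close>,
      the distance to \<open>a\<close> at least \<open>y\<close> and the drop of the logistic at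
      least \<open>s0 / 2\<close>, so \<open>G\<close> cannot be heavy without producing
      dispersion.\<close>
    have step2: "s0\<^sup>2 * y / (4 * exp 1) * measure M G \<le> beta * Q"
    proof -
      have "(\<integral>x. s0\<^sup>2 * y / (4 * exp 1) * indicator G x \<partial>M) \<le> (\<integral>x. b x \<partial>M)"
      proof (rule integral_mono)
        show "integrable M (\<lambda>x. s0\<^sup>2 * y / (4 * exp 1) * indicator G x)" by (intro ind) simp
        fix x assume x: "x \<in> space M"
        show "s0\<^sup>2 * y / (4 * exp 1) * indicator G x \<le> b x"
        proof (cases "x \<in> G")
          case True
          hence zx: "c \<le> z x" "z x < c + 1" by (auto simp: G_def)
          have "logistic (c + 1) \<le> exp 1 * s x"
            using logistic_shift_le[of 1 c] logistic_mono[OF zx(1)] unfolding s_def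
            by (smt (verit) exp_gt_zero mult_left_mono)
          hence sx: "s0 / (2 * exp 1) \<le> s x" unfolding half by (simp add: field_simps)
          have az: "a - z x \<ge> y" using zx unfolding c_def by linarith
          have "s0\<^sup>2 * y / (4 * exp 1) = s0 / (2 * exp 1) * y * (s0 / 2)" by (simp add: power2_eq_square)
          also have "\<dots> \<le> s x * (a - z x) * (s0 - s x)"
            using sx az low[OF zx(2)] s0 y s[of x] by (intro mult_mono mult_nonneg_nonneg) (auto intro: order_trans[of _ y])
          also have "\<dots> = b x" unfolding b_def by (simp add: algebra_simps)
          finally show ?thesis using True by simp
        qed (use b0 in auto)
      qed (rule ib)
      thus ?thesis by (simp add: intb)
    qed
    \<comment> \<open>Since the weighted mean of \<open>z - a\<close> vanishes, its positive part is
      controlled by its negative part, hence by \<open>y * Q\<close> and the dispersion. At most 3/8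
      of \<open>Q\<close> comes from the left of \<open>c + 1\<close> and at most 1/4 from the right
      of \<open>J\<close>, so \<open>J\<close> carries the remaining 3/8.\<close>
    have step4: "Q \<le> 3 * exp 8 * s0 * measure M J"
    proof -
      define pp where "pp x = s x * max 0 (z x - a)" for x
      have mpp[measurable]: "pp \<in> borel_measurable M" unfolding pp_def by measurable
      have ipp: "integrable M pp"
        by (rule integrable_bounded[OF _ order_trans[OF _ st]]) (use s in \<open>auto simp: pp_def abs_mult max_def\<close>)
      have bQ: "beta * Q \<le> s0 / 8 * Q" using True Q0 by (intro mult_right_mono) auto
      have "(\<integral>x. pp x \<partial>M) \<le> (\<integral>x. s x * (z x - a) + (y * s x + (2 / s0) * b x) \<partial>M)"
      proof (rule integral_mono)
        fix x assume "x \<in> space M"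
        show "pp x \<le> s x * (z x - a) + (y * s x + (2 / s0) * b x)"
        proof (cases "z x < c + 1")
          case True
          hence "z x \<le> a" using y unfolding c_def by linarith
          moreover have "0 \<le> y * s x" using s[of x] y by simp
          ultimately show ?thesis using lowb(1)[OF True] by (simp add: pp_def algebra_simps)
        next
          case False
          have "pp x \<le> s x * (z x - a + y)" unfolding pp_def
            using False s[of x] y unfolding c_def by (intro mult_left_mono) auto
          moreover have "0 \<le> (2 / s0) * b x" using s0 b0[of x] by simp
          ultimately show ?thesis by (simp add: algebra_simps)
        qed
      qed (use iS it ib ipp in auto)
      also have "\<dots> = y * Q + 2 / s0 * (beta * Q)" using iS it ib by (simp add: Qs means intb)
      also have "2 / s0 * (beta * Q) \<le> 2 / s0 * (s0 / 8 * Q)" using bQ s0 by (intro mult_left_mono) auto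
      also have "\<dots> = Q / 4" using s0 by simp
      finally have pQ: "(\<integral>x. pp x \<partial>M) \<le> (y + 1/4) * Q" by (simp add: algebra_simps)
      have Ky: "real K - y \<ge> 4 * y + 1" using K by linarith
      have "Q = (\<integral>x. s x \<partial>M)" by (simp add: Qs)
      also have "\<dots> \<le> (\<integral>x. exp 8 * s0 * indicator J x + (2 / (s0 * y) * b x + pp x / (real K - y)) \<partial>M)"
      proof (rule integral_mono)
        fix x assume x: "x \<in> space M"
        have n1: "0 \<le> 2 / (s0 * y) * b x" using s0 y b0[of x] by simp
        have n2: "0 \<le> pp x / (real K - y)" using s[of x] Ky y by (simp add: pp_def)
        have n3: "0 \<le> exp 8 * s0 * indicator J x" using s0 by simp
        consider "z x < c + 1" | "x \<in> J" | "z x \<ge> c + 1 + real K" using x unfolding J_def by force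
        thus "s x \<le> exp 8 * s0 * indicator J x + (2 / (s0 * y) * b x + pp x / (real K - y))"
        proof cases
          case 1
          thus ?thesis using lowb(2)[OF 1] n1 n2 n3 by linarith
        next
          case 2
          \<comment> \<open>For \<open>a \<ge> 0\<close> this holds because
            \<open>s0 \<ge> 1/2\<close>. For \<open>a < 0\<close> one has
            \<open>y \<le> 3/2\<close>, so \<open>J\<close> ends no further than
            \<open>a + 4 * y + 2 \<le> a + 8\<close>.\<close>
          have "s x \<le> exp 8 * s0"
          proof (cases "a \<ge> 0")
            case True
            have "logistic 0 \<le> s0" unfolding s0_def using True by (rule logistic_mono)
            hence "1 \<le> 2 * s0" by (simp add: logistic_def)
            also have "\<dots> \<le> exp 8 * s0" using s0 exp_ge_add_one_self[of "8::real"] by (intro mult_right_mono) linarith+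
            finally show ?thesis using s[of x] by linarith
          next
            case False
            have "y \<le> ln 3" unfolding y_def using False by (subst ln_le_cancel_iff) (auto simp: add_pos_pos)
            also have "ln 3 = ln (3/2) + ln (2::real)" using ln_mult[of "3/2::real" 2] by simp
            also have "\<dots> \<le> (3/2 - 1) + (2 - 1)" by (intro add_mono ln_le_minus_one) auto
            finally have "y \<le> 3/2" by simp
            hence "z x \<le> a + 8" using 2 K unfolding J_def c_def by auto
            thus ?thesis unfolding s_def s0_def using logistic_mono[of "z x" "a + 8"] logistic_shift_le[of 8 a] by linarith
          qed
          thus ?thesis using 2 n1 n2 by simp
        next
          case 3
          have "z x - a \<ge> real K - y" using 3 unfolding c_def by linarith
          hence "s x * (real K - y) \<le> pp x" unfolding pp_def using s[of x] by (intro mult_left_mono) auto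
          hence "s x \<le> pp x / (real K - y)" using Ky y by (simp add: field_simps)
          thus ?thesis using n1 n3 by linarith
        qed
      next
        show "integrable M (\<lambda>x. exp 8 * s0 * indicator J x + (2 / (s0 * y) * b x + pp x / (real K - y)))"
          using ipp by (intro Bochner_Integration.integrable_add ib' ind) simp_all
      qed (rule iS)
      also have "\<dots> = exp 8 * s0 * measure M J + (2 / (s0 * y) * (beta * Q) + (\<integral>x. pp x \<partial>M) / (real K - y))"
      proof -
        have "integrable M (\<lambda>x. pp x / (real K - y))" using ipp by simp
        thus ?thesis
          by (subst Bochner_Integration.integral_add[OF ind Bochner_Integration.integrable_add[OF ib']], simp, simp,
              subst Bochner_Integration.integral_add[OF ib']) (simp_all add: intb)
      qed
      also have "2 / (s0 * y) * (beta * Q) \<le> 2 / (s0 * y) * (s0 / 8 * Q)"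
        using bQ s0 y by (intro mult_left_mono) auto
      also have "\<dots> = Q / (4 * y)" using s0 by simp
      also have "Q / (4 * y) \<le> 3 / 8 * Q" using y Q0 by (simp add: field_simps)
      also have "(\<integral>x. pp x \<partial>M) / (real K - y) \<le> (y + 1/4) * Q / (4 * y + 1)"
        using pQ Ky y Q0 by (intro frac_le) auto
      also have "\<dots> = Q / 4" using y by (simp add: field_simps)
      finally have "3 * Q \<le> 8 * (exp 8 * s0 * measure M J)" by simp
      moreover have "0 \<le> exp 8 * s0 * measure M J" using s0 by simp
      ultimately show ?thesis by simp
    qed
    \<comment> \<open>Here log-concavity enters: \<open>slab\<close> trades the mass of
      \<open>J\<close>, bounded below by \<open>step4\<close>, for the mass of \<open>G\<close>,
      which \<open>step2\<close> bounds by the dispersion.\<close>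
    have "s0 * measure M F \<le> 96 * exp 9 * beta"
    proof -
      have "measure M F * Q \<le> measure M F * (3 * exp 8 * s0 * measure M J)"
        using step4 by (intro mult_left_mono) auto
      also have "\<dots> = 3 * exp 8 * s0 * (measure M F * measure M J)" by simp
      also have "\<dots> \<le> 3 * exp 8 * s0 * (real K * measure M G)" using slab s0 by (intro mult_left_mono) auto
      also have "\<dots> \<le> 3 * exp 8 * s0 * (8 * y * measure M G)"
        using K y s0 by (intro mult_left_mono mult_right_mono) auto
      finally have "s0 * measure M F * Q \<le> s0 * (3 * exp 8 * s0 * (8 * y * measure M G))"
        using s0 by (simp add: mult.assoc)
      also have "\<dots> = 96 * (exp 8 * exp 1) * (s0\<^sup>2 * y / (4 * exp 1) * measure M G)"
        by (simp add: power2_eq_square)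
      also have "\<dots> \<le> 96 * (exp 8 * exp 1) * (beta * Q)" using step2 by (intro mult_left_mono) auto
      also have "exp 8 * exp 1 = exp (9::real)" by (simp flip: exp_add)
      finally show ?thesis using Q0 by simp
    qed
    with step1 show ?thesis unfolding gap_const_def by (simp add: algebra_simps)
  qed
  thus ?thesis unfolding beta_def b_def s_def s0_def .
qed

end

section \<open>Linear forms on a box\<close>

lemma ln_logistic_shift: "ln (logistic (u + e)) - ln (logistic u) = - ln (logistic u + (1 - logistic u) * exp (- e))"
proof -
  define s where "s = logistic u"
  have s: "s > 0" "s < 1" unfolding s_def by (auto simp: logistic_pos logistic_less_1)
  have pos: "s + (1 - s) * exp (- e) > 0" using s by (intro add_pos_pos mult_pos_pos) auto
  have "logistic (u + e) * (s + (1 - s) * exp (-e)) = s"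
  proof -
    have "logistic (u + e) - s = (1 - s) * logistic (u + e) * (1 - exp (- e))"
      using logistic_shift_diff[of "u + e" u] by (simp add: s_def)
    thus ?thesis by (simp add: algebra_simps)
  qed
  hence "logistic (u + e) = s / (s + (1 - s) * exp (-e))" using pos by (simp add: field_simps)
  hence "ln (logistic (u + e)) = ln s - ln (s + (1 - s) * exp (-e))" using s pos by (simp add: ln_div)
  thus ?thesis unfolding s_def by simp
qed

lemma ln_logistic_tangent: "ln (logistic v) \<le> ln (logistic u) + (1 - logistic u) * (v - u)"
proof -
  define s where "s = logistic u"
  have s: "s > 0" "s < 1" unfolding s_def by (auto simp: logistic_pos logistic_less_1)
  define e where "e = v - u"
  have "exp ((1 - (1 - s)) *\<^sub>R 0 + (1 - s) *\<^sub>R (- e)) \<le> (1 - (1 - s)) * exp 0 + (1 - s) * exp (- e)"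
    by (rule convex_onD[OF exp_convex]) (use s in auto)
  hence "exp (- (1 - s) * e) \<le> s + (1 - s) * exp (- e)" by (simp add: algebra_simps)
  hence "ln (exp (- (1 - s) * e)) \<le> ln (s + (1 - s) * exp (- e))"
    by (subst ln_le_cancel_iff) (use s in \<open>auto intro!: add_pos_pos mult_pos_pos\<close>)
  hence "- (1 - s) * e \<le> ln (s + (1 - s) * exp (- e))" by (simp only: ln_exp)
  thus ?thesis using ln_logistic_shift[of u e] unfolding s_def e_def by (simp add: algebra_simps)
qed

lemma exp_minus_quadratic_bound:
  assumes "\<bar>e\<bar> \<le> (1::real)"
  shows "exp (- e) \<le> 1 - e + e\<^sup>2"
proof (cases "e \<ge> 0")
  case True
  have "exp (-e) = 1 / exp e" by (simp add: exp_minus field_simps)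
  also have "\<dots> \<le> 1 / (1 + e)" using True by (intro divide_left_mono) (auto intro!: mult_pos_pos simp: add_pos_nonneg)
  also have "\<dots> \<le> 1 - e + e\<^sup>2"
  proof -
    have "1 \<le> (1 - e + e\<^sup>2) * (1 + e)" using True by (simp add: algebra_simps power2_eq_square)
    thus ?thesis using True by (simp add: divide_le_eq)
  qed
  finally show ?thesis .
next
  case False
  thus ?thesis using exp_bound[of "-e"] assms by simp
qed

text \<open>Applied only to increments that tend to zero in \<open>dilation_inequality\<close>, so
  any finite constant in front of the quadratic error would do.\<close>

lemma ln_logistic_lower:
  assumes "\<bar>e\<bar> \<le> 1"
  shows "ln (logistic u) + (1 - logistic u) * e - e\<^sup>2 \<le> ln (logistic (u + e))"
proof -
  define s where "s = logistic u"
  have s: "s > 0" "s < 1" unfolding s_def by (auto simp: logistic_pos logistic_less_1)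
  have pos: "s + (1 - s) * exp (- e) > 0" using s by (intro add_pos_pos mult_pos_pos) auto
  have "ln (s + (1 - s) * exp (- e)) \<le> s + (1 - s) * exp (- e) - 1" using pos by (rule ln_le_minus_one)
  also have "\<dots> \<le> s + (1 - s) * (1 - e + e\<^sup>2) - 1"
    using exp_minus_quadratic_bound[OF assms] s by (intro diff_right_mono add_left_mono mult_left_mono) auto
  also have "\<dots> = - (1 - s) * e + (1 - s) * e\<^sup>2" by (simp add: algebra_simps)
  also have "\<dots> \<le> - (1 - s) * e + 1 * e\<^sup>2" using s by (intro add_left_mono mult_right_mono) auto
  finally show ?thesis using ln_logistic_shift[of u e] unfolding s_def by (simp add: algebra_simps)
qed

text \<open>Adding the tangent bounds at the weighted mean cancels the linear terms.\<close>

lemma logistic_log_concave: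
  assumes "p > 0" "q > (0::nat)"
  shows "logistic x ^ p * logistic y ^ q \<le> logistic ((real p * x + real q * y) / real (p + q)) ^ (p + q)"
proof -
  define m where "m = (real p * x + real q * y) / real (p + q)"
  have mm: "real p * (x - m) + real q * (y - m) = 0"
    using assms by (simp add: m_def field_simps)
  have "real p * ln (logistic x) + real q * ln (logistic y)
     \<le> real p * (ln (logistic m) + (1 - logistic m) * (x - m)) + real q * (ln (logistic m) + (1 - logistic m) * (y - m))"
    by (intro add_mono mult_left_mono ln_logistic_tangent) auto
  also have "\<dots> = real (p + q) * ln (logistic m) + (1 - logistic m) * (real p * (x - m) + real q * (y - m))"
    by (simp add: algebra_simps)
  finally have "real p * ln (logistic x) + real q * ln (logistic y) \<le> real (p + q) * ln (logistic m)"
    by (simp only: mm mult_zero_right add_0_right)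
  hence "ln (logistic x ^ p * logistic y ^ q) \<le> ln (logistic m ^ (p + q))"
    using logistic_pos by (simp add: ln_mult ln_realpow)
  thus ?thesis unfolding m_def[symmetric] using logistic_pos
    by (subst (asm) ln_le_cancel_iff) (auto intro!: mult_pos_pos zero_less_power)
qed

text \<open>The labels are meant to be absorbed into the signs of \<open>c\<close>, so that
  \<open>logistic (zeta i x)\<close> is the probability of the observed label of \<open>i\<close>,
  \<open>W R\<close> the likelihood of the observations in \<open>R\<close>, and \<open>Z R\<close>
  their marginal likelihood under the unnormalised uniform prior on the box.\<close>

locale linear_forms_on_box =
  fixes I :: "nat set" and b :: real and c :: "'i \<Rightarrow> nat \<Rightarrow> real"
  assumes finI: "finite I" and b_pos: "b > 0"
begin

abbreviation "P \<equiv> box_measure b I"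

definition zeta :: "'i \<Rightarrow> (nat \<Rightarrow> real) \<Rightarrow> real" where
  "zeta i x = (\<Sum>k\<in>I. c i k * x k)"

definition W :: "'i set \<Rightarrow> (nat \<Rightarrow> real) \<Rightarrow> real" where
  "W R x = (\<Prod>i\<in>R. logistic (zeta i x))"

definition Z :: "'i set \<Rightarrow> real" where
  "Z R = (\<integral>x. W R x \<partial>P)"

sublocale fm: finite_measure P
  using finI by (rule finite_box_measure)

lemma zeta_measurable [measurable]: "zeta i \<in> borel_measurable P"
  unfolding zeta_def[abs_def] by measurable

lemma W_measurable [measurable]: "W R \<in> borel_measurable P"
  unfolding W_def[abs_def] by measurable

text \<open>Serves integrability and the limit in the dilation argument; it grows with the box and
  enters no final constant.\<close>

definition zbound :: "'i \<Rightarrow> real" where "zbound i = (\<Sum>k\<in>I. \<bar>c i k\<bar> * b)"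

lemma zeta_bound: "x \<in> space P \<Longrightarrow> \<bar>zeta i x\<bar> \<le> zbound i"
proof -
  assume x: "x \<in> space P"
  have "\<bar>zeta i x\<bar> \<le> (\<Sum>k\<in>I. \<bar>c i k * x k\<bar>)" unfolding zeta_def by (rule sum_abs)
  also have "\<dots> \<le> zbound i" unfolding zbound_def abs_mult
    using x by (intro sum_mono mult_left_mono) (auto simp: space_box_measure PiE_def Pi_def abs_le_iff minus_le_iff)
  finally show ?thesis .
qed

lemma W_pos: "W R x > 0" unfolding W_def by (intro prod_pos) (auto simp: logistic_pos)

lemma W_le_1: "W R x \<le> 1" unfolding W_def by (intro prod_le_1) (auto simp: logistic_pos logistic_less_1 less_imp_le)

lemma W_remove: "finite R \<Longrightarrow> i \<in> R \<Longrightarrow> W R x = logistic (zeta i x) * W (R - {i}) x"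
  unfolding W_def by (rule prod.remove)

lemma W_integrable_mult:
  assumes "f \<in> borel_measurable P" "\<And>x. x \<in> space P \<Longrightarrow> \<bar>f x\<bar> \<le> C"
  shows "integrable P (\<lambda>x. W R x * f x)"
proof (rule fm.integrable_bounded[of _ C])
  show "(\<lambda>x. W R x * f x) \<in> borel_measurable P" using assms(1) by simp
  fix x assume x: "x \<in> space P"
  have "\<bar>W R x\<bar> * \<bar>f x\<bar> \<le> 1 * C" using W_pos[of R x] W_le_1[of R x] assms(2)[OF x] by (intro mult_mono) auto
  thus "\<bar>W R x * f x\<bar> \<le> C" by (simp add: abs_mult)
qed

lemma W_integrable: "integrable P (W R)"
  using W_integrable_mult[of "\<lambda>_. 1" 1] by simp

lemma Z_pos: "Z R > 0"
proof -
  have "Z R \<ge> 0" unfolding Z_def using W_pos by (intro Bochner_Integration.integral_nonneg) (auto simp: less_imp_le)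
  moreover have "Z R \<noteq> 0"
  proof
    assume "Z R = 0"
    hence "AE x in P. W R x = 0" unfolding Z_def
      using integral_nonneg_eq_0_iff_AE[OF W_integrable] W_pos by (auto simp: less_imp_le)
    hence "AE x in P. False" by eventually_elim (use W_pos[of R] in \<open>metis less_irrefl\<close>)
    hence "emeasure P (space P) = 0" by (simp add: eventually_False ae_filter_eq_bot_iff)
    thus False using emeasure_box_measure_pos[OF finI b_pos] by simp
  qed
  ultimately show ?thesis by simp
qed

text \<open>Contracting the box towards \<open>z\<close> by \<open>1 - h\<close> multiplies volumes by \<open>(1 - h) ^ card I\<close>; this is the
  derivative at \<open>h = 0\<close>.\<close>

lemma dilation_inequality:
  assumes R: "finite R" and z: "z \<in> space P"
  shows "(\<Sum>i\<in>R. \<integral>x. W R x * ((zeta i z - zeta i x) * (1 - logistic (zeta i x))) \<partial>P) \<le> real (card I) * Z R"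
proof -
  define d where "d = card I"
  define S where "S x = (\<Sum>i\<in>R. (zeta i z - zeta i x) * (1 - logistic (zeta i x)))" for x
  define D where "D i = 2 * zbound i" for i
  define C where "C = (\<Sum>i\<in>R. (D i)\<^sup>2)"
  have C0: "C \<ge> 0" unfolding C_def by (intro sum_nonneg) auto
  have del: "\<bar>zeta i z - zeta i x\<bar> \<le> D i" if "x \<in> space P" for i x
    using zeta_bound[OF that, of i] zeta_bound[OF z, of i] unfolding D_def by linarith
  have D0: "D i \<ge> 0" for i using del[OF z, of i] by simp
  have term_bd: "\<bar>(zeta i z - zeta i x) * (1 - logistic (zeta i x))\<bar> \<le> D i" if "x \<in> space P" for i x
  proof -
    have "\<bar>zeta i z - zeta i x\<bar> * \<bar>1 - logistic (zeta i x)\<bar> \<le> D i * 1"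
      using del[OF that, of i] D0[of i] logistic_pos[of "zeta i x"] logistic_less_1[of "zeta i x"] by (intro mult_mono) auto
    thus ?thesis by (simp add: abs_mult)
  qed
  have Sm[measurable]: "S \<in> borel_measurable P" unfolding S_def[abs_def] by measurable
  have Sb: "\<bar>S x\<bar> \<le> (\<Sum>i\<in>R. D i)" if "x \<in> space P" for x
    unfolding S_def using term_bd[OF that] by (intro order_trans[OF sum_abs] sum_mono) auto
  have SI: "(\<integral>x. W R x * S x \<partial>P) = (\<Sum>i\<in>R. \<integral>x. W R x * ((zeta i z - zeta i x) * (1 - logistic (zeta i x))) \<partial>P)"
    unfolding S_def sum_distrib_left
    by (rule Bochner_Integration.integral_sum) (rule W_integrable_mult[OF _ term_bd], auto)
  have iS: "integrable P (\<lambda>x. W R x * S x)" by (rule W_integrable_mult[OF Sm Sb])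
  \<comment> \<open>Version for positive \<open>h\<close>: the first summand is the Bernoulli bound
    for \<open>((1 / (1 - h)) ^ d - 1) / h\<close>, and \<open>h * C\<close> is the second-order
    error of the log-likelihood.\<close>
  have step: "(\<integral>x. W R x * S x \<partial>P) \<le> (real d / (1 - real d * h) + h * C) * Z R"
    if h: "0 < h" "h < 1" "real d * h < 1" "\<And>i. i \<in> R \<Longrightarrow> h * D i \<le> 1" for h
  proof -
    define T where "T x = (\<lambda>k\<in>I. z k + (1 - h) * (x k - z k))" for x
    have zT: "zeta i (T x) = zeta i x + h * (zeta i z - zeta i x)" for i x
    proof -
      have "zeta i (T x) = (\<Sum>k\<in>I. c i k * (z k + (1 - h) * (x k - z k)))" by (simp add: zeta_def T_def)
      also have "\<dots> = (\<Sum>k\<in>I. c i k * x k + h * (c i k * z k - c i k * x k))"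
        by (intro sum.cong) (auto simp: algebra_simps)
      finally show ?thesis by (simp add: zeta_def sum.distrib sum_subtractf sum_distrib_left[symmetric])
    qed
    have pw: "W R x * (1 + h * S x - h\<^sup>2 * C) \<le> W R (T x)" if x: "x \<in> space P" for x
    proof -
      have lnW: "ln (W R y) = (\<Sum>i\<in>R. ln (logistic (zeta i y)))" for y
        unfolding W_def using logistic_pos by (intro ln_prod R) (auto simp: less_imp_neq[symmetric])
      have e: "\<bar>h * (zeta i z - zeta i x)\<bar> \<le> h * D i" for i
        using del[OF x, of i] h by (simp add: abs_mult)
      have "ln (W R x) + (h * S x - h\<^sup>2 * C) \<le>
        (\<Sum>i\<in>R. ln (logistic (zeta i x)) + (1 - logistic (zeta i x)) * (h * (zeta i z - zeta i x)) - (h * D i)\<^sup>2)"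
        unfolding lnW S_def C_def
        by (simp add: sum.distrib sum_subtractf sum_distrib_left power_mult_distrib mult_ac)
      also have "\<dots> \<le> (\<Sum>i\<in>R. ln (logistic (zeta i (T x))))"
      proof (rule sum_mono)
        fix i assume i: "i \<in> R"
        have "(h * (zeta i z - zeta i x))\<^sup>2 \<le> (h * D i)\<^sup>2"
          using e[of i] by (metis abs_ge_zero power2_abs power_mono)
        moreover have "\<bar>h * (zeta i z - zeta i x)\<bar> \<le> 1" using e[of i] h(4)[OF i] by linarith
        ultimately show "ln (logistic (zeta i x)) + (1 - logistic (zeta i x)) * (h * (zeta i z - zeta i x)) - (h * D i)\<^sup>2
          \<le> ln (logistic (zeta i (T x)))"
          unfolding zT using ln_logistic_lower[of "h * (zeta i z - zeta i x)" "zeta i x"] by linarith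
      qed
      also have "\<dots> = ln (W R (T x))" by (simp add: lnW)
      finally have "exp (ln (W R x) + (h * S x - h\<^sup>2 * C)) \<le> exp (ln (W R (T x)))" by simp
      hence "W R x * exp (h * S x - h\<^sup>2 * C) \<le> W R (T x)"
        using W_pos by (simp add: exp_add)
      moreover have "W R x * (1 + (h * S x - h\<^sup>2 * C)) \<le> W R x * exp (h * S x - h\<^sup>2 * C)"
        using W_pos[of R x] by (intro mult_left_mono) (auto simp: less_imp_le exp_ge_add_one_self)
      ultimately show ?thesis by (simp add: add_diff_eq)
    qed
    have "(\<integral>\<^sup>+x. ennreal (W R (T x)) \<partial>P) \<le> ennreal (1 / (1 - h)) ^ card I * (\<integral>\<^sup>+x. ennreal (W R x) \<partial>P)"
      unfolding T_def using z h
      by (intro nn_integral_box_contract finI) (auto simp: space_box_measure PiE_def Pi_def)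
    also have "(\<integral>\<^sup>+x. ennreal (W R x) \<partial>P) = ennreal (Z R)"
      unfolding Z_def using W_pos by (intro nn_integral_eq_integral W_integrable) (auto simp: less_imp_le)
    also have "ennreal (1 / (1 - h)) ^ card I * ennreal (Z R) = ennreal ((1 / (1 - h)) ^ d * Z R)"
      using h Z_pos[of R] by (simp add: ennreal_power d_def ennreal_mult)
    finally have up: "(\<integral>\<^sup>+x. ennreal (W R (T x)) \<partial>P) \<le> ennreal ((1 / (1 - h)) ^ d * Z R)" .
    define f where "f x = W R x * (1 + h * S x - h\<^sup>2 * C)" for x
    have fi: "integrable P f"
    proof -
      have "integrable P (\<lambda>x. W R x + h * (W R x * S x) - h\<^sup>2 * C * W R x)"
        using iS W_integrable by simp
      thus ?thesis unfolding f_def[abs_def] by (simp add: algebra_simps)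
    qed
    have iT: "integrable P (\<lambda>x. W R (T x))"
    proof (rule fm.integrable_bounded[of _ 1])
      show "(\<lambda>x. W R (T x)) \<in> borel_measurable P" unfolding W_def zT by measurable
    qed (use W_pos W_le_1 in \<open>auto simp: abs_of_pos\<close>)
    have "(\<integral>x. f x \<partial>P) \<le> (\<integral>x. W R (T x) \<partial>P)"
      by (intro integral_mono fi iT) (use pw in \<open>auto simp: f_def\<close>)
    moreover have "(\<integral>\<^sup>+x. ennreal (W R (T x)) \<partial>P) = ennreal (\<integral>x. W R (T x) \<partial>P)"
      using W_pos by (intro nn_integral_eq_integral iT) (auto simp: less_imp_le)
    hence "(\<integral>x. W R (T x) \<partial>P) \<le> (1 / (1 - h)) ^ d * Z R"
      using up h Z_pos[of R] by (simp add: ennreal_le_iff)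
    ultimately have fle: "(\<integral>x. f x \<partial>P) \<le> (1 / (1 - h)) ^ d * Z R" by linarith
    have "(\<integral>x. f x \<partial>P) = Z R + h * (\<integral>x. W R x * S x \<partial>P) - h\<^sup>2 * C * Z R"
    proof -
      have "(\<integral>x. f x \<partial>P) = (\<integral>x. W R x + h * (W R x * S x) - h\<^sup>2 * C * W R x \<partial>P)"
        by (intro Bochner_Integration.integral_cong) (auto simp: f_def algebra_simps)
      thus ?thesis using iS W_integrable by (simp add: Z_def)
    qed
    moreover have "(1 / (1 - h)) ^ d \<le> 1 / (1 - real d * h)"
    proof -
      have "1 - real d * h \<le> (1 - h) ^ d" using Bernoulli_inequality[of "- h" d] h by simp
      hence "1 / (1 - h) ^ d \<le> 1 / (1 - real d * h)" using h by (intro divide_left_mono) auto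
      thus ?thesis by (simp add: power_divide)
    qed
    ultimately have "h * (\<integral>x. W R x * S x \<partial>P) \<le> (1 / (1 - real d * h)) * Z R - Z R + h\<^sup>2 * C * Z R"
      using fle mult_right_mono[of "(1 / (1 - h)) ^ d" "1 / (1 - real d * h)" "Z R"] Z_pos[of R] by linarith
    also have "\<dots> = h * ((real d / (1 - real d * h) + h * C) * Z R)"
      using h by (simp add: field_simps power2_eq_square)
    finally show ?thesis using h by simp
  qed
  have "((\<lambda>h. (real d / (1 - real d * h) + h * C) * Z R) \<longlongrightarrow> (real d / (1 - real d * 0) + 0 * C) * Z R) (at_right 0)"
    by (intro tendsto_intros) auto
  hence lim: "((\<lambda>h. (real d / (1 - real d * h) + h * C) * Z R) \<longlongrightarrow> real d * Z R) (at_right 0)" by simp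
  have "(\<integral>x. W R x * S x \<partial>P) \<le> real d * Z R"
  proof (rule tendsto_lowerbound[OF lim])
    \<comment> \<open>Below this \<open>m\<close>, each of \<open>h\<close>,
      \<open>real d * h\<close> and \<open>h * D i\<close> is less than 1, as \<open>step\<close>
      demands.\<close>
    define m where "m = 1 / (1 + real d + (\<Sum>i\<in>R. D i))"
    have sD: "(\<Sum>i\<in>R. D i) \<ge> 0" by (intro sum_nonneg D0)
    have m: "m > 0" unfolding m_def using sD by simp
    have "eventually (\<lambda>h. h \<in> {0<..<m}) (at_right 0)" using m by (rule eventually_at_right_real)
    thus "\<forall>\<^sub>F h in at_right 0. (\<integral>x. W R x * S x \<partial>P) \<le> (real d / (1 - real d * h) + h * C) * Z R"
    proof eventually_elim
      case (elim h)
      hence hm: "h > 0" "h * (1 + real d + (\<Sum>i\<in>R. D i)) < 1" using sD by (auto simp: m_def field_simps)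
      have a: "0 \<le> real d * h" "0 \<le> h * (\<Sum>i\<in>R. D i)" using hm sD by auto
      have e: "h + real d * h + h * (\<Sum>i\<in>R. D i) < 1" using hm(2) by (simp add: algebra_simps)
      show ?case
      proof (rule step)
        show "0 < h" "h < 1" "real d * h < 1" using hm(1) a e by linarith+
        fix i assume "i \<in> R"
        hence "D i \<le> (\<Sum>i\<in>R. D i)" using R D0 by (intro member_le_sum) auto
        hence "h * D i \<le> h * (\<Sum>i\<in>R. D i)" using hm by (intro mult_left_mono) auto
        thus "h * D i \<le> 1" using hm(1) a e by linarith
      qed
    qed
  qed simp
  thus ?thesis unfolding SI d_def .
qed

end

section \<open>Log-concave marginals and leave-one-out prediction\<close>

context linear_forms_on_box
begin

definition slab :: "'i \<Rightarrow> real \<Rightarrow> (nat \<Rightarrow> real) set" where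
  "slab i t = {x \<in> space P. t \<le> zeta i x \<and> zeta i x < t + 1}"

lemma slab_sets [measurable]: "slab i t \<in> sets P"
  unfolding slab_def by measurable

lemma zeta_convex_combination:
  "zeta i (\<lambda>k\<in>I. (real p * x k + real q * y k) / real (p + q)) = (real p * zeta i x + real q * zeta i y) / real (p + q)"
proof -
  have "zeta i (\<lambda>k\<in>I. (real p * x k + real q * y k) / real (p + q)) = (\<Sum>k\<in>I. (real p * (c i k * x k) + real q * (c i k * y k)) / real (p + q))"
    unfolding zeta_def by (intro sum.cong) (auto simp: algebra_simps add_divide_distrib)
  thus ?thesis by (simp add: zeta_def sum.distrib sum_distrib_left sum_divide_distrib[symmetric])
qed

lemma W_log_concave:
  assumes "finite R" "p > 0" "q > (0::nat)"
  shows "W R x ^ p * W R y ^ q \<le> W R (\<lambda>k\<in>I. (real p * x k + real q * y k) / real (p + q)) ^ (p + q)"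
  unfolding W_def prod_power_distrib prod.distrib[symmetric] zeta_convex_combination
  using assms logistic_pos by (intro prod_mono conjI logistic_log_concave mult_nonneg_nonneg zero_le_power) (auto simp: less_imp_le)

text \<open>Prekopa-Leindler for \<open>W R\<close> cut off to slabs: weighted means of points of
  the slabs at \<open>t1\<close> and \<open>t2\<close> lie in the slab at \<open>t3\<close>, because
  half-open intervals of equal length survive this averaging.\<close>

lemma slab_interpolation:
  assumes R: "finite R" and pq: "p > 0" "q > (0::nat)"
    and t: "real p * t1 + real q * t2 = real (p + q) * t3"
  shows "(\<integral>x. W R x * indicator (slab i t1) x \<partial>P) ^ p * (\<integral>x. W R x * indicator (slab i t2) x \<partial>P) ^ q
     \<le> (\<integral>x. W R x * indicator (slab i t3) x \<partial>P) ^ (p + q)"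
proof -
  define g where "g t x = W R x * indicator (slab i t) x" for t x
  have g0: "g t x \<ge> 0" for t x unfolding g_def using W_pos[of R x] by (simp add: indicator_def)
  have gm[measurable]: "g t \<in> borel_measurable P" for t unfolding g_def by measurable
  have gi: "integrable P (g t)" for t unfolding g_def[abs_def]
    by (rule W_integrable_mult[of _ 1]) (auto simp: indicator_def)
  have nn: "(\<integral>\<^sup>+x. ennreal (g t x) \<partial>P) = ennreal (\<integral>x. g t x \<partial>P)" for t
    using g0 by (intro nn_integral_eq_integral gi) auto
  have "(\<integral>\<^sup>+x. ennreal (g t1 x) \<partial>P) ^ p * (\<integral>\<^sup>+x. ennreal (g t2 x) \<partial>P) ^ q \<le> (\<integral>\<^sup>+x. ennreal (g t3 x) \<partial>P) ^ (p + q)"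
  proof (rule prekopa_leindler_box[where C = 1, OF finI pq])
    have "ennreal (g t x) \<le> ennreal 1" for t x
      unfolding g_def using W_le_1[of R x] by (intro ennreal_leI) (auto simp: indicator_def)
    thus "ennreal (g t1 x) \<le> ennreal 1" "ennreal (g t2 x) \<le> ennreal 1" for x by blast+
    fix x y assume x: "x \<in> space P" and y: "y \<in> space P"
    define z where "z = (\<lambda>k\<in>I. (real p * x k + real q * y k) / real (p + q))"
    have zz: "zeta i z = (real p * zeta i x + real q * zeta i y) / real (p + q)"
      unfolding z_def by (rule zeta_convex_combination)
    have zs: "z \<in> space P"
      unfolding space_box_measure z_def
    proof (rule PiE_I)
      fix k assume k: "k \<in> I"
      have "real p * x k + real q * y k \<le> real p * b + real q * b" "real p * (-b) + real q * (-b) \<le> real p * x k + real q * y k"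
        using x y k unfolding space_box_measure by (intro add_mono mult_left_mono; auto simp: PiE_def Pi_def)+
      thus "(\<lambda>k\<in>I. (real p * x k + real q * y k) / real (p + q)) k \<in> {-b..b}" using pq k by (auto simp: field_simps)
    qed auto
    have "g t1 x ^ p * g t2 y ^ q \<le> g t3 z ^ (p + q)"
    proof (cases "x \<in> slab i t1 \<and> y \<in> slab i t2")
      case False
      hence "g t1 x = 0 \<or> g t2 y = 0" by (auto simp: g_def)
      thus ?thesis using pq g0[of t3 z] by (auto simp: power_0_left)
    next
      case True
      hence 1: "t1 \<le> zeta i x" "zeta i x < t1 + 1" "t2 \<le> zeta i y" "zeta i y < t2 + 1" by (auto simp: slab_def)
      have lo: "real p * t1 + real q * t2 \<le> real p * zeta i x + real q * zeta i y"
        using 1 by (intro add_mono mult_left_mono) auto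
      have hi: "real p * zeta i x + real q * zeta i y < real p * (t1 + 1) + real q * (t2 + 1)"
        using 1 pq by (intro add_strict_mono mult_strict_left_mono) auto
      have "z \<in> slab i t3"
        unfolding slab_def using zs lo hi t pq
        by (simp add: zz field_simps)
      thus ?thesis using W_log_concave[OF R pq, of x y] True by (simp add: g_def z_def)
    qed
    hence "ennreal (g t1 x ^ p * g t2 y ^ q) \<le> ennreal (g t3 z ^ (p + q))" by (rule ennreal_leI)
    thus "ennreal (g t1 x) ^ p * ennreal (g t2 y) ^ q \<le> ennreal (g t3 (\<lambda>k\<in>I. (real p * x k + real q * y k) / real (p + q))) ^ (p + q)"
      unfolding z_def using g0 by (simp add: ennreal_mult ennreal_power)
  qed auto
  hence "ennreal ((\<integral>x. g t1 x \<partial>P) ^ p * (\<integral>x. g t2 x \<partial>P) ^ q) \<le> ennreal ((\<integral>x. g t3 x \<partial>P) ^ (p + q))"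
    unfolding nn using g0 by (simp add: ennreal_mult ennreal_power Bochner_Integration.integral_nonneg)
  hence "(\<integral>x. g t1 x \<partial>P) ^ p * (\<integral>x. g t2 x \<partial>P) ^ q \<le> (\<integral>x. g t3 x \<partial>P) ^ (p + q)"
    using g0 by (subst (asm) ennreal_le_iff) (auto intro!: zero_le_power Bochner_Integration.integral_nonneg)
  thus ?thesis unfolding g_def .
qed

text \<open>Both \<open>t\<close> and \<open>t + real v - real u\<close> are weighted means of the
  outer points \<open>t - real u\<close> and \<open>t + real v\<close>, with weights
  \<open>v, u\<close> and \<open>u, v\<close> respectively. The product of the two interpolations is
  a power of order \<open>u + v\<close> of the claim; integer shifts keep the weights natural
  numbers.\<close>

lemma slab_four_point:
  assumes R: "finite R" and ij: "u > 0" "v > (0::nat)"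
  shows "(\<integral>x. W R x * indicator (slab i (t - real u)) x \<partial>P) * (\<integral>x. W R x * indicator (slab i (t + real v)) x \<partial>P)
     \<le> (\<integral>x. W R x * indicator (slab i t) x \<partial>P) * (\<integral>x. W R x * indicator (slab i (t + real v - real u)) x \<partial>P)"
    (is "?a * ?b \<le> ?c * ?d")
proof -
  have nn: "(\<integral>x. W R x * indicator (slab i s) x \<partial>P) \<ge> 0" for s
    using W_pos by (intro Bochner_Integration.integral_nonneg) (auto simp: less_imp_le)
  have "?a ^ v * ?b ^ u \<le> ?c ^ (v + u)"
    using ij by (intro slab_interpolation R) (auto simp: algebra_simps)
  moreover have "?a ^ u * ?b ^ v \<le> ?d ^ (u + v)"
    using ij by (intro slab_interpolation R) (auto simp: algebra_simps)
  ultimately have "(?a ^ v * ?b ^ u) * (?a ^ u * ?b ^ v) \<le> ?c ^ (v + u) * ?d ^ (u + v)"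
    using nn by (intro mult_mono) (auto intro!: mult_nonneg_nonneg zero_le_power)
  hence "(?a * ?b) ^ (u + v) \<le> (?c * ?d) ^ (u + v)"
    by (simp add: power_add power_mult_distrib mult_ac)
  moreover obtain m where m: "u + v = Suc m" using ij by (cases "u + v") auto
  ultimately show ?thesis using nn by (intro power_le_imp_le_base[of "?a * ?b" m]) (auto simp del: power_Suc)
qed

text \<open>\<open>logistic_predictive_gap\<close> is applied to the posterior given
  \<open>R - {i}\<close>. Reweighting it by \<open>logistic (zeta i x)\<close> gives the posterior
  given \<open>R\<close>, so the predictive probability is \<open>Z R / Z (R - {i})\<close>, while
  the mean and the dispersion are those of the full posterior.\<close>

lemma predictive_probability_gap:
  assumes R: "finite R" and i: "i \<in> R"
    and mean: "(\<integral>x. W R x * (zeta i x - a) \<partial>P) = 0"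
  shows "logistic a - Z R / Z (R - {i})
     \<le> gap_const * ((\<integral>x. W R x * ((zeta i x - a) * (logistic (zeta i x) - logistic a)) \<partial>P) / Z R)"
proof -
  define V where "V = W (R - {i})"
  define w where "w = Z (R - {i})"
  have w: "w > 0" unfolding w_def by (rule Z_pos)
  have V0: "V x > 0" for x unfolding V_def by (rule W_pos)
  have Vm[measurable]: "V \<in> borel_measurable P" unfolding V_def by simp
  define M where "M = density P (\<lambda>x. ennreal (V x / w))"
  have sM[simp]: "space M = space P" "sets M = sets P" by (simp_all add: M_def)
  have int: "(\<integral>x. f x \<partial>M) = (\<integral>x. V x * f x \<partial>P) / w" if [measurable]: "f \<in> borel_measurable P" for f :: "_ \<Rightarrow> real"
  proof -
    have "(\<integral>x. f x \<partial>M) = (\<integral>x. (V x / w) *\<^sub>R f x \<partial>P)"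
      unfolding M_def using V0 w by (intro integral_density) (auto simp: less_imp_le)
    thus ?thesis by simp
  qed
  have fin: "finite_measure M"
  proof
    have "emeasure M (space M) = (\<integral>\<^sup>+x. ennreal (V x / w) \<partial>P)"
      unfolding M_def by (simp add: emeasure_density nn_integral_restrict_space[symmetric] cong: nn_integral_cong)
    also have "\<dots> = ennreal (\<integral>x. V x / w \<partial>P)"
      using W_integrable[of "R - {i}"] V0 w by (intro nn_integral_eq_integral) (auto simp: V_def less_imp_le)
    finally show "emeasure M (space M) \<noteq> \<infinity>" by simp
  qed
  interpret M: finite_measure M by (rule fin)
  have meas: "measure M A = (\<integral>x. V x * indicator A x \<partial>P) / w" if A: "A \<in> sets P" for A
  proof -
    have "measure M A = (\<integral>x. indicator A x \<partial>M)"
      using A sets.sets_into_space[OF A] by (simp add: Int_absorb2)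
    also have "\<dots> = (\<integral>x. V x * indicator A x \<partial>P) / w" using A by (intro int) auto
    finally show ?thesis .
  qed
  have sl: "{x \<in> space M. t \<le> zeta i x \<and> zeta i x < t + 1} = slab i t" for t by (simp add: slab_def)
  have WR: "V x * logistic (zeta i x) = W R x" for x
    unfolding V_def using W_remove[OF R i, of x] by (simp add: mult.commute)
  have Q: "(\<integral>x. logistic (zeta i x) \<partial>M) = Z R / w"
    by (subst int) (auto simp: WR Z_def)
  have "logistic a - Z R / w \<le> gap_const * ((\<integral>x. logistic (zeta i x) * (zeta i x - a) * (logistic (zeta i x) - logistic a) \<partial>M) / (Z R / w))"
  proof (rule M.logistic_predictive_gap[of "zeta i" "zbound i"])
    show "zeta i \<in> borel_measurable M" unfolding M_def by simp
    show "\<bar>zeta i x\<bar> \<le> zbound i" if "x \<in> space M" for x using that by (intro zeta_bound) simp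
    have "(\<integral>x. V x * indicator (space P) x \<partial>P) = w" unfolding w_def Z_def V_def
      by (intro Bochner_Integration.integral_cong) auto
    thus "measure M (space M) = 1" using w by (simp add: meas)
    show "Z R / w = (\<integral>x. logistic (zeta i x) \<partial>M)" by (simp add: Q)
    show "Z R / w > 0" using Z_pos w by simp
    have "(\<integral>x. logistic (zeta i x) * (zeta i x - a) \<partial>M) = (\<integral>x. V x * (logistic (zeta i x) * (zeta i x - a)) \<partial>P) / w"
      by (rule int) measurable
    also have "(\<lambda>x. V x * (logistic (zeta i x) * (zeta i x - a))) = (\<lambda>x. W R x * (zeta i x - a))"
      by (simp add: WR[symmetric] mult.assoc)
    finally show "(\<integral>x. logistic (zeta i x) * (zeta i x - a) \<partial>M) = 0" using mean by simp
    fix t and u v :: nat assume uv: "0 < u" "0 < v"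
    have "finite (R - {i})" using R by simp
    from slab_four_point[OF this uv, of i t]
    have "(\<integral>x. V x * indicator (slab i (t - real u)) x \<partial>P) * (\<integral>x. V x * indicator (slab i (t + real v)) x \<partial>P)
     \<le> (\<integral>x. V x * indicator (slab i t) x \<partial>P) * (\<integral>x. V x * indicator (slab i (t + real v - real u)) x \<partial>P)"
      unfolding V_def .
    thus "measure M {x \<in> space M. t - real u \<le> zeta i x \<and> zeta i x < t - real u + 1} *
           measure M {x \<in> space M. t + real v \<le> zeta i x \<and> zeta i x < t + real v + 1}
           \<le> measure M {x \<in> space M. t \<le> zeta i x \<and> zeta i x < t + 1} *
              measure M {x \<in> space M. t + real v - real u \<le> zeta i x \<and> zeta i x < t + real v - real u + 1}"
      unfolding sl using w by (simp add: meas divide_right_mono)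
  qed
  also have "(\<integral>x. logistic (zeta i x) * (zeta i x - a) * (logistic (zeta i x) - logistic a) \<partial>M)
     = (\<integral>x. V x * (logistic (zeta i x) * (zeta i x - a) * (logistic (zeta i x) - logistic a)) \<partial>P) / w"
    by (rule int) measurable
  also have "(\<lambda>x. V x * (logistic (zeta i x) * (zeta i x - a) * (logistic (zeta i x) - logistic a)))
     = (\<lambda>x. W R x * ((zeta i x - a) * (logistic (zeta i x) - logistic a)))"
    by (simp add: WR[symmetric] mult.assoc)
  finally show ?thesis using w unfolding w_def by simp
qed

text \<open>Predictive probabilities are compared with plug-in probabilities at the posterior mean.
  Dilation about the posterior mean bounds the sum of the dispersions and yields
  \<open>gap_const / del\<close>; dilation about \<open>x0\<close> shows that the plug-in
  log-likelihood falls short of that of \<open>x0\<close> by at most \<open>card I\<close>, and half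
  of this is the summand \<open>1/2\<close>.\<close>

proposition leave_one_out_gain:
  assumes R: "finite R" and x0: "x0 \<in> space P" and del: "0 < del" "\<And>i. i \<in> R \<Longrightarrow> del \<le> p i"
  shows "(1/2) * (\<Sum>i\<in>R. ln (logistic (zeta i x0) / p i)) - (1/2 + gap_const / del) * real (card I)
     \<le> (\<Sum>i\<in>R. ln ((1 + Z R / Z (R - {i}) / p i) / 2))"
proof -
  define w where "w = Z R"
  have w: "w > 0" unfolding w_def by (rule Z_pos)
  define xb where "xb = (\<lambda>k\<in>I. (\<integral>x. W R x * x k \<partial>P) / w)"
  define a where "a i = zeta i xb" for i
  have xk: "\<bar>x k\<bar> \<le> b" if "x \<in> space P" "k \<in> I" for x k
    using that by (auto simp: space_box_measure PiE_def Pi_def abs_le_iff minus_le_iff)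
  have ixk: "integrable P (\<lambda>x. W R x * x k)" if "k \<in> I" for k
    using that xk by (intro W_integrable_mult[of _ b]) auto
  have xbs: "xb \<in> space P"
    unfolding space_box_measure xb_def
  proof (rule PiE_I)
    fix k assume k: "k \<in> I"
    have "\<bar>\<integral>x. W R x * x k \<partial>P\<bar> \<le> (\<integral>x. \<bar>W R x * x k\<bar> \<partial>P)"
      by (rule integral_abs_bound)
    also have "\<dots> \<le> (\<integral>x. W R x * b \<partial>P)"
      using W_integrable[of R] W_pos[of R] xk[OF _ k]
      by (intro integral_mono Bochner_Integration.integrable_abs[OF ixk[OF k]])
         (auto simp: abs_mult less_imp_le abs_of_pos intro!: mult_left_mono)
    also have "\<dots> = w * b" by (simp add: w_def Z_def)
    finally show "(\<lambda>k\<in>I. (\<integral>x. W R x * x k \<partial>P) / w) k \<in> {-b..b}"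
      using w k by (auto simp: abs_le_iff field_simps)
  qed auto
  have iz: "integrable P (\<lambda>x. W R x * zeta i x)" for i
    by (rule W_integrable_mult[OF _ zeta_bound]) auto
  have am: "(\<integral>x. W R x * zeta i x \<partial>P) = w * a i" for i
  proof -
    have "(\<integral>x. W R x * zeta i x \<partial>P) = (\<integral>x. (\<Sum>k\<in>I. c i k * (W R x * x k)) \<partial>P)"
      by (intro Bochner_Integration.integral_cong) (auto simp: zeta_def sum_distrib_left mult_ac)
    also have "\<dots> = (\<Sum>k\<in>I. c i k * (\<integral>x. W R x * x k \<partial>P))"
      using ixk by (subst Bochner_Integration.integral_sum) auto
    also have "\<dots> = (\<Sum>k\<in>I. w * (c i k * xb k))"
      using w by (intro sum.cong) (auto simp: xb_def)
    also have "\<dots> = w * a i" by (simp add: a_def zeta_def sum_distrib_left)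
    finally show ?thesis .
  qed
  have mean: "(\<integral>x. W R x * (zeta i x - a i) \<partial>P) = 0" for i
  proof -
    have "(\<integral>x. W R x * (zeta i x - a i) \<partial>P) = (\<integral>x. W R x * zeta i x - W R x * a i \<partial>P)"
      by (simp add: right_diff_distrib)
    also have "\<dots> = w * a i - w * a i"
      using iz W_integrable[of R] by (subst Bochner_Integration.integral_diff) (auto simp: am Z_def[symmetric] w_def)
    finally show ?thesis by simp
  qed
  define beta where "beta i = (\<integral>x. W R x * ((zeta i x - a i) * (logistic (zeta i x) - logistic (a i))) \<partial>P) / w" for i
  have beta0: "beta i \<ge> 0" for i
  proof -
    have "0 \<le> W R x * ((zeta i x - a i) * (logistic (zeta i x) - logistic (a i)))" for x
    proof -
      have "0 \<le> (zeta i x - a i) * (logistic (zeta i x) - logistic (a i))"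
        using logistic_mono[of "a i" "zeta i x"] logistic_mono[of "zeta i x" "a i"]
        by (cases "zeta i x \<ge> a i") (auto intro: mult_nonneg_nonneg mult_nonpos_nonpos)
      thus ?thesis using W_pos[of R x] by simp
    qed
    thus ?thesis unfolding beta_def using w by (intro divide_nonneg_pos Bochner_Integration.integral_nonneg) auto
  qed
  have tb: "\<bar>(y - zeta i x) * (1 - logistic (zeta i x))\<bar> \<le> \<bar>y\<bar> + zbound i" if "x \<in> space P" for i x y
  proof -
    have "\<bar>y - zeta i x\<bar> * \<bar>1 - logistic (zeta i x)\<bar> \<le> (\<bar>y\<bar> + zbound i) * 1"
      using zeta_bound[OF that, of i] logistic_pos[of "zeta i x"] logistic_less_1[of "zeta i x"] by (intro mult_mono) auto
    thus ?thesis by (simp add: abs_mult)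
  qed
  have it: "integrable P (\<lambda>x. W R x * ((y - zeta i x) * (1 - logistic (zeta i x))))" for i y
    by (rule W_integrable_mult[OF _ tb]) auto
  have im: "integrable P (\<lambda>x. W R x * (zeta i x - a i))" for i
    using iz W_integrable[of R] by (simp add: right_diff_distrib)
  have betaS: "(\<Sum>i\<in>R. beta i) \<le> real (card I)"
  proof -
    have "w * beta i = (\<integral>x. W R x * ((zeta i xb - zeta i x) * (1 - logistic (zeta i x))) \<partial>P)" for i
    proof -
      \<comment> \<open>Replacing \<open>logistic (a i)\<close> by 1 changes the integrand by a
        multiple of \<open>zeta i x - a i\<close>, whose posterior mean is zero.\<close>
      have "w * beta i = (\<integral>x. W R x * ((a i - zeta i x) * (1 - logistic (zeta i x))) + (1 - logistic (a i)) * (W R x * (zeta i x - a i)) \<partial>P)"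
        unfolding beta_def using w by (simp, intro Bochner_Integration.integral_cong) (auto simp: algebra_simps)
      also have "\<dots> = (\<integral>x. W R x * ((a i - zeta i x) * (1 - logistic (zeta i x))) \<partial>P)"
        using it[of "a i" i] im[of i] by (subst Bochner_Integration.integral_add) (auto simp: mean)
      finally show ?thesis by (simp add: a_def)
    qed
    hence "w * (\<Sum>i\<in>R. beta i) = (\<Sum>i\<in>R. \<integral>x. W R x * ((zeta i xb - zeta i x) * (1 - logistic (zeta i x))) \<partial>P)"
      by (simp add: sum_distrib_left)
    also have "\<dots> \<le> real (card I) * w" unfolding w_def by (rule dilation_inequality[OF R xbs])
    finally show ?thesis using w by (simp add: mult.commute)
  qed
  have gain: "(\<Sum>i\<in>R. ln (logistic (zeta i x0))) \<le> (\<Sum>i\<in>R. ln (logistic (a i))) + real (card I)"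
  proof -
    \<comment> \<open>The value at \<open>x0\<close> is bounded by the tangent at
      \<open>zeta i x\<close>, and the value there by the tangent at \<open>a i\<close>. After
      integration the linear term of the second tangent vanishes and that of the first is a dilation
      integral.\<close>
    have "w * ln (logistic (zeta i x0)) \<le> w * ln (logistic (a i))
        + (\<integral>x. W R x * ((zeta i x0 - zeta i x) * (1 - logistic (zeta i x))) \<partial>P)" for i
    proof -
      have "w * ln (logistic (zeta i x0)) = (\<integral>x. W R x * ln (logistic (zeta i x0)) \<partial>P)"
        using W_integrable[of R] by (simp add: w_def Z_def)
      also have "\<dots> \<le> (\<integral>x. (W R x * ln (logistic (a i)) + (1 - logistic (a i)) * (W R x * (zeta i x - a i)))
            + W R x * ((zeta i x0 - zeta i x) * (1 - logistic (zeta i x))) \<partial>P)"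
      proof (rule integral_mono)
        fix x
        have "ln (logistic (zeta i x0)) \<le> (ln (logistic (a i)) + (1 - logistic (a i)) * (zeta i x - a i))
           + (zeta i x0 - zeta i x) * (1 - logistic (zeta i x))"
          using ln_logistic_tangent[of "zeta i x0" "zeta i x"] ln_logistic_tangent[of "zeta i x" "a i"]
          by (simp add: algebra_simps)
        hence "W R x * ln (logistic (zeta i x0)) \<le> W R x * ((ln (logistic (a i)) + (1 - logistic (a i)) * (zeta i x - a i))
           + (zeta i x0 - zeta i x) * (1 - logistic (zeta i x)))"
          using W_pos[of R x] by (intro mult_left_mono) auto
        thus "W R x * ln (logistic (zeta i x0)) \<le> (W R x * ln (logistic (a i)) + (1 - logistic (a i)) * (W R x * (zeta i x - a i)))
            + W R x * ((zeta i x0 - zeta i x) * (1 - logistic (zeta i x)))"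
          by (simp add: algebra_simps)
      qed (use W_integrable[of R] it[of "zeta i x0" i] im[of i] in auto)
      also have "\<dots> = w * ln (logistic (a i)) + (\<integral>x. W R x * ((zeta i x0 - zeta i x) * (1 - logistic (zeta i x))) \<partial>P)"
        using W_integrable[of R] it[of "zeta i x0" i] im[of i] by (simp add: mean w_def Z_def)
      finally show ?thesis .
    qed
    hence "(\<Sum>i\<in>R. w * ln (logistic (zeta i x0))) \<le> (\<Sum>i\<in>R. w * ln (logistic (a i))
        + (\<integral>x. W R x * ((zeta i x0 - zeta i x) * (1 - logistic (zeta i x))) \<partial>P))" by (intro sum_mono)
    also have "\<dots> \<le> w * (\<Sum>i\<in>R. ln (logistic (a i))) + real (card I) * w"
      using dilation_inequality[OF R x0] by (simp add: sum.distrib sum_distrib_left w_def)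
    finally have "w * (\<Sum>i\<in>R. ln (logistic (zeta i x0))) \<le> w * ((\<Sum>i\<in>R. ln (logistic (a i))) + real (card I))"
      by (simp add: sum_distrib_left distrib_left mult.commute)
    thus ?thesis using w by simp
  qed
  have gc: "gap_const > 0" unfolding gap_const_def by (intro add_pos_pos) auto
  have each: "(1/2) * (ln (logistic (a i)) - ln (p i)) - gap_const / del * beta i \<le> ln ((1 + Z R / Z (R - {i}) / p i) / 2)"
    if i: "i \<in> R" for i
  proof -
    define Q where "Q = Z R / Z (R - {i})"
    define s where "s = logistic (a i)"
    have Q: "Q > 0" unfolding Q_def using Z_pos by simp
    have s: "s > 0" unfolding s_def by (rule logistic_pos)
    have p: "p i \<ge> del" "p i > 0" using del(2)[OF i] del(1) by auto
    have D: "s - Q \<le> gap_const * beta i"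
      using predictive_probability_gap[OF R i mean] unfolding s_def Q_def beta_def w_def .
    have "ln ((p i + s) / (p i + Q)) \<le> (p i + s) / (p i + Q) - 1"
      using p s Q by (intro ln_le_minus_one) auto
    also have "\<dots> = (s - Q) / (p i + Q)" using p Q by (simp add: field_simps)
    also have "\<dots> \<le> gap_const * beta i / (p i + Q)" using D p Q by (intro divide_right_mono) auto
    also have "\<dots> \<le> gap_const * beta i / del" using p Q del(1) gc beta0[of i]
      by (intro divide_left_mono mult_nonneg_nonneg) auto
    finally have 1: "ln (p i + s) - ln (p i + Q) \<le> gap_const / del * beta i"
      using p s Q by (simp add: ln_div)
    \<comment> \<open>This arithmetic-geometric mean inequality is the source of the factor 1/2 in
      front of the log-likelihood ratio.\<close>
    have "(p i * s) * 4 \<le> (p i + s)\<^sup>2"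
      using zero_le_power2[of "p i - s"] by (simp add: power2_eq_square algebra_simps)
    hence "ln (p i * s * 4) \<le> ln ((p i + s)\<^sup>2)" using p s by simp
    hence "ln (p i) + ln s + ln 4 \<le> 2 * ln (p i + s)" using p s by (simp add: ln_mult ln_realpow)
    moreover have "ln 4 = 2 * ln (2::real)" using ln_realpow[of 2 2] by simp
    ultimately have "(ln (p i) + ln s) + 2 * ln 2 \<le> 2 * ln (p i + s)" by simp
    hence 2: "ln (p i + s) \<ge> (1/2) * (ln (p i) + ln s) + ln 2" by (simp add: field_simps)
    have "(1 + Q / p i) / 2 = (p i + Q) / (p i * 2)" using p by (simp add: field_simps)
    hence "ln ((1 + Q / p i) / 2) = ln ((p i + Q) / (p i * 2))" by (simp only:)
    also have "\<dots> = ln (p i + Q) - ln (p i * 2)" using p Q by (subst ln_div) auto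
    also have "ln (p i * 2) = ln (p i) + ln 2" using p by (subst ln_mult) auto
    finally have "ln ((1 + Q / p i) / 2) = ln (p i + Q) - ln (p i) - ln 2" by simp
    moreover define T where "T = gap_const / del * beta i"
    ultimately show ?thesis using 1 2 unfolding Q_def[symmetric] s_def[symmetric] T_def[symmetric]
      by (simp add: field_simps)
  qed
  have lnp: "ln (logistic (zeta i x0) / p i) = ln (logistic (zeta i x0)) - ln (p i)" if "i \<in> R" for i
    using del(1) del(2)[OF that] logistic_pos by (intro ln_divide_pos) auto
  have "(1/2) * (\<Sum>i\<in>R. ln (logistic (zeta i x0) / p i)) = (1/2) * ((\<Sum>i\<in>R. ln (logistic (zeta i x0))) - (\<Sum>i\<in>R. ln (p i)))"
    by (simp add: lnp sum_subtractf)
  also have "\<dots> \<le> (1/2) * ((\<Sum>i\<in>R. ln (logistic (a i))) + real (card I) - (\<Sum>i\<in>R. ln (p i)))"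
    using gain by simp
  also have "\<dots> = (\<Sum>i\<in>R. (1/2) * (ln (logistic (a i)) - ln (p i)) - gap_const / del * beta i) + gap_const / del * (\<Sum>i\<in>R. beta i) + real (card I) / 2"
    unfolding sum_subtractf sum_distrib_left[symmetric] by (simp add: algebra_simps)
  also have "\<dots> \<le> (\<Sum>i\<in>R. ln ((1 + Z R / Z (R - {i}) / p i) / 2)) + gap_const / del * real (card I) + real (card I) / 2"
    using betaS gc del(1) by (intro add_mono sum_mono each mult_left_mono) auto
  finally show ?thesis by (simp add: algebra_simps)
qed

end

section \<open>Bernoulli expectations and sequential prediction\<close>

definition bern_weight :: "(nat \<Rightarrow> real) \<Rightarrow> (nat \<Rightarrow> real) \<Rightarrow> nat \<Rightarrow> real" where
  "bern_weight pr y i = (if y i = 1 then pr i else 1 - pr i)"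

definition bern_expect :: "nat \<Rightarrow> (nat \<Rightarrow> real) \<Rightarrow> ((nat \<Rightarrow> real) \<Rightarrow> real) \<Rightarrow> real" where
  "bern_expect n pr g = (\<Sum>y\<in>resp_space n. (\<Prod>i<n. bern_weight pr y i) * g y)"

lemma finite_resp_space: "finite (resp_space n)"
  unfolding resp_space_def by (intro finite_PiE) auto

lemma sum_resp_space_split:
  fixes h :: "(nat \<Rightarrow> real) \<Rightarrow> real"
  assumes "i < n"
  shows "(\<Sum>y\<in>resp_space n. h y) = (\<Sum>g\<in>PiE ({..<n} - {i}) (\<lambda>_. {0, 1}). h (g(i := 1)) + h (g(i := 0)))"
proof -
  define A where "A = PiE ({..<n} - {i}) (\<lambda>_. {0, 1::real})"
  have ins: "{..<n} = insert i ({..<n} - {i})" using assms by auto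
  have "resp_space n = (\<lambda>(b, g). g(i := b)) ` ({0, 1} \<times> A)"
    unfolding resp_space_def A_def by (subst ins, subst PiE_insert_eq) simp
  moreover have "inj_on (\<lambda>(b, g). g(i := b)) ({0, 1} \<times> A)"
    unfolding A_def using inj_combinator[of i "{..<n} - {i}" "\<lambda>_. {0, 1::real}"] by simp
  ultimately have "(\<Sum>y\<in>resp_space n. h y) = (\<Sum>(b, g)\<in>{0, 1} \<times> A. h (g(i := b)))"
    by (simp add: sum.reindex case_prod_unfold)
  also have "\<dots> = (\<Sum>b\<in>{0, 1}. \<Sum>g\<in>A. h (g(i := b)))"
    by (rule sum.cartesian_product[symmetric])
  also have "\<dots> = (\<Sum>g\<in>A. h (g(i := 1)) + h (g(i := 0)))" by (simp add: sum.distrib add.commute)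
  finally show ?thesis unfolding A_def .
qed

text \<open>Averaging over \<open>Y i\<close> with all other responses held fixed; stands in for
  conditional expectations in the martingale argument.\<close>

lemma bern_expect_resample:
  assumes "i < n"
  shows "bern_expect n pr g = bern_expect n pr (\<lambda>y. pr i * g (y(i := 1)) + (1 - pr i) * g (y(i := 0)))"
proof -
  define w where "w y = (\<Prod>j\<in>{..<n} - {i}. bern_weight pr y j)" for y
  have w: "(\<Prod>j<n. bern_weight pr (y(i := b)) j) = bern_weight pr (y(i := b)) i * w y" for y b
  proof -
    have "(\<Prod>j<n. bern_weight pr (y(i := b)) j) = bern_weight pr (y(i := b)) i * (\<Prod>j\<in>{..<n} - {i}. bern_weight pr (y(i := b)) j)"
      using assms by (intro prod.remove) auto
    also have "(\<Prod>j\<in>{..<n} - {i}. bern_weight pr (y(i := b)) j) = w y"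
      unfolding w_def by (intro prod.cong) (auto simp: bern_weight_def)
    finally show ?thesis .
  qed
  show ?thesis
    unfolding bern_expect_def sum_resp_space_split[OF assms] w
    by (intro sum.cong) (auto simp: bern_weight_def algebra_simps)
qed

lemma bern_expect_cong:
  "(\<And>y. y \<in> resp_space n \<Longrightarrow> g y = h y) \<Longrightarrow> bern_expect n pr g = bern_expect n pr h"
  unfolding bern_expect_def by (intro sum.cong) auto

lemma bern_expect_sum: "bern_expect n pr (\<lambda>y. \<Sum>i\<in>A. g i y) = (\<Sum>i\<in>A. bern_expect n pr (g i))"
  unfolding bern_expect_def sum_distrib_left by (rule sum.swap)

lemma bern_expect_cmult: "bern_expect n pr (\<lambda>y. k * g y) = k * bern_expect n pr g"
  unfolding bern_expect_def by (simp add: sum_distrib_left mult_ac)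

lemma bern_expect_add: "bern_expect n pr (\<lambda>y. g y + h y) = bern_expect n pr g + bern_expect n pr h"
  unfolding bern_expect_def by (simp add: sum.distrib distrib_left)

lemma bern_expect_mono:
  assumes "\<And>i. i < n \<Longrightarrow> 0 \<le> pr i \<and> pr i \<le> 1" "\<And>y. y \<in> resp_space n \<Longrightarrow> g y \<le> h y"
  shows "bern_expect n pr g \<le> bern_expect n pr h"
  unfolding bern_expect_def
  using assms by (intro sum_mono mult_left_mono prod_nonneg) (auto simp: bern_weight_def)

lemma bern_expect_1: "bern_expect n pr (\<lambda>_. 1) = 1"
proof (induction n)
  case 0
  show ?case by (simp add: bern_expect_def resp_space_def)
next
  case (Suc n)
  have A: "{..<Suc n} - {n} = {..<n}" by auto
  have "bern_expect (Suc n) pr (\<lambda>_. 1) = (\<Sum>g\<in>resp_space n. (\<Prod>i<n. bern_weight pr (g(n := 1)) i) * pr n + (\<Prod>i<n. bern_weight pr (g(n := 0)) i) * (1 - pr n))"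
    unfolding bern_expect_def by (subst sum_resp_space_split[of n]) (auto simp: A resp_space_def[of n] bern_weight_def)
  also have "\<dots> = (\<Sum>g\<in>resp_space n. (\<Prod>i<n. bern_weight pr g i) * 1)"
  proof (rule sum.cong)
    fix g
    have "(\<Prod>i<n. bern_weight pr (g(n := b)) i) = (\<Prod>i<n. bern_weight pr g i)" for b
      by (intro prod.cong) (auto simp: bern_weight_def)
    thus "(\<Prod>i<n. bern_weight pr (g(n := 1)) i) * pr n + (\<Prod>i<n. bern_weight pr (g(n := 0)) i) * (1 - pr n) = (\<Prod>i<n. bern_weight pr g i) * 1"
      by (simp add: algebra_simps)
  qed simp
  also have "\<dots> = 1" using Suc unfolding bern_expect_def .
  finally show ?case .
qed

text \<open>Jensen's inequality, from the tangent of the exponential at the mean.\<close>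

lemma exp_average_le:
  assumes "finite R" "R \<noteq> {}"
  shows "exp ((\<Sum>i\<in>R. a i) / real (card R)) \<le> (\<Sum>i\<in>R. exp (a i :: real)) / real (card R)"
proof -
  define m where "m = (\<Sum>i\<in>R. a i) / real (card R)"
  have r: "real (card R) > 0" using assms by (simp add: card_gt_0_iff)
  have "real (card R) * exp m = (\<Sum>i\<in>R. exp m * (1 + (a i - m)))"
    using r by (simp add: sum.distrib sum_subtractf m_def flip: sum_distrib_left)
  also have "\<dots> \<le> (\<Sum>i\<in>R. exp m * exp (a i - m))"
    by (intro sum_mono mult_left_mono) (auto simp: exp_ge_add_one_self)
  also have "\<dots> = (\<Sum>i\<in>R. exp (a i))" by (simp flip: exp_add)
  finally show ?thesis using r unfolding m_def[symmetric] by (simp add: field_simps)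
qed

section \<open>Sequential prediction along a random order\<close>

locale logistic_design =
  fixes n :: nat and pr :: "nat \<Rightarrow> real" and del :: real
    and I :: "nat set" and b :: real and v :: "nat \<Rightarrow> nat \<Rightarrow> real"
  assumes finI: "finite I" and b_pos: "b > 0" and del_pos: "del > 0"
    and pr: "\<And>i. i < n \<Longrightarrow> del \<le> pr i \<and> pr i \<le> 1 - del"
begin

text \<open>Because \<open>1 - logistic t = logistic (- t)\<close>, flipping the sign of the
  covariates encodes label 0. Every value other than 1 counts as label 0, in agreement with
  \<open>bern_weight\<close>.\<close>

definition signed :: "(nat \<Rightarrow> real) \<Rightarrow> nat \<Rightarrow> nat \<Rightarrow> real" where
  "signed y i k = (if y i = 1 then v i k else - v i k)"

sublocale lf: linear_forms_on_box I b "signed y" for y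
  by unfold_locales (use finI b_pos in auto)

definition mass :: "(nat \<Rightarrow> real) \<Rightarrow> nat set \<Rightarrow> real" where
  "mass y R = lf.Z y R"

definition pred_ratio :: "(nat \<Rightarrow> real) \<Rightarrow> nat set \<Rightarrow> nat \<Rightarrow> real" where
  "pred_ratio y R i = (1 + mass y R / mass y (R - {i}) / bern_weight pr y i) / 2"

definition loglik :: "(nat \<Rightarrow> real) \<Rightarrow> nat set \<Rightarrow> (nat \<Rightarrow> real) \<Rightarrow> real" where
  "loglik y R x = (\<Sum>i\<in>R. ln (logistic (lf.zeta y i x) / bern_weight pr y i))"

lemma mass_pos: "mass y R > 0"
  unfolding mass_def by (rule lf.Z_pos)

lemma weight_ge: "i < n \<Longrightarrow> bern_weight pr y i \<ge> del"
  using pr[of i] by (auto simp: bern_weight_def)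

lemma pred_ratio_pos: "i < n \<Longrightarrow> pred_ratio y R i > 0"
  unfolding pred_ratio_def using mass_pos weight_ge[of i y] del_pos
  by (intro divide_pos_pos add_pos_pos) auto

lemma mass_cong:
  assumes "\<And>i. i \<in> R \<Longrightarrow> y i = y' i"
  shows "mass y R = mass y' R"
proof -
  have "lf.W y R = lf.W y' R"
    unfolding lf.W_def[abs_def] lf.zeta_def using assms by (intro ext prod.cong) (auto simp: signed_def)
  thus ?thesis unfolding mass_def lf.Z_def by (simp only:)
qed

text \<open>Under the integral, \<open>logistic t + logistic (- t) = 1\<close>. Hence the predictive
  probabilities of the two labels sum to 1, which gives \<open>pred_ratio\<close> its conditional
  mean 1.\<close>

lemma mass_split:
  assumes R: "finite R" and i: "i \<in> R"
  shows "mass (y(i := 1)) R + mass (y(i := 0)) R = mass y (R - {i})"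
proof -
  have z: "lf.zeta (y(i := 0)) i x = - lf.zeta (y(i := 1)) i x" for x
    unfolding lf.zeta_def by (simp add: signed_def sum_negf)
  have r: "lf.W (y(i := t)) (R - {i}) x = lf.W y (R - {i}) x" for t x
    unfolding lf.W_def lf.zeta_def by (intro prod.cong) (auto simp: signed_def)
  have "mass (y(i := 1)) R + mass (y(i := 0)) R = (\<integral>x. lf.W (y(i := 1)) R x + lf.W (y(i := 0)) R x \<partial>box_measure b I)"
    unfolding mass_def lf.Z_def by (rule Bochner_Integration.integral_add[symmetric]) (rule lf.W_integrable)+
  also have "(\<lambda>x. lf.W (y(i := 1)) R x + lf.W (y(i := 0)) R x) = lf.W y (R - {i})"
    by (simp add: fun_eq_iff lf.W_remove[OF R i] r z logistic_minus algebra_simps)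
  finally show ?thesis unfolding mass_def lf.Z_def .
qed

text \<open>\<open>online k R y\<close> averages, over all ways of removing \<open>k\<close> observations from \<open>R\<close> one at a time, the
  product of the predictive ratios of the removed observations.\<close>

primrec online :: "nat \<Rightarrow> nat set \<Rightarrow> (nat \<Rightarrow> real) \<Rightarrow> real" where
  "online 0 R y = 1"
| "online (Suc k) R y = (\<Sum>i\<in>R. online k (R - {i}) y * pred_ratio y R i) / real (card R)"

lemma online_cong: "(\<And>i. i \<in> R \<Longrightarrow> y i = y' i) \<Longrightarrow> online k R y = online k R y'"
proof (induction k arbitrary: R)
  case (Suc k)
  have "online k (R - {i}) y * pred_ratio y R i = online k (R - {i}) y' * pred_ratio y' R i" if "i \<in> R" for i
  proof -
    have "online k (R - {i}) y = online k (R - {i}) y'" using Suc.prems by (intro Suc.IH) auto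
    moreover have "mass y R = mass y' R" "mass y (R - {i}) = mass y' (R - {i})"
      using Suc.prems by (auto intro!: mass_cong)
    ultimately show ?thesis using Suc.prems[OF that] by (simp add: pred_ratio_def bern_weight_def)
  qed
  thus ?case by simp
qed simp

text \<open>The factor for \<open>R - {i}\<close> ignores \<open>Y i\<close>, so resampling
  \<open>Y i\<close> averages \<open>pred_ratio\<close> alone, to 1. The removed index has equal
  weights whatever the outcome, so the mean over removal orders keeps expectation 1.\<close>

lemma bern_expect_online:
  assumes "R \<subseteq> {..<n}" "k \<le> card R"
  shows "bern_expect n pr (online k R) = 1"
  using assms
proof (induction k arbitrary: R)
  case 0
  show ?case by (simp add: bern_expect_1)
next
  case (Suc k)
  have fR: "finite R" using Suc.prems finite_subset by blast
  have r: "real (card R) > 0" using Suc.prems by simp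
  have "bern_expect n pr (\<lambda>y. online k (R - {i}) y * pred_ratio y R i) = 1" if i: "i \<in> R" for i
  proof -
    have "i < n" using i Suc.prems by auto
    have p: "pr i > 0" "1 - pr i > 0" using pr[OF \<open>i < n\<close>] del_pos by auto
    have "bern_expect n pr (\<lambda>y. online k (R - {i}) y * pred_ratio y R i) = bern_expect n pr (online k (R - {i}))"
    proof (subst bern_expect_resample[OF \<open>i < n\<close>], rule bern_expect_cong)
      fix y
      have o: "online k (R - {i}) (y(i := t)) = online k (R - {i}) y" for t by (rule online_cong) auto
      have m: "mass (y(i := t)) (R - {i}) = mass y (R - {i})" for t by (rule mass_cong) auto
      have "pr i * pred_ratio (y(i := 1)) R i + (1 - pr i) * pred_ratio (y(i := 0)) R i
         = (pr i + (1 - pr i)) / 2 + (mass (y(i := 1)) R + mass (y(i := 0)) R) / mass y (R - {i}) / 2"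
      proof -
        have half: "t * ((1 + u / t) / 2) = t / 2 + u / 2" if "t > 0" for t u :: real using that by (simp add: field_simps)
        have "bern_weight pr (y(i := 1)) i = pr i" "bern_weight pr (y(i := 0)) i = 1 - pr i"
          by (auto simp: bern_weight_def)
        thus ?thesis unfolding pred_ratio_def m by (simp only: half[OF p(1)] half[OF p(2)]) (simp add: add_divide_distrib diff_divide_distrib)
      qed
      also have "\<dots> = 1" unfolding mass_split[OF fR i] using mass_pos[of y "R - {i}"] by simp
      finally have *: "pr i * pred_ratio (y(i := 1)) R i + (1 - pr i) * pred_ratio (y(i := 0)) R i = 1" .
      show "pr i * (online k (R - {i}) (y(i := 1)) * pred_ratio (y(i := 1)) R i) +
         (1 - pr i) * (online k (R - {i}) (y(i := 0)) * pred_ratio (y(i := 0)) R i) = online k (R - {i}) y"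
        unfolding o using arg_cong[OF *, of "\<lambda>t. online k (R - {i}) y * t"] by (simp add: algebra_simps)
    qed
    also have "\<dots> = 1" using Suc.prems i fR by (intro Suc.IH) auto
    finally show ?thesis .
  qed
  hence "bern_expect n pr (\<lambda>y. (1 / real (card R)) * (\<Sum>i\<in>R. online k (R - {i}) y * pred_ratio y R i)) = 1"
    unfolding bern_expect_cmult bern_expect_sum using r by simp
  thus ?case by simp
qed

definition gain_const :: real where "gain_const = 1/2 + gap_const / del"

text \<open>Jensen carries the average over the removed index into the exponent. There, removal from
  a set of size \<open>r\<close> contributes \<open>1 / r\<close> times the bound of
  \<open>leave_one_out_gain\<close>, whose cost is at most
  \<open>gain_const * real (card I) / real (k0 + 1)\<close> as \<open>r \<ge> k0 + 1\<close>.
  Together with the shares from the smaller sets, the fraction \<open>k / (k0 + k)\<close> of the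
  log-likelihood ratio is collected.\<close>

lemma online_lower_bound:
  assumes "R \<subseteq> {..<n}" "card R = k0 + k" "x \<in> space (box_measure b I)"
  shows "exp (real k / real (k0 + k) * (1/2) * loglik y R x - gain_const * real (card I) * (real k / real (k0 + 1))) \<le> online k R y"
  using assms(1,2)
proof (induction k arbitrary: R)
  case 0
  show ?case by simp
next
  case (Suc k)
  have fR: "finite R" using Suc.prems finite_subset by blast
  have ne: "R \<noteq> {}" using Suc.prems by auto
  define r where "r = real (card R)"
  have r: "r = real (k0 + k) + 1" unfolding r_def using Suc.prems by simp
  define L where "L = loglik y R x"
  define K where "K = gain_const * real (card I)"
  define l where "l i = ln (logistic (lf.zeta y i x) / bern_weight pr y i)" for i
  have Ll: "L = (\<Sum>i\<in>R. l i)" unfolding L_def loglik_def l_def ..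
  define A where "A i = real k / real (k0 + k) * (1/2) * (L - l i) - K * (real k / real (k0 + 1))" for i
  have IH: "exp (A i) \<le> online k (R - {i}) y" if i: "i \<in> R" for i
  proof -
    have "loglik y (R - {i}) x = L - l i"
      unfolding Ll loglik_def l_def[symmetric] using fR i by (simp add: sum_diff1)
    moreover have "R - {i} \<subseteq> {..<n}" "card (R - {i}) = k0 + k" using Suc.prems i fR by auto
    ultimately show ?thesis using Suc.IH[of "R - {i}"] unfolding A_def K_def by simp
  qed
  have gain: "(1/2) * L - K \<le> (\<Sum>i\<in>R. ln (pred_ratio y R i))"
    unfolding L_def loglik_def K_def gain_const_def pred_ratio_def mass_def
    using Suc.prems weight_ge del_pos by (intro lf.leave_one_out_gain fR assms(3)) auto
  have "real (Suc k) / real (k0 + Suc k) * (1/2) * L - K * (real (Suc k) / real (k0 + 1))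
     \<le> (real k * (1/2) * L + ((1/2) * L - K)) / r - K * (real k / real (k0 + 1))"
  proof -
    have K0: "K \<ge> 0" unfolding K_def gain_const_def gap_const_def using del_pos by (intro mult_nonneg_nonneg add_nonneg_nonneg) auto
    have e: "real (k0 + Suc k) = r" using r by simp
    have "K / r \<le> K / real (k0 + 1)" using K0 unfolding r by (intro divide_left_mono) auto
    thus ?thesis unfolding e by (simp add: add_divide_distrib diff_divide_distrib distrib_left distrib_right)
  qed
  also have "\<dots> \<le> (\<Sum>i\<in>R. A i + ln (pred_ratio y R i)) / r"
  proof -
    \<comment> \<open>If \<open>k0 + k = 0\<close> then \<open>k = 0\<close>, and the convention for
      division by zero makes the left side 0 as well.\<close>
    have kk: "real k / real (k0 + k) * (r - 1) = real k" unfolding r by (cases "k0 + k = 0") auto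
    have "(\<Sum>i\<in>R. L - l i) = (r - 1) * L"
      by (simp add: sum_subtractf Ll[symmetric] r_def algebra_simps)
    hence "(\<Sum>i\<in>R. A i) = real k / real (k0 + k) * (1/2) * ((r - 1) * L) - r * (K * (real k / real (k0 + 1)))"
      unfolding A_def sum_subtractf[of "\<lambda>i. _ * (L - l i)"] sum_distrib_left[symmetric] by (simp add: r_def)
    also have "real k / real (k0 + k) * (1/2) * ((r - 1) * L) = (real k / real (k0 + k) * (r - 1)) * ((1/2) * L)" by simp
    also have "\<dots> = real k * ((1/2) * L)" unfolding kk ..
    finally have s: "(\<Sum>i\<in>R. A i) = real k * ((1/2) * L) - r * (K * (real k / real (k0 + 1)))" .
    have r0: "r > 0" unfolding r by simp
    have "((real k * (1/2) * L + ((1/2) * L - K)) / r - K * (real k / real (k0 + 1))) * r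
       = (\<Sum>i\<in>R. A i) + ((1/2) * L - K)" unfolding s using r0 by (simp add: left_diff_distrib)
    also have "\<dots> \<le> (\<Sum>i\<in>R. A i + ln (pred_ratio y R i))" using gain by (simp add: sum.distrib)
    finally show ?thesis using r0 by (simp add: pos_le_divide_eq)
  qed
  finally have "exp (real (Suc k) / real (k0 + Suc k) * (1/2) * L - K * (real (Suc k) / real (k0 + 1)))
     \<le> exp ((\<Sum>i\<in>R. A i + ln (pred_ratio y R i)) / real (card R))" unfolding r_def by simp
  also have "\<dots> \<le> (\<Sum>i\<in>R. exp (A i + ln (pred_ratio y R i))) / real (card R)"
    by (rule exp_average_le[OF fR ne])
  also have "\<dots> \<le> (\<Sum>i\<in>R. online k (R - {i}) y * pred_ratio y R i) / real (card R)"
  proof (intro divide_right_mono sum_mono)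
    fix i assume i: "i \<in> R"
    have pp: "pred_ratio y R i > 0" using i Suc.prems by (intro pred_ratio_pos) auto
    thus "exp (A i + ln (pred_ratio y R i)) \<le> online k (R - {i}) y * pred_ratio y R i"
      using IH[OF i] by (simp add: exp_add)
  qed simp
  finally show ?case unfolding L_def K_def by simp
qed

text \<open>The lower bound on \<open>online\<close> holds outcome by outcome, so the point
  \<open>x y\<close> may depend on the data; this takes the place of a supremum. Removing the larger
  half of the observations gives \<open>k / (k0 + 1) \<le> 1\<close> and leaves
  \<open>cn \<ge> 1/4\<close>.\<close>

proposition exponential_gain_bound:
  assumes n: "n \<ge> 1" and x: "\<And>y. y \<in> resp_space n \<Longrightarrow> x y \<in> space (box_measure b I)"
    and cn: "cn = real (n - n div 2) / real n / 2"
  shows "bern_expect n pr (\<lambda>y. exp (cn * loglik y {..<n} (x y))) \<le> exp (gain_const * real (card I))"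
proof -
  define k0 where "k0 = n div 2"
  define k where "k = n - k0"
  have kk: "k0 + k = n" unfolding k_def k0_def by simp
  have k1: "real k / real (k0 + 1) \<le> 1"
  proof -
    have "k \<le> k0 + 1" unfolding k_def k0_def by linarith
    thus ?thesis by simp
  qed
  have K0: "gain_const * real (card I) \<ge> 0"
    unfolding gain_const_def gap_const_def using del_pos by (intro mult_nonneg_nonneg add_nonneg_nonneg) auto
  have "bern_expect n pr (\<lambda>y. exp (- (gain_const * real (card I))) * exp (cn * loglik y {..<n} (x y))) \<le> bern_expect n pr (online k {..<n})"
  proof (rule bern_expect_mono)
    show "i < n \<Longrightarrow> 0 \<le> pr i \<and> pr i \<le> 1" for i using pr[of i] del_pos by auto
    fix y assume y: "y \<in> resp_space n"
    have "cn = real k / real (k0 + k) * (1/2)" unfolding cn kk by (simp add: k_def k0_def)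
    moreover have "gain_const * real (card I) * (real k / real (k0 + 1)) \<le> gain_const * real (card I) * 1"
      using k1 K0 by (intro mult_left_mono) auto
    ultimately have "exp (- (gain_const * real (card I)) + cn * loglik y {..<n} (x y))
       \<le> exp (real k / real (k0 + k) * (1/2) * loglik y {..<n} (x y) - gain_const * real (card I) * (real k / real (k0 + 1)))" by simp
    also have "\<dots> \<le> online k {..<n} y" by (rule online_lower_bound[OF _ _ x[OF y]]) (auto simp: kk)
    finally show "exp (- (gain_const * real (card I))) * exp (cn * loglik y {..<n} (x y)) \<le> online k {..<n} y"
      by (simp only: exp_add)
  qed
  also have "\<dots> = 1" by (rule bern_expect_online) (auto simp: k_def)
  finally have "exp (- (gain_const * real (card I))) * bern_expect n pr (\<lambda>y. exp (cn * loglik y {..<n} (x y))) \<le> 1"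
    unfolding bern_expect_cmult .
  thus ?thesis by (simp add: exp_minus field_simps)
qed

end

section \<open>Logistic regression\<close>

definition softplus :: "real \<Rightarrow> real" where "softplus t = ln (1 + exp t)"

text \<open>Bregman divergence of the log-partition function, that is, the Kullback-Leibler
  divergence of the Bernoulli law with log-odds \<open>t\<close> from the one with log-odds
  \<open>t0\<close>.\<close>

definition softplus_breg :: "real \<Rightarrow> real \<Rightarrow> real" where
  "softplus_breg t0 t = softplus t - softplus t0 - logistic t0 * (t - t0)"

lemma softplus_deriv: "(softplus has_real_derivative logistic t) (at t)"
  unfolding softplus_def[abs_def] logistic_def
  by (auto intro!: derivative_eq_intros simp: add_pos_pos field_simps)

lemma logistic_deriv: "(logistic has_real_derivative logistic t * (1 - logistic t)) (at t)"
proof -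
  have "1 + exp t \<noteq> 0" by (rule one_plus_exp_neq_0)
  thus ?thesis unfolding logistic_def[abs_def]
    by (auto intro!: derivative_eq_intros simp: field_simps power2_eq_square)
qed

lemma ln_logistic: "ln (logistic t) = t - softplus t"
  by (simp add: logistic_def softplus_def ln_divide_pos add_pos_pos)

lemma ln_one_minus_logistic: "ln (1 - logistic t) = - softplus t"
proof -
  have "1 - logistic t = inverse (1 + exp t)"
    using one_plus_exp_neq_0[of t] by (simp add: logistic_def field_simps)
  thus ?thesis by (simp add: softplus_def ln_inverse add_pos_pos)
qed

text \<open>The difference of the two sides factors as \<open>(S - s) * (S - (1 - s))\<close> with
  \<open>S = logistic B\<close> and \<open>s = logistic t\<close>. The lower bound, called
  \<open>w\<close> below, is the least curvature of the log-partition function on the range.\<close>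

lemma logistic_variance_lower:
  assumes "\<bar>t\<bar> \<le> B"
  shows "logistic B * (1 - logistic B) \<le> logistic t * (1 - logistic t)"
proof -
  have "logistic t \<le> logistic B" "1 - logistic t \<le> logistic B"
    using assms logistic_mono[of t B] logistic_mono[of "-t" B] by (auto simp: logistic_minus)
  hence "0 \<le> (logistic B - logistic t) * (logistic B - (1 - logistic t))" by (intro mult_nonneg_nonneg) auto
  thus ?thesis by (simp add: algebra_simps)
qed

lemma softplus_breg_lower:
  assumes t0: "\<bar>t0\<bar> \<le> B" and t: "\<bar>t\<bar> \<le> B" and w: "w = logistic B * (1 - logistic B)"
  shows "w / 2 * (t - t0)\<^sup>2 \<le> softplus_breg t0 t"
proof -
  have "(logistic t0 - w * t0) * (t - t0) \<le> (softplus t - w / 2 * t\<^sup>2) - (softplus t0 - w / 2 * t0\<^sup>2)"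
  proof (rule f''_imp_f'[where C = "{-B..B}" and f = "\<lambda>t. softplus t - w / 2 * t\<^sup>2" and f'' = "\<lambda>t. logistic t * (1 - logistic t) - w"])
    show "((\<lambda>t. softplus t - w / 2 * t\<^sup>2) has_real_derivative logistic t - w * t) (at t)" for t
      by (auto intro!: derivative_eq_intros softplus_deriv)
    show "((\<lambda>t. logistic t - w * t) has_real_derivative logistic t * (1 - logistic t) - w) (at t)" for t
      by (auto intro!: derivative_eq_intros logistic_deriv)
    show "t \<in> {-B..B} \<Longrightarrow> 0 \<le> logistic t * (1 - logistic t) - w" for t
      using logistic_variance_lower[of t B] unfolding w by auto
  qed (use t0 t in auto)
  thus ?thesis unfolding softplus_breg_def by (simp add: algebra_simps power2_eq_square)
qed

lemma softplus_breg_upper: "softplus_breg t0 t \<le> 1 / 2 * (t - t0)\<^sup>2"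
proof -
  have "(t0 - logistic t0) * (t - t0) \<le> (1 / 2 * t\<^sup>2 - softplus t) - (1 / 2 * t0\<^sup>2 - softplus t0)"
  proof (rule f''_imp_f'[where C = UNIV and f = "\<lambda>t. 1 / 2 * t\<^sup>2 - softplus t" and f'' = "\<lambda>t. 1 - logistic t * (1 - logistic t)"])
    show "((\<lambda>t. 1 / 2 * t\<^sup>2 - softplus t) has_real_derivative t - logistic t) (at t)" for t
      by (auto intro!: derivative_eq_intros softplus_deriv)
    show "((\<lambda>t. t - logistic t) has_real_derivative 1 - logistic t * (1 - logistic t)) (at t)" for t
      by (auto intro!: derivative_eq_intros logistic_deriv)
    show "0 \<le> 1 - logistic t * (1 - logistic t)" for t
      using mult_mono[of "logistic t" 1 "1 - logistic t" 1] logistic_pos[of t] logistic_less_1[of t] by auto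
  qed auto
  thus ?thesis unfolding softplus_breg_def by (simp add: algebra_simps power2_eq_square)
qed

text \<open>By an identity at the midpoint \<open>m\<close>, \<open>2 * softplus_breg t0 m\<close>
  falls short of \<open>softplus_breg t0 t\<close> by the two divergences of the endpoints from
  \<open>m\<close>. Curvature bounds these below by \<open>w / 4 * (t - t0)\<^sup>2\<close> in
  total, which is at least \<open>w / 2\<close> times \<open>softplus_breg t0 t\<close>. This
  fraction of the risk is what survives in the oracle inequality.\<close>

lemma softplus_breg_midpoint:
  assumes t0: "\<bar>t0\<bar> \<le> B" and t: "\<bar>t\<bar> \<le> B" and w: "w = logistic B * (1 - logistic B)"
  shows "2 * softplus_breg t0 ((t0 + t) / 2) \<le> (1 - w / 2) * softplus_breg t0 t"
proof -
  define m where "m = (t0 + t) / 2"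
  have m: "\<bar>m\<bar> \<le> B" using t0 t unfolding m_def by auto
  have w0: "w \<ge> 0" unfolding w using logistic_pos[of B] logistic_less_1[of B] by simp
  have "t0 - m = - ((t - t0) / 2)" "t - m = (t - t0) / 2" by (auto simp: m_def field_simps)
  hence sq: "(t0 - m)\<^sup>2 = (t - t0)\<^sup>2 / 4" "(t - m)\<^sup>2 = (t - t0)\<^sup>2 / 4" by (simp_all only: power2_minus power_divide) simp_all
  have a: "w / 2 * ((t - t0)\<^sup>2 / 4) \<le> softplus_breg m t0" "w / 2 * ((t - t0)\<^sup>2 / 4) \<le> softplus_breg m t"
    using softplus_breg_lower[OF m t0 w] softplus_breg_lower[OF m t w] unfolding sq by auto
  have "softplus_breg m t0 + softplus_breg m t + 2 * softplus_breg t0 m = softplus_breg t0 t"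
    unfolding softplus_breg_def m_def by (simp add: field_simps)
  hence "2 * softplus_breg t0 m \<le> softplus_breg t0 t - w / 2 * (1 / 2 * (t - t0)\<^sup>2)" using a by simp
  also have "\<dots> \<le> softplus_breg t0 t - w / 2 * softplus_breg t0 t"
    using softplus_breg_upper[of t0 t] w0 by (intro diff_left_mono mult_left_mono) auto
  finally show ?thesis unfolding m_def by (simp add: algebra_simps)
qed

section \<open>Kullback-Leibler divergence, empirical risk and noise\<close>

lemma expect_eq_bern_expect: "expect n x f0 g = bern_expect n (\<lambda>i. pif f0 (x i)) g"
  unfolding expect_def bern_expect_def bern_weight_def ..

lemma bern_expect_component: "i < n \<Longrightarrow> bern_expect n pr (\<lambda>y. y i) = pr i"
proof -
  assume i: "i < n"
  have "bern_expect n pr (\<lambda>y. y i) = bern_expect n pr (\<lambda>y. pr i * 1)"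
    by (subst bern_expect_resample[OF i]) simp
  thus ?thesis unfolding bern_expect_cmult bern_expect_1 by simp
qed

lemma KL_eq_softplus_breg: "KL n x f0 f = (1 / real n) * (\<Sum>i<n. softplus_breg (f0 (x i)) (f (x i)))"
proof -
  have "logistic a * ln (logistic a / logistic c) + (1 - logistic a) * ln ((1 - logistic a) / (1 - logistic c)) = softplus_breg a c" for a c
  proof -
    have "ln (logistic a / logistic c) = ln (logistic a) - ln (logistic c)"
      by (rule ln_divide_pos) (auto simp: logistic_pos)
    moreover have "ln ((1 - logistic a) / (1 - logistic c)) = ln (1 - logistic a) - ln (1 - logistic c)"
      using logistic_less_1[of a] logistic_less_1[of c] by (intro ln_divide_pos) auto
    ultimately have "logistic a * ln (logistic a / logistic c) + (1 - logistic a) * ln ((1 - logistic a) / (1 - logistic c))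
       = logistic a * ((a - softplus a) - (c - softplus c)) + (1 - logistic a) * (- softplus a - - softplus c)"
      by (simp only: ln_logistic ln_one_minus_logistic)
    thus ?thesis unfolding softplus_breg_def by (simp add: algebra_simps)
  qed
  thus ?thesis unfolding KL_def pif_def by simp
qed

definition noise :: "nat \<Rightarrow> (nat \<Rightarrow> 'x) \<Rightarrow> ('x \<Rightarrow> real) \<Rightarrow> (nat \<Rightarrow> real) \<Rightarrow> ('x \<Rightarrow> real) \<Rightarrow> real" where
  "noise n x f0 y f = (\<Sum>i<n. (y i - pif f0 (x i)) * (f (x i) - f0 (x i)))"

lemma gamma_n_excess:
  "gamma_n n x y f - gamma_n n x y f0 = KL n x f0 f - noise n x f0 y f / real n"
proof -
  have "gamma_n n x y f - gamma_n n x y f0 = (1 / real n) * (\<Sum>i<n. (softplus (f (x i)) - y i * f (x i)) - (softplus (f0 (x i)) - y i * f0 (x i)))"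
    unfolding gamma_n_def softplus_def by (simp add: sum_subtractf right_diff_distrib)
  also have "\<dots> = (1 / real n) * (\<Sum>i<n. softplus_breg (f0 (x i)) (f (x i)) - (y i - pif f0 (x i)) * (f (x i) - f0 (x i)))"
    by (intro arg_cong2[of _ _ _ _ "(*)"] sum.cong refl) (simp add: softplus_breg_def pif_def algebra_simps)
  also have "\<dots> = KL n x f0 f - noise n x f0 y f / real n"
    unfolding KL_eq_softplus_breg noise_def
    unfolding sum_subtractf[of "\<lambda>i. softplus_breg (f0 (x i)) (f (x i))"] by (simp add: diff_divide_distrib)
  finally show ?thesis .
qed

lemma expect_noise: "bern_expect n (\<lambda>i. pif f0 (x i)) (\<lambda>y. noise n x f0 y f) = 0"
proof -
  define pr where "pr i = pif f0 (x i)" for i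
  have "bern_expect n pr (\<lambda>y. (y i - pr i) * (f (x i) - f0 (x i))) = 0" if i: "i < n" for i
  proof -
    have "bern_expect n pr (\<lambda>y. (y i - pr i) * (f (x i) - f0 (x i)))
       = bern_expect n pr (\<lambda>y. (f (x i) - f0 (x i)) * y i + - (f (x i) - f0 (x i)) * pr i * 1)"
      by (simp add: algebra_simps)
    also have "\<dots> = 0"
      unfolding bern_expect_add bern_expect_cmult bern_expect_1 bern_expect_component[OF i] by (simp add: algebra_simps)
    finally show ?thesis .
  qed
  thus ?thesis unfolding noise_def pr_def[symmetric] bern_expect_sum by simp
qed

text \<open>The log-likelihood ratio of \<open>(f0 + f) / 2\<close> against \<open>f0\<close>.\<close>

definition midpoint_gain :: "nat \<Rightarrow> (nat \<Rightarrow> 'x) \<Rightarrow> ('x \<Rightarrow> real) \<Rightarrow> (nat \<Rightarrow> real) \<Rightarrow> ('x \<Rightarrow> real) \<Rightarrow> real" where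
  "midpoint_gain n x f0 y f = noise n x f0 y f / 2 - (\<Sum>i<n. softplus_breg (f0 (x i)) ((f0 (x i) + f (x i)) / 2))"

text \<open>The midpoint is linear in the dictionary extended by \<open>f0\<close> at index 0, which
  is free because models are subsets of \<open>{1..M}\<close>. In the extended model, with
  \<open>card m + 1\<close> coefficients, \<open>exponential_gain_bound\<close> applies.\<close>

lemma midpoint_gain_expectation:
  fixes phi :: "nat \<Rightarrow> 'x \<Rightarrow> real" and F :: "(nat \<Rightarrow> real) \<Rightarrow> 'x \<Rightarrow> real"
  assumes n: "n \<ge> 1" and f0: "\<And>i. i < n \<Longrightarrow> \<bar>f0 (x i)\<bar> \<le> c1"
    and m: "m \<subseteq> {1..M}" and F: "\<And>y. y \<in> resp_space n \<Longrightarrow> F y \<in> S_m phi m"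
    and cn: "cn = real (n - n div 2) / real n / 2"
  shows "bern_expect n (\<lambda>i. pif f0 (x i)) (\<lambda>y. exp (cn * midpoint_gain n x f0 y (F y)))
     \<le> exp ((1/2 + gap_const / logistic (- c1)) * real (card m + 1))"
proof -
  have fm: "finite m" using m finite_subset by blast
  have "\<forall>y\<in>resp_space n. \<exists>be. F y = (\<lambda>z. \<Sum>j\<in>m. be j * phi j z)" using F unfolding S_m_def by auto
  then obtain be where be: "\<And>y. y \<in> resp_space n \<Longrightarrow> F y = (\<lambda>z. \<Sum>j\<in>m. be y j * phi j z)" by metis
  define I where "I = insert 0 m"
  \<comment> \<open>One box for the coefficients of all outcomes; the summand 1 makes room for the
    coefficient 1/2 of \<open>f0\<close>.\<close>
  define b where "b = 1 + (\<Sum>y\<in>resp_space n. \<Sum>j\<in>m. \<bar>be y j\<bar>)"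
  define v where "v i k = (if k = 0 then f0 (x i) else phi k (x i))" for i k :: nat
  define X where "X y = (\<lambda>k\<in>I. if k = 0 then 1/2 else be y k / 2)" for y
  define pr where "pr i = pif f0 (x i)" for i
  have m0: "0 \<notin> m" using m by auto
  have cI: "card I = card m + 1" unfolding I_def using fm m0 by simp
  have b1: "b \<ge> 1" unfolding b_def by (simp add: sum_nonneg)
  interpret logistic_design n pr "logistic (- c1)" I b v
  proof
    show "finite I" unfolding I_def using fm by simp
    show "b > 0" using b1 by simp
    show "logistic (- c1) > 0" by (rule logistic_pos)
    fix i assume "i < n"
    hence "- c1 \<le> f0 (x i)" "f0 (x i) \<le> c1" using f0[of i] by auto
    thus "logistic (- c1) \<le> pr i \<and> pr i \<le> 1 - logistic (- c1)"
      unfolding pr_def pif_def using logistic_mono[of "-c1" "f0 (x i)"] logistic_mono[of "f0 (x i)" c1] logistic_minus[of c1] by auto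
  qed
  have Xs: "X y \<in> space (box_measure b I)" if y: "y \<in> resp_space n" for y
    unfolding space_box_measure X_def
  proof (rule PiE_I)
    fix k assume k: "k \<in> I"
    show "(\<lambda>k\<in>I. if k = 0 then 1/2 else be y k / 2) k \<in> {-b..b}"
    proof (cases "k = 0")
      case True thus ?thesis using b1 k by simp
    next
      case False
      hence km: "k \<in> m" using k unfolding I_def by simp
      have "\<bar>be y k\<bar> \<le> (\<Sum>j\<in>m. \<bar>be y j\<bar>)" using km fm by (intro member_le_sum) auto
      also have "\<dots> \<le> (\<Sum>y\<in>resp_space n. \<Sum>j\<in>m. \<bar>be y j\<bar>)"
        using y by (intro member_le_sum finite_resp_space) (auto intro: sum_nonneg)
      finally have "\<bar>be y k\<bar> \<le> b" unfolding b_def by simp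
      thus ?thesis using k False by auto
    qed
  qed auto
  have mid: "(\<Sum>k\<in>I. v i k * X y k) = (f0 (x i) + F y (x i)) / 2" if y: "y \<in> resp_space n" for y i
  proof -
    have "(\<Sum>k\<in>I. v i k * X y k) = v i 0 * X y 0 + (\<Sum>k\<in>m. v i k * X y k)"
      unfolding I_def using fm m0 by simp
    also have "(\<Sum>k\<in>m. v i k * X y k) = (\<Sum>k\<in>m. be y k * phi k (x i) / 2)"
      using m0 by (intro sum.cong) (auto simp: v_def X_def I_def)
    also have "\<dots> = F y (x i) / 2" using be[OF y] by (simp add: sum_divide_distrib)
    also have "v i 0 * X y 0 = f0 (x i) / 2" by (simp add: v_def X_def I_def)
    finally show ?thesis by simp
  qed
  have ll: "loglik y {..<n} (X y) = midpoint_gain n x f0 y (F y)" if y: "y \<in> resp_space n" for y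
  proof -
    have "ln (logistic (lf.zeta y i (X y)) / bern_weight pr y i)
       = (y i - pif f0 (x i)) * (F y (x i) - f0 (x i)) / 2 - softplus_breg (f0 (x i)) ((f0 (x i) + F y (x i)) / 2)"
      if i: "i < n" for i
    proof -
      define t where "t = (f0 (x i) + F y (x i)) / 2"
      have Ft: "F y (x i) - f0 (x i) = 2 * (t - f0 (x i))" by (simp add: t_def)
      have z: "lf.zeta y i (X y) = (if y i = 1 then t else - t)"
        using mid[OF y, of i] unfolding lf.zeta_def signed_def t_def by (simp add: sum_negf)
      have yi: "y i = 0 \<or> y i = 1" using y i unfolding resp_space_def by (auto simp: PiE_def Pi_def)
      have "ln (logistic (lf.zeta y i (X y)) / bern_weight pr y i) =
        (if y i = 1 then ln (logistic t) - ln (logistic (f0 (x i))) else ln (1 - logistic t) - ln (1 - logistic (f0 (x i))))"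
        using logistic_less_1[of t] logistic_less_1[of "f0 (x i)"] logistic_pos[of t] logistic_pos[of "f0 (x i)"]
        by (simp add: z bern_weight_def pr_def pif_def logistic_minus ln_divide_pos)
      also have "\<dots> = (y i - pif f0 (x i)) * (t - f0 (x i)) - softplus_breg (f0 (x i)) t"
        using yi unfolding ln_logistic ln_one_minus_logistic softplus_breg_def pif_def by (auto simp: algebra_simps)
      finally show ?thesis unfolding Ft t_def[symmetric] by simp
    qed
    thus ?thesis unfolding loglik_def midpoint_gain_def noise_def by (simp add: sum_subtractf sum_divide_distrib)
  qed
  have "bern_expect n pr (\<lambda>y. exp (cn * midpoint_gain n x f0 y (F y))) = bern_expect n pr (\<lambda>y. exp (cn * loglik y {..<n} (X y)))"
    by (rule bern_expect_cong) (simp add: ll)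
  also have "\<dots> \<le> exp (gain_const * real (card I))" by (rule exponential_gain_bound[OF n Xs cn])
  finally show ?thesis unfolding gain_const_def cI pr_def .
qed

section \<open>Dimension of a model\<close>

lemma sum_fun_apply: "(\<Sum>v\<in>A. g v) z = (\<Sum>v\<in>A. (g v :: 'x \<Rightarrow> real) z)"
  by (induction A rule: infinite_finite_induct) auto

lemma D_m_orthonormal:
  assumes n: "n \<ge> 1" and m: "finite m"
    and on: "\<forall>j\<in>m. \<forall>k\<in>m. inner_n n x (phi j) (phi k) = (if j = k then 1 else 0)"
  shows "D_m phi m = card m"
proof -
  interpret vs: vector_space "\<lambda>(c::real) (f::'x \<Rightarrow> real) z. c * f z"
    by unfold_locales (auto simp: fun_eq_iff algebra_simps)
  have inj: "inj_on phi m"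
  proof (rule inj_onI, rule ccontr)
    fix j k assume "j \<in> m" "k \<in> m" "phi j = phi k" "j \<noteq> k"
    thus False using on by (metis zero_neq_one)
  qed
  have "vs.independent (phi ` m)"
  proof (rule vs.independent_if_scalars_zero)
    fix u v assume z: "(\<Sum>v\<in>phi ` m. (\<lambda>z. u v * v z)) = 0" and v: "v \<in> phi ` m"
    then obtain j where j: "j \<in> m" "v = phi j" by auto
    have "(\<Sum>k\<in>m. u (phi k) * phi k t) = 0" for t
      using fun_cong[OF z, of t] inj by (simp add: sum_fun_apply sum.reindex)
    hence "0 = inner_n n x (\<lambda>t. \<Sum>k\<in>m. u (phi k) * phi k t) (phi j)" unfolding inner_n_def by simp
    also have "\<dots> = (\<Sum>k\<in>m. u (phi k) * inner_n n x (phi k) (phi j))"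
      unfolding inner_n_def sum_distrib_right sum_distrib_left
      by (subst sum.swap) (simp add: mult_ac)
    also have "\<dots> = (\<Sum>k\<in>m. if k = j then u (phi j) else 0)" using on j by (intro sum.cong) auto
    also have "\<dots> = u v" using j m by simp
    finally show "u v = 0" by simp
  qed (use m in auto)
  hence "D_m phi m = card (phi ` m)" unfolding D_m_def by (rule vs.dim_eq_card_independent)
  thus ?thesis using card_image[OF inj] by simp
qed

section \<open>Oracle inequalities\<close>

text \<open>The constant \<open>32 * G + 2\<close> makes half of the penalty, multiplied by
  \<open>cn \<ge> 1/4\<close>, pay for \<open>G * d\<close> and \<open>L * d\<close>:
  \<open>32 / 4 / 8 = 1\<close> covers the exponent of the gain, and
  \<open>2 * 5 / 8 \<ge> 1\<close> leaves \<open>exp (- L * d)\<close> for the sum over models. The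
  factor \<open>exp G\<close> is the price of the extra direction \<open>f0\<close>, and 8 bounds
  \<open>2 / cn\<close>.\<close>

lemma penalised_gain_expectation:
  fixes phi :: "nat \<Rightarrow> 'x \<Rightarrow> real" and F :: "(nat \<Rightarrow> real) \<Rightarrow> 'x \<Rightarrow> real"
  assumes n: "n \<ge> 1" and f0: "\<And>i. i < n \<Longrightarrow> \<bar>f0 (x i)\<bar> \<le> c1"
    and m: "m \<subseteq> {1..M}" and F: "\<And>y. y \<in> resp_space n \<Longrightarrow> F y \<in> S_m phi m"
    and G: "G = 1/2 + gap_const / logistic (- c1)" and L: "L > 0"
    and pen: "pn \<ge> (32 * G + 2) * real (card m) / real n * (1/2 + sqrt (5 * L))\<^sup>2"
    and cn: "cn = real (n - n div 2) / real n / 2"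
  shows "bern_expect n (\<lambda>i. pif f0 (x i)) (\<lambda>y. 2 / cn * exp (cn * midpoint_gain n x f0 y (F y) - cn * real n * pn / 2))
     \<le> 8 * exp G * exp (- L * real (card m))"
proof -
  define d where "d = real (card m)"
  have d0: "d \<ge> 0" unfolding d_def by simp
  have G0: "G > 0" unfolding G gap_const_def using logistic_pos[of "-c1"] by (intro add_pos_nonneg divide_nonneg_pos add_nonneg_nonneg) auto
  have cn4: "cn \<ge> 1/4"
  proof -
    have "real n \<le> 2 * real (n - n div 2)" by linarith
    thus ?thesis unfolding cn using n by (simp add: field_simps)
  qed
  have npn: "real n * pn \<ge> (32 * G + 2) * d * (1/4 + 5 * L)"
  proof -
    have "1/4 + 5 * L \<le> (1/2 + sqrt (5 * L))\<^sup>2"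
      using L by (simp add: power2_sum power2_eq_square[of "1/2::real"])
    hence "(32 * G + 2) * d * (1/4 + 5 * L) \<le> (32 * G + 2) * d * (1/2 + sqrt (5 * L))\<^sup>2"
      using G0 d0 by (intro mult_left_mono) auto
    also have "\<dots> = real n * ((32 * G + 2) * d / real n * (1/2 + sqrt (5 * L))\<^sup>2)" using n by simp
    also have "\<dots> \<le> real n * pn" using pen unfolding d_def by (intro mult_left_mono) auto
    finally show ?thesis .
  qed
  have expo: "G * (d + 1) - cn * real n * pn / 2 \<le> G - L * d"
  proof -
    have p0: "(32 * G + 2) * d * (1/4 + 5 * L) \<ge> 0" using G0 d0 L by (intro mult_nonneg_nonneg) auto
    have "1/4 * ((32 * G + 2) * d * (1/4 + 5 * L)) \<le> cn * (real n * pn)"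
      by (rule mult_mono[OF cn4 npn]) (use cn4 p0 in auto)
    moreover have "8 * (G * d + L * d) \<le> (32 * G + 2) * d * (1/4 + 5 * L)"
    proof -
      have "(32 * G + 2) * d * (1/4 + 5 * L) = 8 * (G * d + L * d) + (160 * (G * (d * L)) + d / 2 + 2 * (d * L))"
        by (simp add: algebra_simps)
      moreover have "0 \<le> 160 * (G * (d * L)) + d / 2 + 2 * (d * L)" using G0 d0 L by (intro add_nonneg_nonneg) auto
      ultimately show ?thesis by linarith
    qed
    ultimately show ?thesis by (simp add: algebra_simps)
  qed
  have "bern_expect n (\<lambda>i. pif f0 (x i)) (\<lambda>y. 2 / cn * exp (cn * midpoint_gain n x f0 y (F y) - cn * real n * pn / 2))
     = 2 / cn * exp (- (cn * real n * pn / 2)) * bern_expect n (\<lambda>i. pif f0 (x i)) (\<lambda>y. exp (cn * midpoint_gain n x f0 y (F y)))"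
    unfolding bern_expect_cmult[symmetric] by (simp add: mult.assoc flip: exp_add)
  also have "\<dots> \<le> 2 / cn * exp (- (cn * real n * pn / 2)) * exp (G * (d + 1))"
    using midpoint_gain_expectation[where x = x and ?f0.0 = f0 and F = F and phi = phi, OF n f0 m F cn] cn4 unfolding G d_def by (intro mult_left_mono) (auto simp: add.commute)
  also have "\<dots> = 2 / cn * exp (G * (d + 1) - cn * real n * pn / 2)" by (simp add: mult.assoc flip: exp_add)
  also have "\<dots> \<le> 8 * exp (G - L * d)"
    using expo cn4 by (intro mult_mono) (auto simp: field_simps)
  also have "\<dots> = 8 * exp G * exp (- L * real (card m))" by (simp add: d_def exp_diff exp_minus field_simps)
  finally show ?thesis .
qed

text \<open>The noise of \<open>f\<close> is twice its midpoint gain plus twice the midpoint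
  divergences. By \<open>softplus_breg_midpoint\<close> the latter use up only the fraction
  \<open>1 - w / 2\<close> of the risk of \<open>f\<close>; the rest stays on the left.\<close>

lemma excess_risk_pointwise:
  assumes n: "n \<ge> 1" and B: "\<And>i. i < n \<Longrightarrow> \<bar>f0 (x i)\<bar> \<le> B" "\<And>i. i < n \<Longrightarrow> \<bar>f (x i)\<bar> \<le> B"
    and w: "w = logistic B * (1 - logistic B)"
    and le: "gamma_n n x y f + pf \<le> gamma_n n x y g + pg"
  shows "w / 2 * KL n x f0 f \<le> KL n x f0 g + pg + (2 * midpoint_gain n x f0 y f - real n * pf) / real n - noise n x f0 y g / real n"
proof -
  define N where "N = noise n x f0 y f / real n"
  define A where "A = (1 / real n) * (\<Sum>i<n. 2 * softplus_breg (f0 (x i)) ((f0 (x i) + f (x i)) / 2))"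
  have "A \<le> (1 / real n) * (\<Sum>i<n. (1 - w / 2) * softplus_breg (f0 (x i)) (f (x i)))"
    unfolding A_def using B w by (intro mult_left_mono sum_mono softplus_breg_midpoint[of _ B]) auto
  also have "\<dots> = (1 - w / 2) * KL n x f0 f" by (simp add: KL_eq_softplus_breg sum_distrib_left[symmetric])
  finally have 1: "A \<le> (1 - w / 2) * KL n x f0 f" .
  have 2: "2 * midpoint_gain n x f0 y f / real n = N - A"
    unfolding midpoint_gain_def N_def A_def sum_distrib_left[symmetric] by (simp add: diff_divide_distrib)
  have 3: "KL n x f0 f - N + pf \<le> KL n x f0 g - noise n x f0 y g / real n + pg"
    using le gamma_n_excess[of n x y f f0] gamma_n_excess[of n x y g f0] unfolding N_def by linarith
  have 4: "(2 * midpoint_gain n x f0 y f - real n * pf) / real n = N - A - pf"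
    using n 2 by (simp add: diff_divide_distrib)
  have "(1 - w / 2) * KL n x f0 f = KL n x f0 f - w / 2 * KL n x f0 f" by (simp add: left_diff_distrib)
  with 1 3 show ?thesis unfolding 4 by linarith
qed

text \<open>The competitor \<open>g\<close> is fixed, so its noise has mean zero. The selected model
  is random: its penalised gain is bounded through \<open>t \<le> exp t\<close>, and then by the sum
  of these exponentials over all models, a union bound in expectation.\<close>

lemma KL_oracle_inequality:
  fixes x :: "nat \<Rightarrow> 'x" and phi :: "nat \<Rightarrow> 'x \<Rightarrow> real"
    and fhat :: "nat set \<Rightarrow> (nat \<Rightarrow> real) \<Rightarrow> 'x \<Rightarrow> real"
  assumes n: "n \<ge> 1" and f0: "\<forall>i<n. \<bar>f0 (x i)\<bar> \<le> c1"
    and on: "\<forall>j\<in>{1..M}. \<forall>k\<in>{1..M}. inner_n n x (phi j) (phi k) = (if j = k then 1 else 0)"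
    and Ms: "Ms \<subseteq> Pow {1..M}"
    and fhat: "\<forall>Y\<in>resp_space n. \<forall>m\<in>Ms.
           fhat m Y \<in> S_m phi m \<inter> Linf n x C0 \<and>
           (\<forall>t\<in>S_m phi m \<inter> Linf n x C0. gamma_n n x Y (fhat m Y) \<le> gamma_n n x Y t)"
    and g: "g \<in> S_m phi m0 \<inter> Linf n x C0" and m0: "m0 \<in> Ms"
    and L: "\<forall>m\<in>Ms. L m > 0"
    and G: "G = 1/2 + gap_const / logistic (- c1)"
    and pen: "\<forall>m\<in>Ms. pen m \<ge> 0 \<and>
           pen m \<ge> (32 * G + 2) * real (D_m phi m) / real n * (1/2 + sqrt (5 * L m))\<^sup>2"
    and mhat: "\<forall>Y\<in>resp_space n. mhat Y \<in> Ms \<and>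
           (\<forall>m\<in>Ms. gamma_n n x Y (fhat (mhat Y) Y) + pen (mhat Y) \<le> gamma_n n x Y (fhat m Y) + pen m)"
    and w: "w = logistic (max c1 C0) * (1 - logistic (max c1 C0))"
  shows "w / 2 * expect n x f0 (\<lambda>Y. KL n x f0 (fhat (mhat Y) Y))
     \<le> KL n x f0 g + pen m0 + 8 * exp G * (\<Sum>m\<in>Ms. exp (- L m * real (D_m phi m))) / real n"
proof -
  define pr where "pr i = pif f0 (x i)" for i
  define cn where "cn = real (n - n div 2) / real n / 2"
  have cn0: "cn > 0"
  proof -
    have "n - n div 2 > 0" using n by linarith
    thus ?thesis unfolding cn_def using n by simp
  qed
  have fMs: "finite Ms" using Ms finite_subset by blast
  have D: "D_m phi m = card m" if "m \<in> Ms" for m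
  proof (rule D_m_orthonormal[OF n])
    have mm: "m \<subseteq> {1..M}" using Ms that by auto
    thus "finite m" using finite_subset by blast
    show "\<forall>j\<in>m. \<forall>k\<in>m. inner_n n x (phi j) (phi k) = (if j = k then 1 else 0)" using on mm by blast
  qed
  define H where "H m y = 2 / cn * exp (cn * midpoint_gain n x f0 y (fhat m y) - cn * real n * pen m / 2)" for m y
  have H0: "H m y \<ge> 0" for m y unfolding H_def using cn0 by simp
  have EH: "bern_expect n pr (H m) \<le> 8 * exp G * exp (- L m * real (D_m phi m))" if m: "m \<in> Ms" for m
    unfolding H_def[abs_def] pr_def D[OF m]
  proof (rule penalised_gain_expectation[OF n _ _ _ G _ _ cn_def])
    show "m \<subseteq> {1..M}" using Ms m by auto
    show "y \<in> resp_space n \<Longrightarrow> fhat m y \<in> S_m phi m" for y using fhat m by auto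
    show "L m > 0" using L m by auto
    show "(32 * G + 2) * real (card m) / real n * (1/2 + sqrt (5 * L m))\<^sup>2 \<le> pen m" using pen m D[OF m] by auto
  qed (use f0 in auto)
  have pw: "w / 2 * KL n x f0 (fhat (mhat y) y) \<le> (KL n x f0 g + pen m0) * 1 + (1 / real n) * (\<Sum>m\<in>Ms. H m y) + - (1 / real n) * noise n x f0 y g"
    if y: "y \<in> resp_space n" for y
  proof -
    define m' where "m' = mhat y"
    have m': "m' \<in> Ms" using mhat y unfolding m'_def by auto
    have "gamma_n n x y (fhat m' y) + pen m' \<le> gamma_n n x y (fhat m0 y) + pen m0"
      using mhat y m0 unfolding m'_def by auto
    moreover have "gamma_n n x y (fhat m0 y) \<le> gamma_n n x y g" using fhat y m0 g by blast
    ultimately have "gamma_n n x y (fhat m' y) + pen m' \<le> gamma_n n x y g + pen m0" by linarith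
    moreover have "\<bar>fhat m' y (x i)\<bar> \<le> max c1 C0" if "i < n" for i
    proof -
      have "fhat m' y \<in> Linf n x C0" using fhat y m' by blast
      thus ?thesis using that unfolding Linf_def by (auto intro: max.coboundedI2)
    qed
    ultimately have "w / 2 * KL n x f0 (fhat m' y) \<le> KL n x f0 g + pen m0
        + (2 * midpoint_gain n x f0 y (fhat m' y) - real n * pen m') / real n - noise n x f0 y g / real n"
      using n f0 w by (intro excess_risk_pointwise[where B = "max c1 C0"]) (auto intro: max.coboundedI1)
    also have "2 * midpoint_gain n x f0 y (fhat m' y) - real n * pen m' \<le> H m' y"
    proof -
      define t where "t = cn * midpoint_gain n x f0 y (fhat m' y) - cn * real n * pen m' / 2"
      have "2 * midpoint_gain n x f0 y (fhat m' y) - real n * pen m' = 2 / cn * t"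
        unfolding t_def using cn0 by (simp add: field_simps)
      also have "\<dots> \<le> 2 / cn * exp t"
      proof (rule mult_left_mono)
        show "t \<le> exp t" using exp_ge_add_one_self[of t] by linarith
      qed (use cn0 in simp)
      finally show ?thesis unfolding H_def t_def .
    qed
    also have "H m' y \<le> (\<Sum>m\<in>Ms. H m y)" using fMs m' H0 by (intro member_le_sum) auto
    finally show ?thesis unfolding m'_def using n by (simp add: divide_right_mono)
  qed
  have prb: "0 \<le> pr i \<and> pr i \<le> 1" for i
    unfolding pr_def pif_def using logistic_pos[of "f0 (x i)"] logistic_less_1[of "f0 (x i)"] by auto
  have "w / 2 * expect n x f0 (\<lambda>Y. KL n x f0 (fhat (mhat Y) Y)) = bern_expect n pr (\<lambda>y. w / 2 * KL n x f0 (fhat (mhat y) y))"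
    unfolding expect_eq_bern_expect pr_def by (rule bern_expect_cmult[symmetric])
  also have "\<dots> \<le> bern_expect n pr (\<lambda>y. (KL n x f0 g + pen m0) * 1 + (1 / real n) * (\<Sum>m\<in>Ms. H m y) + - (1 / real n) * noise n x f0 y g)"
    using prb pw by (intro bern_expect_mono) auto
  also have "\<dots> = KL n x f0 g + pen m0 + (1 / real n) * (\<Sum>m\<in>Ms. bern_expect n pr (H m))"
  proof -
    have "bern_expect n pr (\<lambda>y. noise n x f0 y g) = 0" unfolding pr_def by (rule expect_noise)
    thus ?thesis unfolding bern_expect_add bern_expect_cmult bern_expect_sum bern_expect_1 by simp
  qed
  also have "\<dots> \<le> KL n x f0 g + pen m0 + (1 / real n) * (\<Sum>m\<in>Ms. 8 * exp G * exp (- L m * real (D_m phi m)))"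
    by (intro add_left_mono mult_left_mono sum_mono EH) auto
  finally show ?thesis by (simp add: sum_distrib_left[symmetric])
qed

lemma norm_n_sq_le_KL:
  assumes "\<And>i. i < n \<Longrightarrow> \<bar>f0 (x i)\<bar> \<le> B" "\<And>i. i < n \<Longrightarrow> \<bar>f (x i)\<bar> \<le> B"
    and "w = logistic B * (1 - logistic B)"
  shows "w / 2 * norm_n_sq n x (\<lambda>z. f z - f0 z) \<le> KL n x f0 f"
proof -
  have "w / 2 * norm_n_sq n x (\<lambda>z. f z - f0 z) = (1 / real n) * (\<Sum>i<n. w / 2 * (f (x i) - f0 (x i))\<^sup>2)"
    unfolding norm_n_sq_def sum_distrib_left[symmetric] by simp
  also have "\<dots> \<le> KL n x f0 f"
    unfolding KL_eq_softplus_breg using assms by (intro mult_left_mono sum_mono softplus_breg_lower[of _ B]) auto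
  finally show ?thesis .
qed

lemma KL_le_norm_n_sq: "KL n x f0 f \<le> norm_n_sq n x (\<lambda>z. f0 z - f z)"
proof -
  have "KL n x f0 f \<le> (1 / real n) * (\<Sum>i<n. (f0 (x i) - f (x i))\<^sup>2)"
    unfolding KL_eq_softplus_breg
  proof (intro mult_left_mono sum_mono)
    fix i
    show "softplus_breg (f0 (x i)) (f (x i)) \<le> (f0 (x i) - f (x i))\<^sup>2"
      using softplus_breg_upper[of "f0 (x i)" "f (x i)"] zero_le_power2[of "f0 (x i) - f (x i)"]
      unfolding power2_commute[of "f (x i)"] by linarith
  qed simp
  thus ?thesis unfolding norm_n_sq_def .
qed

lemma le_cmult_INF_add:
  fixes e :: real
  assumes "A \<noteq> {}" "k > 0" "\<And>a. a \<in> A \<Longrightarrow> e \<le> k * h a + r"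
  shows "e \<le> k * (INF a\<in>A. h a) + r"
proof -
  have "(e - r) / k \<le> (INF a\<in>A. h a)"
    using assms by (intro cINF_greatest) (auto simp: field_simps)
  thus ?thesis using assms(2) by (simp add: field_simps)
qed

theorem theorem3p1:
  "\<forall>c1 > (0::real). \<exists>lam > (0::real). \<forall>C0 > (0::real).
     \<exists>C C' C1 C1' :: real. C > 0 \<and> C' > 0 \<and> C1 > 0 \<and> C1' > 0 \<and>
     (\<forall>(n::nat) (x :: nat \<Rightarrow> 'x) (f0 :: 'x \<Rightarrow> real) (M::nat) (phi :: nat \<Rightarrow> 'x \<Rightarrow> real)
        (Ms :: nat set set) (L :: nat set \<Rightarrow> real) (pen :: nat set \<Rightarrow> real)
        (fhat :: nat set \<Rightarrow> (nat \<Rightarrow> real) \<Rightarrow> 'x \<Rightarrow> real) (fm :: nat set \<Rightarrow> 'x \<Rightarrow> real)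
        (mhat :: (nat \<Rightarrow> real) \<Rightarrow> nat set).
        n \<ge> 1 \<longrightarrow>
        (\<forall>i<n. \<bar>f0 (x i)\<bar> \<le> c1) \<longrightarrow>
        (\<forall>j\<in>{1..M}. \<forall>k\<in>{1..M}. inner_n n x (phi j) (phi k) = (if j = k then 1 else 0)) \<longrightarrow>
        Ms \<subseteq> Pow {1..M} \<longrightarrow> Ms \<noteq> {} \<longrightarrow>
        (\<forall>Y\<in>resp_space n. \<forall>m\<in>Ms.
           fhat m Y \<in> S_m phi m \<inter> Linf n x C0 \<and>
           (\<forall>t\<in>S_m phi m \<inter> Linf n x C0. gamma_n n x Y (fhat m Y) \<le> gamma_n n x Y t)) \<longrightarrow>
        (\<forall>m\<in>Ms. fm m \<in> S_m phi m \<inter> Linf n x C0 \<and>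
           (\<forall>t\<in>S_m phi m \<inter> Linf n x C0. gamma n x f0 (fm m) \<le> gamma n x f0 t)) \<longrightarrow>
        (\<forall>m\<in>Ms. L m > 0) \<longrightarrow>
        (\<forall>m\<in>Ms. pen m \<ge> 0 \<and>
           pen m \<ge> lam * real (D_m phi m) / real n * (1/2 + sqrt (5 * L m))\<^sup>2) \<longrightarrow>
        (\<forall>Y\<in>resp_space n. mhat Y \<in> Ms \<and>
           (\<forall>m\<in>Ms. gamma_n n x Y (fhat (mhat Y) Y) + pen (mhat Y)
                     \<le> gamma_n n x Y (fhat m Y) + pen m)) \<longrightarrow>
        (let Sigma = (\<Sum>m\<in>Ms. exp (- L m * real (D_m phi m))) in
          expect n x f0 (\<lambda>Y. KL n x f0 (fhat (mhat Y) Y))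
            \<le> C * (INF m\<in>Ms. KL n x f0 (fm m) + pen m) + C1 * Sigma / real n
          \<and>
          expect n x f0 (\<lambda>Y. norm_n_sq n x (\<lambda>z. fhat (mhat Y) Y z - f0 z))
            \<le> C' * (INF m\<in>Ms. norm_n_sq n x (\<lambda>z. f0 z - fm m z) + pen m) + C1' * Sigma / real n))"
  (is "\<forall>c1>0. \<exists>lam>0. \<forall>C0>0. \<exists>C C' C1 C1'. C > 0 \<and> C' > 0 \<and> C1 > 0 \<and> C1' > 0 \<and> ?Q c1 lam C0 C C' C1 C1'")
proof (intro allI impI)
  fix c1 :: real assume "c1 > 0"
  \<comment> \<open>The label probabilities are at least \<open>logistic (- c1)\<close>, so
    \<open>G\<close>, and with it the penalty constant, depends on \<open>c1\<close> only.\<close>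
  define G where "G = 1/2 + gap_const / logistic (- c1)"
  have G0: "G > 0" unfolding G_def gap_const_def using logistic_pos[of "-c1"]
    by (intro add_pos_nonneg divide_nonneg_pos add_nonneg_nonneg) auto
  have "\<exists>C C' C1 C1'. C > 0 \<and> C' > 0 \<and> C1 > 0 \<and> C1' > 0 \<and> ?Q c1 (32 * G + 2) C0 C C' C1 C1'" for C0
  proof -
    define w where "w = logistic (max c1 C0) * (1 - logistic (max c1 C0))"
    have w0: "w > 0" unfolding w_def using logistic_pos[of "max c1 C0"] logistic_less_1[of "max c1 C0"] by simp
    \<comment> \<open>\<open>C\<close> undoes the factor \<open>w / 2\<close>. It occurs twice for
      the squared norm, which is first bounded by \<open>C\<close> times the divergence.\<close>
    define C where "C = 2 / w"
    define C1 where "C1 = C * (8 * exp G)"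
    have C0: "C > 0" "C1 > 0" unfolding C1_def C_def using w0 by auto
    have "?Q c1 (32 * G + 2) C0 C (C * C) C1 (C * C1)"
    proof (intro allI impI)
      fix n :: nat and x :: "nat \<Rightarrow> 'x" and f0 :: "'x \<Rightarrow> real" and M :: nat and phi :: "nat \<Rightarrow> 'x \<Rightarrow> real"
        and Ms :: "nat set set" and L pen :: "nat set \<Rightarrow> real"
        and fhat :: "nat set \<Rightarrow> (nat \<Rightarrow> real) \<Rightarrow> 'x \<Rightarrow> real" and fm :: "nat set \<Rightarrow> 'x \<Rightarrow> real"
        and mhat :: "(nat \<Rightarrow> real) \<Rightarrow> nat set"
      assume n: "1 \<le> n" and f0: "\<forall>i<n. \<bar>f0 (x i)\<bar> \<le> c1"
        and on: "\<forall>j\<in>{1..M}. \<forall>k\<in>{1..M}. inner_n n x (phi j) (phi k) = (if j = k then 1 else 0)"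
        and Ms: "Ms \<subseteq> Pow {1..M}" "Ms \<noteq> {}"
        and fhat: "\<forall>Y\<in>resp_space n. \<forall>m\<in>Ms. fhat m Y \<in> S_m phi m \<inter> Linf n x C0 \<and>
           (\<forall>t\<in>S_m phi m \<inter> Linf n x C0. gamma_n n x Y (fhat m Y) \<le> gamma_n n x Y t)"
        and fm: "\<forall>m\<in>Ms. fm m \<in> S_m phi m \<inter> Linf n x C0 \<and>
           (\<forall>t\<in>S_m phi m \<inter> Linf n x C0. gamma n x f0 (fm m) \<le> gamma n x f0 t)"
        and L: "\<forall>m\<in>Ms. L m > 0"
        and pen: "\<forall>m\<in>Ms. pen m \<ge> 0 \<and> pen m \<ge> (32 * G + 2) * real (D_m phi m) / real n * (1/2 + sqrt (5 * L m))\<^sup>2"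
        and mhat: "\<forall>Y\<in>resp_space n. mhat Y \<in> Ms \<and>
           (\<forall>m\<in>Ms. gamma_n n x Y (fhat (mhat Y) Y) + pen (mhat Y) \<le> gamma_n n x Y (fhat m Y) + pen m)"
      define Sigma where "Sigma = (\<Sum>m\<in>Ms. exp (- L m * real (D_m phi m)))"
      define E where "E = expect n x f0 (\<lambda>Y. KL n x f0 (fhat (mhat Y) Y))"
      define N where "N = expect n x f0 (\<lambda>Y. norm_n_sq n x (\<lambda>z. fhat (mhat Y) Y z - f0 z))"
      have each: "E \<le> C * (KL n x f0 (fm m) + pen m) + C1 * Sigma / real n" if m: "m \<in> Ms" for m
      proof -
        have "w / 2 * E \<le> KL n x f0 (fm m) + pen m + 8 * exp G * Sigma / real n"
          unfolding E_def Sigma_def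
          by (rule KL_oracle_inequality[OF n f0 on Ms(1) fhat _ m L G_def pen mhat w_def]) (use fm m in blast)
        hence "C * (w / 2 * E) \<le> C * (KL n x f0 (fm m) + pen m + 8 * exp G * Sigma / real n)"
          using C0 by (intro mult_left_mono) auto
        also have "C * (w / 2 * E) = E" unfolding C_def using w0 by simp
        finally show ?thesis unfolding C1_def by (simp add: distrib_left mult.assoc)
      qed
      have NE: "N \<le> C * E"
      proof -
        have "N \<le> bern_expect n (\<lambda>i. pif f0 (x i)) (\<lambda>Y. C * KL n x f0 (fhat (mhat Y) Y))"
          unfolding N_def expect_eq_bern_expect
        proof (rule bern_expect_mono)
          show "0 \<le> pif f0 (x i) \<and> pif f0 (x i) \<le> 1" for i
            unfolding pif_def using logistic_pos[of "f0 (x i)"] logistic_less_1[of "f0 (x i)"] by auto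
          fix Y assume Y: "Y \<in> resp_space n"
          have "fhat (mhat Y) Y \<in> Linf n x C0" using fhat mhat Y by blast
          hence "w / 2 * norm_n_sq n x (\<lambda>z. fhat (mhat Y) Y z - f0 z) \<le> KL n x f0 (fhat (mhat Y) Y)"
            using f0 by (intro norm_n_sq_le_KL[OF _ _ w_def]) (auto simp: Linf_def intro: max.coboundedI1 max.coboundedI2)
          thus "norm_n_sq n x (\<lambda>z. fhat (mhat Y) Y z - f0 z) \<le> C * KL n x f0 (fhat (mhat Y) Y)"
            unfolding C_def using w0 by (simp add: field_simps)
        qed
        thus ?thesis unfolding E_def expect_eq_bern_expect bern_expect_cmult .
      qed
      have eachN: "N \<le> C * C * (norm_n_sq n x (\<lambda>z. f0 z - fm m z) + pen m) + C * C1 * Sigma / real n" if m: "m \<in> Ms" for m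
      proof -
        note NE
        also have "C * E \<le> C * (C * (norm_n_sq n x (\<lambda>z. f0 z - fm m z) + pen m) + C1 * Sigma / real n)"
        proof (rule mult_left_mono)
          have "C * (KL n x f0 (fm m) + pen m) \<le> C * (norm_n_sq n x (\<lambda>z. f0 z - fm m z) + pen m)"
            using C0 KL_le_norm_n_sq[of n x f0 "fm m"] by (intro mult_left_mono) auto
          thus "E \<le> C * (norm_n_sq n x (\<lambda>z. f0 z - fm m z) + pen m) + C1 * Sigma / real n"
            using each[OF m] by linarith
        qed (use C0 in simp)
        finally show ?thesis by (simp add: distrib_left mult.assoc)
      qed
      have "E \<le> C * (INF m\<in>Ms. KL n x f0 (fm m) + pen m) + C1 * Sigma / real n"
        by (rule le_cmult_INF_add[OF Ms(2) C0(1) each])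
      moreover have "N \<le> C * C * (INF m\<in>Ms. norm_n_sq n x (\<lambda>z. f0 z - fm m z) + pen m) + C * C1 * Sigma / real n"
        by (rule le_cmult_INF_add[OF Ms(2) _ eachN]) (use C0 in simp)
      ultimately show "let Sigma = (\<Sum>m\<in>Ms. exp (- L m * real (D_m phi m))) in
          expect n x f0 (\<lambda>Y. KL n x f0 (fhat (mhat Y) Y))
            \<le> C * (INF m\<in>Ms. KL n x f0 (fm m) + pen m) + C1 * Sigma / real n
          \<and>
          expect n x f0 (\<lambda>Y. norm_n_sq n x (\<lambda>z. fhat (mhat Y) Y z - f0 z))
            \<le> C * C * (INF m\<in>Ms. norm_n_sq n x (\<lambda>z. f0 z - fm m z) + pen m) + C * C1 * Sigma / real n"
        unfolding Let_def E_def N_def Sigma_def by blast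
    qed
    moreover have "C * C > 0" "C * C1 > 0" using C0 by auto
    ultimately show ?thesis using C0 by blast
  qed
  thus "\<exists>lam>0. \<forall>C0>0. \<exists>C C' C1 C1'. C > 0 \<and> C' > 0 \<and> C1 > 0 \<and> C1' > 0 \<and> ?Q c1 lam C0 C C' C1 C1'"
    using G0 by (intro exI[of _ "32 * G + 2"]) auto
qed

end
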